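(* Let $k\ge2$ be an integer, and let $\mathbb T_n$ be a path with $n$ vertices labelled $1,\dots,n$ from the root to the leaf (so it is rooted at an end vertex). Then its $k$-cut number satisfies $$n^{-1+1/k}\,\mathcal K(\mathbb T_n)\xrightarrow{d}Z_{\rm path}\quad\text{as } n\to\infty,$$ where $Z_{\rm path}$ is a non-degenerate random variable whose law is determined entirely by its moments $\mathbb E[Z_{\rm path}^q]=m_q(f)$, $q\in\mathbb Z_{\ge0}$, with $$f(t)=\begin{cases}2t,& t\in[0,1/2],\\ 2-2t,& t\in(1/2,1].\end{cases}$$
   Context: The $k$-cut number $\mathcal K(T)$ of a finite rooted tree $T$ is the random total number of cuts made in the following procedure. Step 1: choose a vertex uniformly at random from the component that currently contains the root and cut it once. Step 2: if this vertex has now been cut $k$ times, remove it together with the edges attached to it. Step 3: if the root has been removed, stop; otherwise go to Step 1. For $f:[0,1]\to\mathbb R_+$ and $t_1,\dots,t_q\in[0,1]$ put $$L_f(t_1,\dots,t_q):=\sum_{i=1}^q f(t_{(i)})-\sum_{i=1}^{q-1}\inf_{t\in[t_{(i)},t_{(i+1)}]}f(t),$$ where $t_{(1)}\le\dots\le t_{(q)}$ is the nondecreasing rearrangement of $t_1,\dots,t_q$. Put $D_f(t_1):=L_f(t_1)$ and $D_f(t_1,\dots,t_q):=L_f(t_1,\dots,t_q)-L_f(t_1,\dots,t_{q-1})$ for $q\ge2$. Define $m_0(f):=1$ and, for $q\ge1$, $$m_q(f):=q!\int_{[0,1]^q}\int_0^\infty\int_0^{x_1}\cdots\int_0^{x_{q-1}}\exp\Big(-\frac1{k!}\sum_{i=1}^qD_f(t_1,\dots,t_i)\,x_i^k\Big)\,dx_q\cdots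 dx_1\,dt_q\cdots dt_1 .$$ *)

theory Defs
  imports "HOL-Probability.Probability"
begin

definition root_component :: "'a set \<Rightarrow> 'a set set \<Rightarrow> 'a \<Rightarrow> 'a set" where
  "root_component V E r = {v \<in> V. (r, v) \<in> {(u, w). {u, w} \<in> E}\<^sup>*}"

lemma root_component_simps:
  assumes "r \<in> V" "finite V"
  shows "root_component V E r \<noteq> {}" "finite (root_component V E r)" "root_component V E r \<subseteq> V"
  using assms by (auto simp: root_component_def)

text \<open>
  The law of the number of cuts still to be made, when the remaining graph has vertices \<open>V\<close> and
  edges \<open>E\<close> (sets of two vertices), the root is \<open>r\<close>, and each vertex \<open>v\<close> has been cut \<open>c v\<close> times
  so far. All remaining vertices of a run started with \<open>c = (\<lambda>_. 0)\<close> and \<open>k \<ge> 1\<close> satisfy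
  \<open>c v < k\<close>, so the test \<open>k \<le> c' v\<close> means \<open>c' v = k\<close> there; the inequality makes the
  recursion terminate for all arguments.
\<close>

function remaining_cuts ::
    "nat \<Rightarrow> 'a set \<Rightarrow> 'a set set \<Rightarrow> 'a \<Rightarrow> ('a \<Rightarrow> nat) \<Rightarrow> nat pmf" where
  "remaining_cuts k V E r c =
    (if r \<in> V \<and> finite V then
       bind_pmf (pmf_of_set (root_component V E r)) (\<lambda>v.
         let c' = c(v := Suc (c v)) in
         map_pmf Suc
           (if k \<le> c' v
            then remaining_cuts k (V - {v}) {e \<in> E. v \<notin> e} r c'
            else remaining_cuts k V E r c'))
     else return_pmf 0)"
  by pat_completeness auto

termination
proof (relation "Wellfounded.measure (\<lambda>(k, V, E, r, c). card V + (\<Sum>v\<in>V. k - c v))", goal_cases)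
  case 1
  show ?case by simp
next
  case (2 k V E r c v c')
  then have v: "v \<in> V" and fin: "finite V"
    using root_component_simps[of r V E] by auto
  have "(\<Sum>w\<in>V - {v}. k - c' w) \<le> (\<Sum>w\<in>V. k - c w)"
    using fin 2 by (intro order.trans[OF sum_mono sum_mono2]) auto
  moreover have "card (V - {v}) < card V"
    using v fin by (rule card_Diff1_less[rotated])
  ultimately show ?case by simp
next
  case (3 k V E r c v c')
  then have v: "v \<in> V" and fin: "finite V"
    using root_component_simps[of r V E] by auto
  have "(\<Sum>w\<in>V. k - c' w) < (\<Sum>w\<in>V. k - c w)"
    using fin v 3 by (intro sum_strict_mono_ex1) auto
  then show ?case by simp
qed

declare remaining_cuts.simps [simp del]

definition kcut_number :: "nat \<Rightarrow> 'a set \<Rightarrow> 'a set set \<Rightarrow> 'a \<Rightarrow> nat pmf" where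
  "kcut_number k V E r = remaining_cuts k V E r (\<lambda>_. 0)"

definition path_kcut_number :: "nat \<Rightarrow> nat \<Rightarrow> nat pmf" where
  "path_kcut_number k n = kcut_number k {1..n} {{i, Suc i} | i. 1 \<le> i \<and> i < n} 1"

definition L_fun :: "(real \<Rightarrow> real) \<Rightarrow> real list \<Rightarrow> real" where
  "L_fun f ts = (let s = sort ts in
     (\<Sum>i<length ts. f (s ! i)) - (\<Sum>i<length ts - 1. INF t\<in>{s ! i..s ! Suc i}. f t))"

definition D_fun :: "(real \<Rightarrow> real) \<Rightarrow> real list \<Rightarrow> real" where
  "D_fun f ts = (if length ts = 1 then L_fun f ts else L_fun f ts - L_fun f (butlast ts))"

text \<open>Iterated integral over \<open>[0,1]^q\<close>, with the first coordinate outermost.\<close>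

primrec cube_integral :: "nat \<Rightarrow> (real list \<Rightarrow> ennreal) \<Rightarrow> ennreal" where
  "cube_integral 0 g = g []"
| "cube_integral (Suc q) g = (\<integral>\<^sup>+t\<in>{0..1}. cube_integral q (\<lambda>ts. g (t # ts)) \<partial>lborel)"

text \<open>
  Iterated integral in which the first (outermost) variable ranges over \<open>S\<close> and each further
  one over the interval from 0 to the preceding variable.
\<close>

primrec decreasing_integral :: "nat \<Rightarrow> real set \<Rightarrow> (real list \<Rightarrow> ennreal) \<Rightarrow> ennreal" where
  "decreasing_integral 0 S g = g []"
| "decreasing_integral (Suc q) S g =
     (\<integral>\<^sup>+x\<in>S. decreasing_integral q {0..x} (\<lambda>xs. g (x # xs)) \<partial>lborel)"

text \<open>
  \<open>moment_fun k f q\<close> is \<open>m\<^sub>q(f)\<close>. The lists are indexed from 0, so \<open>xs ! i\<close> is \<open>x\<^sub>i\<^sub>+\<^sub>1\<close>, and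
  \<open>D_fun f (take (Suc i) ts)\<close> is \<open>D\<^sub>f(t\<^sub>1,\<dots>,t\<^sub>i\<^sub>+\<^sub>1)\<close>.
\<close>

definition moment_fun :: "nat \<Rightarrow> (real \<Rightarrow> real) \<Rightarrow> nat \<Rightarrow> ennreal" where
  "moment_fun k f q =
    (if q = 0 then 1
     else fact q * cube_integral q (\<lambda>ts. decreasing_integral q {0..} (\<lambda>xs.
            ennreal (exp (- (1 / fact k) * (\<Sum>i<q. D_fun f (take (Suc i) ts) * (xs ! i) ^ k))))))"

definition has_moments :: "real measure \<Rightarrow> (nat \<Rightarrow> ennreal) \<Rightarrow> bool" where
  "has_moments \<mu> a \<longleftrightarrow>
    (\<forall>q. a q < \<infinity> \<and> integrable \<mu> (\<lambda>x. x ^ q) \<and> (\<integral>x. x ^ q \<partial>\<mu>) = enn2real (a q))"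

definition nondegenerate :: "real measure \<Rightarrow> bool" where
  "nondegenerate \<mu> \<longleftrightarrow> \<not> (\<exists>c. AE x in \<mu>. x = c)"

definition path_f :: "real \<Rightarrow> real" where
  "path_f t = (if t \<le> 1 / 2 then 2 * t else 2 - 2 * t)"

end

theory Submission imports Defs begin

text \<open>
  Give every vertex a unit-rate Poisson clock and cut it at the first \<open>k\<close> rings, as long as it is still
  connected to the root; by memorylessness the number of cuts is the \<open>k\<close>-cut number. On a path,
  vertex \<open>v\<close> is disconnected at the minimum \<open>M\<^sub>v\<close> of the \<open>k\<close>-th ring times of its predecessors, which
  are i.i.d. Erlang variables, and given \<open>M\<^sub>v = x\<close> it contributes \<open>min k Poisson(x) = x + O(x\<^sup>2)\<close> cuts.
  A telescoping argument on characteristic functions replaces the number of cuts by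
  \<open>\<Sum>\<^sub>v min 1 M\<^sub>v\<close> with an error of smaller order than \<open>n\<close> to the power \<open>1 - 1/k\<close>.

  After scaling, this sum is \<open>X = \<integral> \<phi>(x) dx\<close>, where \<open>\<phi>(x)\<close> is the fraction of vertices whose scaled minimum
  exceeds \<open>x\<close>. Since \<open>X\<close> to the power \<open>q\<close> is \<open>q!\<close> times the integral of \<open>\<phi>(x\<^sub>1) \<dots> \<phi>(x\<^sub>q)\<close> over decreasing
  \<open>x\<close>, its moments are integrals of probabilities \<open>P(Y(t\<^sub>i) > x\<^sub>i for all i)\<close>, which converge to the
  exponential in \<open>m\<^sub>q(f)\<close>, because \<open>L\<^sub>f\<close> is a maximum for the tent function \<open>f\<close>. Bounding each such
  probability by a geometric mean of one-point probabilities gives dominated convergence and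
  \<open>m\<^sub>q(f) \<le> (C \<surd>q)\<^sup>q\<close>, so that the moments determine the law and the method of moments applies.
\<close>

section \<open>The method of moments\<close>

text \<open>No probability space carries both the cutting process and the clocks:
  \<open>remaining_cuts\<close> is a discrete recursion, so the passage to continuous time is
  analytic. \<open>cut_gf\<close> is built from one integral operator per vertex and solves a linear
  system in the time \<open>x\<close>; its equilibrium for \<open>x\<close> tending to infinity is
  the one-step recursion with a uniformly chosen vertex. The same operator at \<open>s = 1\<close>
  averages over the ring time of a single vertex, so both sides of the comparison obey recursions in
  the number of vertices and can be subtracted without a coupling. The cap at 1 serves two purposes:
  the capped sum no longer depends on the horizon once it exceeds 1, and the second-order errors
  stay bounded at vertices with a large minimum. Few vertices have one, since their expected number
  above a fixed level is at most a convergent geometric series. A path places its vertices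
  uniformly, not along a tent; \<open>path_f\<close> can enter because the tent map preserves
  Lebesgue measure.\<close>

lemma (in real_distribution) char_moment_sum:
  assumes "\<And>q. integrable M (\<lambda>x. x ^ q)"
    and "(\<lambda>p. t ^ (2 * p) * (\<integral>x. x ^ (2 * p) \<partial>M) / fact (2 * p)) \<longlonglongrightarrow> 0"
  shows "(\<lambda>p. \<Sum>j\<le>2 * p. (\<i> * t) ^ j / fact j * (\<integral>x. x ^ j \<partial>M)) \<longlonglongrightarrow> char M t"
proof -
  let ?S = "\<lambda>p. \<Sum>j\<le>2 * p. (\<i> * t) ^ j / fact j * (\<integral>x. x ^ j \<partial>M)"
  have lim: "(\<lambda>p. 2 * (t ^ (2 * p) * (\<integral>x. x ^ (2 * p) \<partial>M) / fact (2 * p))) \<longlonglongrightarrow> 0"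
    using tendsto_mult[OF tendsto_const[of 2] assms(2)] by simp
  \<comment> \<open>The Taylor remainder is bounded by an absolute moment; at the even order
    \<open>2 * p\<close> this is an ordinary moment.\<close>
  have le: "cmod (char M t - (?S p))
      \<le> 2 * (t ^ (2 * p) * (\<integral>x. x ^ (2 * p) \<partial>M) / fact (2 * p))" for p
    using char_approx1[of "2 * p" t] assms(1) by (simp add: power_even_abs)
  have "(\<lambda>p. char M t - (?S p)) \<longlonglongrightarrow> 0"
    by (rule Lim_null_comparison[OF always_eventually lim]) (rule allI, rule le)
  from tendsto_diff[OF tendsto_const[of "char M t"] this] show ?thesis by simp
qed

text \<open>The growth condition holds for every real \<open>t\<close>, so the Taylor sums recover
  the characteristic function on the whole line, and these sums depend on the moments only.\<close>

lemma moments_determine_distribution: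
  assumes "real_distribution M" "real_distribution N"
    and "\<And>q. integrable M (\<lambda>x. x ^ q)" "\<And>q. integrable N (\<lambda>x. x ^ q)"
    and "\<And>q. (\<integral>x. x ^ q \<partial>M) = a q" "\<And>q. (\<integral>x. x ^ q \<partial>N) = a q"
    and "\<And>t. (\<lambda>p. t ^ (2 * p) * a (2 * p) / fact (2 * p)) \<longlonglongrightarrow> 0"
  shows "M = N"
proof (rule Levy_uniqueness)
  show "char M = char N"
  proof
    fix t
    show "char M t = char N t"
      using real_distribution.char_moment_sum[OF assms(1), of t]
        real_distribution.char_moment_sum[OF assms(2), of t] assms
      by (intro LIMSEQ_unique[of _ "char M t" "char N t"]) auto
  qed
qed fact+

section \<open>Truncation and moments of weak limits\<close>

definition clip :: "real \<Rightarrow> real \<Rightarrow> real" where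
  "clip R x = max (- R) (min R x)"

lemma clip_measurable [measurable]: "clip R \<in> borel_measurable borel"
  unfolding clip_def[abs_def] by measurable

lemma abs_clip_le: "R \<ge> 0 \<Longrightarrow> \<bar>clip R x\<bar> \<le> R"
  by (auto simp: clip_def)

lemma abs_clip_le_abs: "R \<ge> 0 \<Longrightarrow> \<bar>clip R x\<bar> \<le> \<bar>x\<bar>"
  by (auto simp: clip_def)

text \<open>Beyond \<open>R\<close> each factor \<open>R\<close> is at most
  \<open>\<bar>x\<bar>\<close>, so the loss is paid for by the moment of twice the order. Moments
  are bounded uniformly along the sequence, hence so is the truncation error.\<close>

lemma clip_diff_bound:
  assumes "R > 0"
  shows "\<bar>x ^ q - clip R x ^ q\<bar> \<le> 2 * x ^ (2 * q) / R ^ q"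
proof (cases "\<bar>x\<bar> \<le> R")
  case True
  then have "clip R x = x" by (auto simp: clip_def)
  then show ?thesis using assms by (simp add: power_mult)
next
  case False
  have "\<bar>clip R x\<bar> ^ q \<le> \<bar>x\<bar> ^ q"
    using assms abs_clip_le_abs[of R x] by (intro power_mono) auto
  then have 1: "\<bar>x ^ q - clip R x ^ q\<bar> \<le> 2 * \<bar>x\<bar> ^ q"
    using abs_triangle_ineq4[of "x ^ q" "clip R x ^ q"] by (simp add: power_abs)
  have "\<bar>x\<bar> ^ q * R ^ q \<le> \<bar>x\<bar> ^ q * \<bar>x\<bar> ^ q"
    using False assms by (intro mult_left_mono power_mono) auto
  also have "\<dots> = x ^ (2 * q)"
    by (simp add: power_mult power2_eq_square flip: power_mult_distrib)
  finally have "2 * \<bar>x\<bar> ^ q \<le> 2 * x ^ (2 * q) / R ^ q"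
    using assms by (simp add: pos_le_divide_eq)
  with 1 show ?thesis by linarith
qed

text \<open>Weak convergence tests bounded continuous functions, so it passes to the limit for
  powers of \<open>clip R\<close>. Integrability comes first, for even powers; the values follow by
  letting \<open>R\<close> grow with an error uniform in \<open>n\<close>.\<close>

lemma weak_conv_moments:
  assumes rd: "\<And>n. real_distribution (\<mu> n)" "real_distribution M"
    and wc: "weak_conv_m \<mu> M"
    and int: "\<And>n q. integrable (\<mu> n) (\<lambda>x. x ^ q)"
    and B: "\<And>n q. (\<integral>x. x ^ q \<partial>\<mu> n) \<le> B q"
    and lim: "\<And>q. (\<lambda>n. \<integral>x. x ^ q \<partial>\<mu> n) \<longlonglongrightarrow> a q"
  shows "integrable M (\<lambda>x. x ^ q)" "(\<integral>x. x ^ q \<partial>M) = a q"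
proof -
  interpret \<mu>: real_distribution "\<mu> n" for n by (rule rd)
  interpret M: real_distribution M by (rule rd)
  have clip_lim: "(\<lambda>n. \<integral>x. clip R x ^ q \<partial>\<mu> n) \<longlonglongrightarrow> (\<integral>x. clip R x ^ q \<partial>M)" if "R \<ge> 0" for R q
  proof (rule weak_conv_imp_integral_bdd_continuous_conv[OF rd wc, where B = "R ^ q"])
    show "\<And>x. isCont (\<lambda>x. clip R x ^ q) x" unfolding clip_def by (intro continuous_intros)
    show "\<And>x. norm (clip R x ^ q) \<le> R ^ q"
      using that abs_clip_le[of R] by (auto simp: power_abs intro!: power_mono)
  qed
  have int_clip: "integrable (\<mu> n) (\<lambda>x. clip R x ^ q)" "integrable M (\<lambda>x. clip R x ^ q)"
    if "R \<ge> 0" for R q n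
  proof -
    have "norm (clip R x ^ q) \<le> R ^ q" for x
      using that abs_clip_le[of R x] by (auto simp: power_abs intro!: power_mono)
    then show "integrable (\<mu> n) (\<lambda>x. clip R x ^ q)" "integrable M (\<lambda>x. clip R x ^ q)"
      by (auto intro: \<mu>.integrable_const_bound[where B = "R ^ q"]
        M.integrable_const_bound[where B = "R ^ q"])
  qed
  have even: "integrable M (\<lambda>x. x ^ (2 * p))" for p
  proof -
    have le: "(\<integral>x. clip R x ^ (2 * p) \<partial>M) \<le> B (2 * p)" if "R \<ge> 0" for R
    proof (rule LIMSEQ_le_const2[OF clip_lim[OF that]], intro exI allI impI)
      fix n
      have "(\<integral>x. clip R x ^ (2 * p) \<partial>\<mu> n) \<le> (\<integral>x. x ^ (2 * p) \<partial>\<mu> n)"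
        using that by (intro integral_mono int_clip int)
          (auto intro!: power_mono_even abs_clip_le_abs)
      then show "(\<integral>x. clip R x ^ (2 * p) \<partial>\<mu> n) \<le> B (2 * p)" using B order.trans by blast
    qed
    have "(\<integral>\<^sup>+x. ennreal (x ^ (2 * p)) \<partial>M) =
        (\<integral>\<^sup>+x. liminf (\<lambda>m. ennreal (clip (real m) x ^ (2 * p))) \<partial>M)"
    proof (intro nn_integral_cong lim_imp_Liminf[symmetric])
      fix x :: real
      obtain N where N: "\<bar>x\<bar> \<le> real N" using real_arch_simple by blast
      have "eventually (\<lambda>m. clip (real m) x = x) sequentially"
        using eventually_ge_at_top[of N]
      proof eventually_elim
        case (elim m)
        then have "real N \<le> real m" by simp
        with N have "- real m \<le> x" "x \<le> real m" by linarith+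
        then show ?case by (simp add: clip_def)
      qed
      then show "((\<lambda>m. ennreal (clip (real m) x ^ (2 * p))) \<longlongrightarrow> ennreal (x ^ (2 * p))) sequentially"
        by (rule tendsto_eventually[OF eventually_mono]) simp
    qed auto
    \<comment> \<open>Fatou's lemma over the truncation levels; each truncated moment of
      \<open>M\<close> is a limit of truncated moments of \<open>\<mu> n\<close> and inherits their
      bound.\<close>
    also have "\<dots> \<le> liminf (\<lambda>m. \<integral>\<^sup>+x. ennreal (clip (real m) x ^ (2 * p)) \<partial>M)"
      by (intro nn_integral_liminf) auto
    also have "\<dots> \<le> liminf (\<lambda>m::nat. ennreal (B (2 * p)))"
    proof (intro Liminf_mono always_eventually allI)
      fix m :: nat
      have "(\<integral>\<^sup>+x. ennreal (clip (real m) x ^ (2 * p)) \<partial>M) =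
          ennreal (\<integral>x. clip (real m) x ^ (2 * p) \<partial>M)"
        by (intro nn_integral_eq_integral int_clip) auto
      also have "\<dots> \<le> ennreal (B (2 * p))" by (intro ennreal_leI le) auto
      finally show "(\<integral>\<^sup>+x. ennreal (clip (real m) x ^ (2 * p)) \<partial>M) \<le> ennreal (B (2 * p))" .
    qed
    finally have "(\<integral>\<^sup>+x. ennreal (x ^ (2 * p)) \<partial>M) < \<infinity>"
      by (simp add: Liminf_const) (metis ennreal_less_top le_less_trans)
    then show ?thesis by (intro integrableI_bounded) auto
  qed
  show intM: "integrable M (\<lambda>x. x ^ q)" for q
  proof (rule Bochner_Integration.integrable_bound)
    show "integrable M (\<lambda>x. 1 + x ^ (2 * q))" using even[of q] by auto
    have y: "y \<le> 1 + y\<^sup>2" for y :: real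
      using zero_le_power2[of "y - 1"] by (simp add: power2_diff)
        (smt (verit) zero_le_power2)
    have "norm (x ^ q) \<le> norm (1 + x ^ (2 * q))" for x :: real
      using y[of "\<bar>x ^ q\<bar>"] by (simp add: power_mult[symmetric] power2_abs mult.commute)
    then show "AE x in M. norm (x ^ q) \<le> norm (1 + x ^ (2 * q))" by auto
  qed auto
  show "(\<integral>x. x ^ q \<partial>M) = a q"
  \<comment> \<open>For \<open>q = 0\<close> the error bound \<open>2 * C / real R ^ q\<close> does
    not decay, so total masses are compared directly.\<close>
  proof (cases "q = 0")
    case True
    then have "a 0 = 1" using lim[of 0] by (simp add: \<mu>.prob_space[unfolded \<mu>.space_eq_univ] LIMSEQ_const_iff)
    then show ?thesis using True M.prob_space by simp
  next
    case q: False
    define C where "C = \<bar>B (2 * q)\<bar> + (\<integral>x. x ^ (2 * q) \<partial>M)"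
    have clip_err: "\<bar>(\<integral>x. x ^ q \<partial>N) - (\<integral>x. clip R x ^ q \<partial>N)\<bar> \<le> 2 * (\<integral>x. x ^ (2 * q) \<partial>N) / R ^ q"
      if "R > 0" "\<And>j. integrable N (\<lambda>x. x ^ j)" "integrable N (\<lambda>x. clip R x ^ q)" for R N
    proof -
      have "\<bar>(\<integral>x. x ^ q \<partial>N) - (\<integral>x. clip R x ^ q \<partial>N)\<bar> = \<bar>\<integral>x. x ^ q - clip R x ^ q \<partial>N\<bar>"
        using that by simp
      also have "\<dots> \<le> (\<integral>x. \<bar>x ^ q - clip R x ^ q\<bar> \<partial>N)" by (rule integral_abs_bound)
      also have "\<dots> \<le> (\<integral>x. 2 * x ^ (2 * q) / R ^ q \<partial>N)"
        using that by (intro integral_mono clip_diff_bound integrable_abs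
            Bochner_Integration.integrable_diff) auto
      finally show ?thesis by simp
    qed
    have le: "\<bar>(\<integral>x. x ^ q \<partial>M) - a q\<bar> \<le> 2 * C / real R ^ q" if R: "R > 0" for R :: nat
    proof -
      have "\<bar>a q - (\<integral>x. clip R x ^ q \<partial>M)\<bar> \<le> 2 * \<bar>B (2 * q)\<bar> / real R ^ q"
      proof (rule LIMSEQ_le_const2)
        show "(\<lambda>n. \<bar>(\<integral>x. x ^ q \<partial>\<mu> n) - (\<integral>x. clip R x ^ q \<partial>\<mu> n)\<bar>) \<longlonglongrightarrow>
            \<bar>a q - (\<integral>x. clip R x ^ q \<partial>M)\<bar>"
          by (intro tendsto_intros lim clip_lim) auto
        have B_le: "2 * (\<integral>x. x ^ (2 * q) \<partial>\<mu> n) / real R ^ q \<le> 2 * \<bar>B (2 * q)\<bar> / real R ^ q" for n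
          using B[of n "2 * q"] by (intro divide_right_mono mult_left_mono) auto
        show "\<exists>N. \<forall>n\<ge>N. \<bar>(\<integral>x. x ^ q \<partial>\<mu> n) - (\<integral>x. clip R x ^ q \<partial>\<mu> n)\<bar> \<le>
            2 * \<bar>B (2 * q)\<bar> / real R ^ q"
          using R by (intro exI[of _ 0] allI impI order.trans[OF clip_err B_le] int int_clip) auto
      qed
      moreover have "\<bar>(\<integral>x. x ^ q \<partial>M) - (\<integral>x. clip R x ^ q \<partial>M)\<bar> \<le> 2 * (\<integral>x. x ^ (2 * q) \<partial>M) / real R ^ q"
        using R intM int_clip by (intro clip_err) auto
      ultimately show ?thesis by (simp add: C_def algebra_simps add_divide_distrib)
    qed
    have "(\<lambda>R. 2 * C / real R ^ q) \<longlonglongrightarrow> 0"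
      using q by (intro tendsto_divide_0[OF tendsto_const] filterlim_at_top_imp_at_infinity
          filterlim_pow_at_top filterlim_real_sequentially) auto
    then have "\<bar>(\<integral>x. x ^ q \<partial>M) - a q\<bar> \<le> 0"
      by (rule LIMSEQ_le_const) (use le in \<open>auto intro: exI[of _ 1]\<close>)
    then show ?thesis by simp
  qed
qed

lemma tight_of_second_moment:
  assumes rd: "\<And>n. real_distribution (\<mu> n)"
    and int: "\<And>n. integrable (\<mu> n) (\<lambda>x. x ^ 2)"
    and B: "\<And>n. (\<integral>x. x ^ 2 \<partial>\<mu> n) \<le> B"
  shows "tight \<mu>"
  unfolding tight_def
proof (intro conjI allI impI rd)
  interpret \<mu>: real_distribution "\<mu> n" for n by (rule rd)
  fix \<epsilon> :: real assume \<epsilon>: "0 < \<epsilon>"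
  have B0: "B \<ge> 0" using B[of 0] by (rule order.trans[rotated]) simp
  \<comment> \<open>The summand 1 ensures \<open>R \<ge> 1\<close>, so that \<open>R\<close> is at
    most its square and \<open>\<epsilon> * R > B\<close> suffices for Chebyshev's
    inequality.\<close>
  define R where "R = 1 + B / \<epsilon>"
  have R: "R \<ge> 1" "B < \<epsilon> * R\<^sup>2"
  proof -
    show "R \<ge> 1" using B0 \<epsilon> by (simp add: R_def)
    then have "\<epsilon> * R \<le> \<epsilon> * R\<^sup>2" using \<epsilon> by (simp add: power2_eq_square)
    moreover have "B < \<epsilon> * R" using \<epsilon> by (simp add: R_def field_simps)
    ultimately show "B < \<epsilon> * R\<^sup>2" by simp
  qed
  have "measure (\<mu> n) {-R<..R} > 1 - \<epsilon>" for n
  proof -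
    have "measure (\<mu> n) {x. x\<^sup>2 \<ge> R\<^sup>2} \<le> (\<integral>x. x\<^sup>2 \<partial>\<mu> n) / R\<^sup>2"
      using integral_Markov_inequality_measure[OF int[of n], of "{}" "R\<^sup>2"] R by simp
    also have "\<dots> \<le> B / R\<^sup>2" using B by (intro divide_right_mono) auto
    also have "\<dots> < \<epsilon>" using R by (simp add: field_simps)
    finally have "measure (\<mu> n) {x. x\<^sup>2 \<ge> R\<^sup>2} < \<epsilon>" .
    moreover have "UNIV - {x. x\<^sup>2 \<ge> R\<^sup>2} \<subseteq> {-R<..R}"
      using R by (auto simp: abs_le_square_iff[symmetric] not_le)
    then have "measure (\<mu> n) (UNIV - {x. x\<^sup>2 \<ge> R\<^sup>2}) \<le> measure (\<mu> n) {-R<..R}"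
      by (intro \<mu>.finite_measure_mono) auto
    moreover have "measure (\<mu> n) (UNIV - {x. x\<^sup>2 \<ge> R\<^sup>2}) = 1 - measure (\<mu> n) {x. x\<^sup>2 \<ge> R\<^sup>2}"
      by (subst \<mu>.prob_compl[symmetric]) auto
    ultimately show ?thesis by simp
  qed
  then show "\<exists>a b. a < b \<and> (\<forall>n. measure (\<mu> n) {a<..b} > 1 - \<epsilon>)"
    using R by (intro exI[of _ "-R"] exI[of _ R]) auto
qed

text \<open>Tightness yields one subsequential limit. Any other subsequential limit has the same
  moments and is therefore the same law, which forces convergence of the whole sequence.\<close>

theorem method_of_moments:
  assumes rd: "\<And>n. real_distribution (\<mu> n)"
    and int: "\<And>n q. integrable (\<mu> n) (\<lambda>x. x ^ q)"
    and lim: "\<And>q. (\<lambda>n. \<integral>x. x ^ q \<partial>\<mu> n) \<longlonglongrightarrow> a q"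
    and small: "\<And>t. (\<lambda>p. t ^ (2 * p) * a (2 * p) / fact (2 * p)) \<longlonglongrightarrow> 0"
  obtains M where "real_distribution M" "\<And>q. integrable M (\<lambda>x. x ^ q)"
    "\<And>q. (\<integral>x. x ^ q \<partial>M) = a q" "weak_conv_m \<mu> M"
proof -
  have "\<exists>B. \<forall>n. (\<integral>x. x ^ q \<partial>\<mu> n) \<le> B" for q
    using convergent_imp_Bseq[OF convergentI[OF lim[of q]]] unfolding Bseq_def
    by (metis abs_le_iff real_norm_def)
  then obtain B where B: "\<And>n q. (\<integral>x. x ^ q \<partial>\<mu> n) \<le> B q" by metis
  have tight: "tight \<mu>" using rd int B by (rule tight_of_second_moment)
  have moments: "integrable N (\<lambda>x. x ^ q)" "(\<integral>x. x ^ q \<partial>N) = a q"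
    if "real_distribution N" "strict_mono s" "weak_conv_m (\<mu> \<circ> s) N" for N s q
    using weak_conv_moments[OF _ that(1,3), of B a q] rd int B LIMSEQ_subseq_LIMSEQ[OF lim that(2)]
    by (auto simp: o_def)
  obtain r M where r: "strict_mono r" and M: "real_distribution M" "weak_conv_m (\<mu> \<circ> r) M"
    using tight_imp_convergent_subsubsequence[OF tight strict_mono_id] by auto
  have "weak_conv_m \<mu> M"
  proof (rule tight_subseq_weak_converge[OF rd M(1) tight])
    fix s N assume s: "strict_mono s" and N: "weak_conv_m (\<mu> \<circ> s) N" "real_distribution N"
    have "N = M"
      by (rule moments_determine_distribution[OF N(2) M(1) moments(1)[OF N(2) s N(1)]
            moments(1)[OF M(1) r M(2)] moments(2)[OF N(2) s N(1)] moments(2)[OF M(1) r M(2)] small])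
    then show "weak_conv_m (\<mu> \<circ> s) M" using N by simp
  qed
  then show ?thesis using that M moments[OF M(1) r M(2)] by blast
qed

section \<open>Generating function of the number of cuts\<close>

text \<open>Plays two roles: as a function of \<open>r\<close> it is the Poisson mass function with
  mean \<open>x\<close>; as a function of \<open>x \<ge> 0\<close> it is the density of the ring
  time number \<open>r + 1\<close> of a unit-rate clock.\<close>

definition pois :: "nat \<Rightarrow> real \<Rightarrow> real" where
  "pois r x = exp (- x) * x ^ r / fact r"

lemma pois_at_0: "pois r 0 = (if r = 0 then 1 else 0)"
  by (simp add: pois_def)

lemma continuous_on_pois [continuous_intros]: "continuous_on A (pois r)"
  unfolding pois_def[abs_def] by (intro continuous_intros) auto

lemma pois_deriv:
  "(pois r has_real_derivative ((if r = 0 then 0 else pois (r - 1) x) - pois r x)) (at x within A)"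
proof (cases r)
  case 0
  then show ?thesis unfolding pois_def[abs_def] by (auto intro!: derivative_eq_intros)
next
  case (Suc j)
  have d: "((\<lambda>x. x ^ Suc j / fact (Suc j)) has_real_derivative x ^ j / fact j) (at x within A)"
    by (rule DERIV_cong[OF DERIV_cdivide[OF DERIV_power[OF DERIV_ident]]]) (simp add: divide_simps)
  have "((\<lambda>x. exp (- x)) has_real_derivative - exp (- x)) (at x within A)"
    by (auto intro!: derivative_eq_intros)
  from DERIV_mult[OF this d]
  have "((\<lambda>x. exp (- x) * (x ^ Suc j / fact (Suc j))) has_real_derivative
      exp (- x) * (x ^ j / fact j) - exp (- x) * (x ^ Suc j / fact (Suc j))) (at x within A)"
    by (rule DERIV_cong) (simp add: mult.commute)
  then show ?thesis unfolding Suc pois_def[abs_def] by simp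
qed

lemma pois_sum_deriv:
  fixes s :: complex
  shows "((\<lambda>x. \<Sum>r<a. s ^ r * pois r x) has_vector_derivative
    (- (\<Sum>r<a. s ^ r * pois r x) + s * (\<Sum>r<a - 1. s ^ r * pois r x))) (at x within A)"
proof -
  have "((\<lambda>x. \<Sum>r<a. s ^ r * pois r x) has_vector_derivative
      (\<Sum>r<a. s ^ r * of_real ((if r = 0 then 0 else pois (r - 1) x) - pois r x))) (at x within A)"
    by (intro has_vector_derivative_sum has_vector_derivative_mult_right
        has_vector_derivative_of_real pois_deriv)
  also have "(\<Sum>r<a. s ^ r * of_real ((if r = 0 then 0 else pois (r - 1) x) - pois r x)) =
      (\<Sum>r<a. s ^ r * of_real (if r = 0 then 0 else pois (r - 1) x)) - (\<Sum>r<a. s ^ r * pois r x)"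
    by (simp add: right_diff_distrib sum_subtractf)
  also have "(\<Sum>r<a. s ^ r * of_real (if r = 0 then 0 else pois (r - 1) x)) =
      s * (\<Sum>r<a - 1. s ^ r * pois r x)"
    by (cases a) (simp_all add: sum.lessThan_Suc_shift sum_distrib_left mult_ac del: sum.lessThan_Suc)
  finally show ?thesis by (simp add: algebra_simps)
qed

lemma integral_deriv_half_line:
  fixes f :: "real \<Rightarrow> 'a::banach"
  assumes "continuous_on {0..} f" "x \<ge> 0"
  shows "((\<lambda>x. integral {0..x} f) has_vector_derivative f x) (at x within {0..})"
proof -
  have "((\<lambda>x. integral {0..x} f) has_vector_derivative f x) (at x within {0..x + 1})"
    using assms by (intro integral_has_vector_derivative continuous_on_subset[OF assms(1)]) auto
  also have "at x within {0..x + 1} = at x within {0..}"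
    by (rule at_within_nhd[of _ "{..<x + 1}"]) auto
  finally show ?thesis .
qed

lemma continuous_on_half_line_deriv:
  assumes "\<And>x::real. x \<ge> 0 \<Longrightarrow> (f has_vector_derivative f' x) (at x within {0..})"
  shows "continuous_on {0..} f"
  by (rule continuous_on_vector_derivative) (use assms in auto)

lemma integrable_half_line:
  fixes f :: "real \<Rightarrow> 'a::banach"
  shows "continuous_on {0..} f \<Longrightarrow> f integrable_on {0..x}"
  by (rule integrable_continuous_real) (auto elim: continuous_on_subset)

text \<open>
  \<open>ring_op s a g x\<close> is the expectation of \<open>s\<close> to the power \<open>min a N\<close>, times \<open>g\<close> at the minimum of \<open>x\<close> and
  the time of the \<open>a\<close>-th ring, for the number \<open>N\<close> of rings of a unit-rate clock up to time \<open>x\<close>.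
\<close>

definition ring_op :: "complex \<Rightarrow> nat \<Rightarrow> (real \<Rightarrow> complex) \<Rightarrow> real \<Rightarrow> complex" where
  "ring_op s a g x = (\<Sum>r<a. s ^ r * complex_of_real (pois r x)) * g x
     + s ^ a * integral {0..x} (\<lambda>y. complex_of_real (pois (a - 1) y) * g y)"

lemma continuous_on_pois_mult:
  fixes g :: "real \<Rightarrow> complex"
  shows "continuous_on A g \<Longrightarrow> continuous_on A (\<lambda>y. pois j y * g y)"
  by (intro continuous_intros)

lemma continuous_on_ring_op:
  assumes "continuous_on {0..} g"
  shows "continuous_on {0..} (ring_op s a g)"
proof -
  have "continuous_on {0..} (\<lambda>x. integral {0..x} (\<lambda>y. complex_of_real (pois (a - 1) y) * g y))"
    by (rule continuous_on_half_line_deriv[OF integral_deriv_half_line])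
      (intro continuous_on_pois_mult assms, simp)
  then show ?thesis
    unfolding ring_op_def[abs_def] by (intro continuous_intros assms)
qed

lemma ring_op_add:
  assumes "continuous_on {0..} g" "continuous_on {0..} h"
  shows "ring_op s a (\<lambda>y. g y + h y) x = ring_op s a g x + ring_op s a h x"
proof -
  have "integral {0..x} (\<lambda>y. pois (a - 1) y * g y + pois (a - 1) y * h y) =
      integral {0..x} (\<lambda>y. pois (a - 1) y * g y) + integral {0..x} (\<lambda>y. pois (a - 1) y * h y)"
    by (intro Henstock_Kurzweil_Integration.integral_add integrable_half_line continuous_on_pois_mult assms)
  then show ?thesis by (simp add: ring_op_def algebra_simps)
qed

lemma ring_op_cmult: "ring_op s a (\<lambda>y. c * g y) x = c * ring_op s a g x"
proof -
  have "integral {0..x} (\<lambda>y. c * (pois (a - 1) y * g y)) = c * integral {0..x} (\<lambda>y. pois (a - 1) y * g y)"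
    by (rule integral_mult_right)
  then show ?thesis by (simp add: ring_op_def algebra_simps)
qed

lemma ring_op_zero: "ring_op s a (\<lambda>y. 0) x = 0"
  by (simp add: ring_op_def)

lemma ring_op_sum:
  assumes "\<And>i. i \<in> I \<Longrightarrow> continuous_on {0..} (g i)" and "finite I"
  shows "ring_op s a (\<lambda>y. \<Sum>i\<in>I. g i y) x = (\<Sum>i\<in>I. ring_op s a (g i) x)"
  using assms(2,1)
proof (induction I)
  case empty
  then show ?case by (simp add: ring_op_zero)
next
  case (insert i I)
  then show ?case by (simp add: ring_op_add continuous_on_sum)
qed

text \<open>Trades the boundary term that appears when the integral in \<open>ring_op\<close> is
  differentiated for integrals that again have the form found in \<open>ring_op\<close>. The case
  \<open>j = 0\<close> stands apart because \<open>j - 1\<close> would be 0 again.\<close>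

lemma integral_pois_by_parts:
  fixes g g' :: "real \<Rightarrow> complex"
  assumes g: "\<And>x. x \<ge> 0 \<Longrightarrow> (g has_vector_derivative g' x) (at x within {0..})"
    and g': "continuous_on {0..} g'" and x: "x \<ge> 0"
  shows "pois j x * g x - pois j 0 * g 0 =
    (if j = 0 then 0 else integral {0..x} (\<lambda>y. pois (j - 1) y * g y))
    - integral {0..x} (\<lambda>y. pois j y * g y) + integral {0..x} (\<lambda>y. pois j y * g' y)"
proof -
  note cont = continuous_on_half_line_deriv[OF g]
  define p where "p y = (if j = 0 then 0 else complex_of_real (pois (j - 1) y) * g y)" for y
  have p: "continuous_on {0..} p"
    unfolding p_def[abs_def] by (cases "j = 0") (auto intro: continuous_on_pois_mult cont)
  have "((\<lambda>y. p y - pois j y * g y + pois j y * g' y) has_integral (pois j x * g x - pois j 0 * g 0)) {0..x}"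
  proof (rule fundamental_theorem_of_calculus[OF x])
    fix y assume y: "y \<in> {0..x}"
    have "((\<lambda>x. of_real (pois j x) * g x) has_vector_derivative
        (of_real (pois j y) * g' y + of_real ((if j = 0 then 0 else pois (j - 1) y) - pois j y) * g y))
        (at y within {0..x})"
      using y by (intro has_vector_derivative_mult has_vector_derivative_of_real
          pois_deriv
          has_vector_derivative_within_subset[OF g]) auto
    then show "((\<lambda>x. of_real (pois j x) * g x) has_vector_derivative
        (p y - pois j y * g y + pois j y * g' y)) (at y within {0..x})"
      by (simp add: p_def algebra_simps split: if_splits)
  qed
  from integral_unique[OF this]
  have "pois j x * g x - pois j 0 * g 0 = integral {0..x} (\<lambda>y. p y - pois j y * g y + pois j y * g' y)" by simp
  also have "\<dots> = integral {0..x} (\<lambda>y. p y - pois j y * g y) + integral {0..x} (\<lambda>y. pois j y * g' y)"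
    by (intro Henstock_Kurzweil_Integration.integral_add integrable_half_line continuous_on_pois_mult g'
        continuous_on_diff p cont)
  also have "integral {0..x} (\<lambda>y. p y - pois j y * g y) = integral {0..x} p - integral {0..x} (\<lambda>y. pois j y * g y)"
    by (intro Henstock_Kurzweil_Integration.integral_diff integrable_half_line continuous_on_pois_mult p cont)
  also have "integral {0..x} p = (if j = 0 then 0 else integral {0..x} (\<lambda>y. pois (j - 1) y * g y))"
    by (simp add: p_def[abs_def])
  finally show ?thesis .
qed

text \<open>Backward equation with respect to one clock: at rate 1 it rings, which costs a factor
  \<open>s\<close> and leaves \<open>a - 1\<close> rings, or leaves nothing to cut if
  \<open>a = 1\<close>; the last term lets the other vertices evolve.\<close>

lemma ring_op_deriv:
  assumes g: "\<And>x. x \<ge> 0 \<Longrightarrow> (g has_vector_derivative g' x) (at x within {0..})"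
    and g': "continuous_on {0..} g'" and g0: "g 0 = 1" and a: "a \<ge> 1" and x: "x \<ge> 0"
  shows "(ring_op s a g has_vector_derivative
    (- ring_op s a g x + s * (if a = 1 then 1 else ring_op s (a - 1) g x) + ring_op s a g' x))
    (at x within {0..})"
proof -
  note cont = continuous_on_half_line_deriv[OF g]
  define B where "B j = (\<Sum>r<j. s ^ r * complex_of_real (pois r x))" for j
  define I where "I j h = integral {0..x} (\<lambda>y. complex_of_real (pois j y) * h y)" for j and h :: "real \<Rightarrow> complex"
  have "((\<lambda>x. (\<Sum>r<a. s ^ r * pois r x) * g x) has_vector_derivative
      (B a * g' x + (- B a + s * B (a - 1)) * g x)) (at x within {0..})"
    unfolding B_def by (intro has_vector_derivative_mult pois_sum_deriv g x)
  moreover have "((\<lambda>x. s ^ a * integral {0..x} (\<lambda>y. complex_of_real (pois (a - 1) y) * g y))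
      has_vector_derivative s ^ a * (pois (a - 1) x * g x)) (at x within {0..})"
    by (intro has_vector_derivative_mult_right integral_deriv_half_line x continuous_on_pois_mult cont)
  ultimately have "(ring_op s a g has_vector_derivative
      (B a * g' x + (- B a + s * B (a - 1)) * g x + s ^ a * (pois (a - 1) x * g x))) (at x within {0..})"
    unfolding ring_op_def[abs_def] by (rule has_vector_derivative_add)
  moreover have "B a * g' x + (- B a + s * B (a - 1)) * g x + s ^ a * (pois (a - 1) x * g x) =
      - ring_op s a g x + s * (if a = 1 then 1 else ring_op s (a - 1) g x) + ring_op s a g' x"
  proof -
    note parts = integral_pois_by_parts[OF g g' x, of "a - 1", folded I_def]
    have ops: "ring_op s a h x = B a * h x + s ^ a * I (a - 1) h"
      "ring_op s (a - 1) h x = B (a - 1) * h x + s ^ (a - 1) * I (a - 1 - 1) h" for h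
      by (simp_all add: ring_op_def B_def I_def)
    show ?thesis
    proof (cases "a = 1")
      case True
      \<comment> \<open>The 1 is the boundary value \<open>pois 0 0 * g 0\<close>; it represents the
        empty path left after the first vertex is removed.\<close>
      have "pois 0 x * g x = 1 - I 0 g + I 0 g'"
        using parts True by (simp add: g0 pois_at_0 algebra_simps)
      moreover have "ring_op s 1 h x = pois 0 x * h x + s * I 0 h" for h :: "real \<Rightarrow> complex"
        by (simp add: ring_op_def I_def)
      moreover from calculation(1) have "s * (pois 0 x * g x) = s * (1 - I 0 g + I 0 g')" by simp
      ultimately show ?thesis using True by (simp add: B_def algebra_simps)
    next
      case False
      then have p: "pois (a - 1) x * g x = I (a - 1 - 1) g - I (a - 1) g + I (a - 1) g'"
        using parts a by (simp add: g0 pois_at_0 algebra_simps)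
      have "s ^ a = s * s ^ (a - 1)" using a by (cases a) auto
      then show ?thesis using False unfolding p ops by (simp add: algebra_simps)
    qed
  qed
  ultimately show ?thesis by simp
qed

text \<open>
  The generating function at \<open>s\<close> of the number of cuts made up to time \<open>x\<close> on a path whose vertices,
  listed from the root, have \<open>as\<close> cuts left. \<open>cut_step v as\<close> is the state after a cut of vertex \<open>v\<close>.
\<close>

primrec cut_gf :: "complex \<Rightarrow> nat list \<Rightarrow> real \<Rightarrow> complex" where
  "cut_gf s [] = (\<lambda>x. 1)"
| "cut_gf s (a # as) = ring_op s a (cut_gf s as)"

definition cut_step :: "nat \<Rightarrow> nat list \<Rightarrow> nat list" where
  "cut_step v as = (if as ! v = 1 then take v as else as[v := as ! v - 1])"

lemma cut_step_Cons:
  "cut_step 0 (a # as) = (if a = 1 then [] else (a - 1) # as)"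
  "cut_step (Suc v) (a # as) = a # cut_step v as"
  by (simp_all add: cut_step_def)

lemma continuous_on_cut_gf: "continuous_on {0..} (cut_gf s as)"
  by (induction as) (auto intro: continuous_on_ring_op)

lemma cut_gf_0: "\<forall>a\<in>set as. a \<ge> 1 \<Longrightarrow> cut_gf s as 0 = 1"
proof (induction as)
  case (Cons a as)
  have "(\<Sum>r<a. s ^ r * complex_of_real (pois r 0)) = (\<Sum>r<a. if r = 0 then 1 else 0)"
    by (intro sum.cong) (auto simp: pois_at_0)
  also have "\<dots> = 1" using Cons.prems by simp
  finally show ?case using Cons by (simp add: ring_op_def)
qed simp

text \<open>The backward equation for the cuts made up to time \<open>x\<close>: the first of the \<open>length as\<close>
  independent unit-rate clocks to ring is uniformly distributed.\<close>

lemma cut_gf_deriv: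
  assumes "\<forall>a\<in>set as. a \<ge> 1" "x \<ge> 0"
  shows "(cut_gf s as has_vector_derivative
    (- of_nat (length as) * cut_gf s as x + s * (\<Sum>v<length as. cut_gf s (cut_step v as) x)))
    (at x within {0..})"
  using assms
proof (induction as arbitrary: x)
  case Nil
  then show ?case by simp
next
  case (Cons a as)
  define g where "g = cut_gf s as"
  define g' where "g' x = - of_nat (length as) * g x + s * (\<Sum>v<length as. cut_gf s (cut_step v as) x)" for x
  have g: "(g has_vector_derivative g' x) (at x within {0..})" if "x \<ge> 0" for x
    using Cons.IH[OF _ that] Cons.prems by (simp add: g_def g'_def)
  have cont: "continuous_on {0..} (\<lambda>x. \<Sum>v<length as. cut_gf s (cut_step v as) x)"
    by (intro continuous_on_sum continuous_on_cut_gf)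
  have g': "continuous_on {0..} g'"
    unfolding g'_def[abs_def] g_def by (intro continuous_intros continuous_on_cut_gf cont)
  \<comment> \<open>By linearity the operator of the first vertex passes through the equation for
    \<open>as\<close>, and it commutes with cuts of later vertices because
    \<open>cut_step (Suc v)\<close> leaves the head alone.\<close>
  have "ring_op s a g' x = ring_op s a (\<lambda>x. - of_nat (length as) * g x) x
      + ring_op s a (\<lambda>x. s * (\<Sum>v<length as. cut_gf s (cut_step v as) x)) x"
    unfolding g'_def[abs_def]
    by (rule ring_op_add) (auto simp: g_def intro!: continuous_intros continuous_on_cut_gf cont)
  then have "ring_op s a g' x = - of_nat (length as) * ring_op s a g x
      + s * ring_op s a (\<lambda>x. \<Sum>v<length as. cut_gf s (cut_step v as) x) x"
    by (simp only: ring_op_cmult)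
  also have "ring_op s a (\<lambda>x. \<Sum>v<length as. cut_gf s (cut_step v as) x) x =
      (\<Sum>v<length as. cut_gf s (cut_step (Suc v) (a # as)) x)"
    by (subst ring_op_sum) (auto simp: cut_step_Cons continuous_on_cut_gf)
  finally have op: "ring_op s a g' x = - of_nat (length as) * cut_gf s (a # as) x
      + s * (\<Sum>v<length as. cut_gf s (cut_step (Suc v) (a # as)) x)"
    by (simp add: g_def)
  have "(ring_op s a g has_vector_derivative
      (- ring_op s a g x + s * (if a = 1 then 1 else ring_op s (a - 1) g x) + ring_op s a g' x))
      (at x within {0..})"
    by (rule ring_op_deriv[OF g g']) (use Cons.prems cut_gf_0 in \<open>auto simp: g_def\<close>)
  moreover have "(if a = 1 then 1 else ring_op s (a - 1) g x) = cut_gf s (cut_step 0 (a # as)) x"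
    by (simp add: cut_step_Cons g_def)
  ultimately show ?case
    unfolding op by (simp add: g_def sum.lessThan_Suc_shift algebra_simps del: sum.lessThan_Suc)
qed

text \<open>Multiplication by \<open>exp (m * x)\<close> removes the linear term, and L'Hospital's
  rule compares the two derivatives \<open>exp (m * x) * g x\<close> and
  \<open>m * exp (m * x)\<close>. The value found is the equilibrium of the equation.\<close>

lemma linear_ode_limit_real:
  fixes f g :: "real \<Rightarrow> real"
  assumes f: "\<And>x. x > 0 \<Longrightarrow> (f has_real_derivative (- m * f x + g x)) (at x)"
    and g: "(g \<longlongrightarrow> G) at_top" and m: "m > 0"
  shows "(f \<longlongrightarrow> G / m) at_top"
proof -
  have "((\<lambda>x. (exp (m * x) * f x) / exp (m * x)) \<longlongrightarrow> G / m) at_top"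
  proof (rule lhospital_at_top_at_top)
    show "LIM x at_top. exp (m * x) :> at_top"
      using m by (intro filterlim_compose[OF exp_at_top] filterlim_tendsto_pos_mult_at_top[OF tendsto_const _ filterlim_ident])
    show "eventually (\<lambda>x. ((\<lambda>x. exp (m * x) * f x) has_real_derivative exp (m * x) * g x) (at x)) at_top"
      using eventually_gt_at_top[of 0]
      by eventually_elim (auto intro!: derivative_eq_intros f simp: algebra_simps)
    show "eventually (\<lambda>x. ((\<lambda>x. exp (m * x)) has_real_derivative m * exp (m * x)) (at x)) at_top"
      by (auto intro!: always_eventually derivative_eq_intros)
    have "((\<lambda>x. g x / m) \<longlongrightarrow> G / m) at_top" using m by (intro tendsto_intros g) auto
    then show "((\<lambda>x. exp (m * x) * g x / (m * exp (m * x))) \<longlongrightarrow> G / m) at_top" by simp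
  qed (use m in auto)
  then show ?thesis by simp
qed

lemma linear_ode_limit:
  fixes f g :: "real \<Rightarrow> complex"
  assumes f: "\<And>x. x \<ge> 0 \<Longrightarrow> (f has_vector_derivative (- of_real m * f x + g x)) (at x within {0..})"
    and g: "(g \<longlongrightarrow> G) at_top" and m: "m > 0"
  shows "(f \<longlongrightarrow> G / of_real m) at_top"
proof -
  have f': "(f has_vector_derivative (- of_real m * f x + g x)) (at x)" if "x > 0" for x
  proof -
    have "at x within {0..} = at x" using that by (intro at_within_interior) auto
    with f[of x] that show ?thesis by simp
  qed
  have "((\<lambda>x. Re (f x)) \<longlongrightarrow> Re G / m) at_top"
  proof (rule linear_ode_limit_real[OF _ tendsto_Re[OF g] m])
    fix x :: real assume "x > 0"
    from bounded_linear.has_vector_derivative[OF bounded_linear_Re f'[OF this]]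
    show "((\<lambda>x. Re (f x)) has_real_derivative (- m * Re (f x) + Re (g x))) (at x)"
      by (simp add: has_real_derivative_iff_has_vector_derivative)
  qed
  moreover have "((\<lambda>x. Im (f x)) \<longlongrightarrow> Im G / m) at_top"
  proof (rule linear_ode_limit_real[OF _ tendsto_Im[OF g] m])
    fix x :: real assume "x > 0"
    from bounded_linear.has_vector_derivative[OF bounded_linear_Im f'[OF this]]
    show "((\<lambda>x. Im (f x)) has_real_derivative (- m * Im (f x) + Im (g x))) (at x)"
      by (simp add: has_real_derivative_iff_has_vector_derivative)
  qed
  ultimately show ?thesis by (simp add: tendsto_complex_iff Re_divide_of_real Im_divide_of_real)
qed


section \<open>The discrete process on a path and its generating function\<close>

lemma finite_set_pmf_remaining_cuts: "finite (set_pmf (remaining_cuts k V E r c))"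
proof (induction k V E r c rule: remaining_cuts.induct)
  case (1 k V E r c)
  show ?case
  proof (cases "r \<in> V \<and> finite V")
    case True
    note rc = root_component_simps[of r V E]
    have "finite (set_pmf (if k \<le> (c(v := Suc (c v))) v
            then remaining_cuts k (V - {v}) {e \<in> E. v \<notin> e} r (c(v := Suc (c v)))
            else remaining_cuts k V E r (c(v := Suc (c v)))))"
      if "v \<in> root_component V E r" for v
      using 1(1)[OF True _ refl, of v] 1(2)[OF True _ refl, of v] that True rc
      by (cases "k \<le> Suc (c v)") (simp_all add: set_pmf_of_set del: fun_upd_apply add: fun_upd_same)
    then show ?thesis
      using rc True by (subst remaining_cuts.simps) (auto simp: Let_def)
  next
    case False
    then show ?thesis by (subst remaining_cuts.simps) auto
  qed
qed

lemma gf_remaining_cuts: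
  fixes s :: complex
  assumes "r \<in> V" "finite V"
  shows "(\<integral>x. s ^ x \<partial>measure_pmf (remaining_cuts k V E r c)) =
    s * (\<Sum>v\<in>root_component V E r. \<integral>x. s ^ x \<partial>measure_pmf
      (if k \<le> Suc (c v) then remaining_cuts k (V - {v}) {e \<in> E. v \<notin> e} r (c(v := Suc (c v)))
       else remaining_cuts k V E r (c(v := Suc (c v))))) / of_nat (card (root_component V E r))"
    (is "_ = s * (\<Sum>v\<in>_. \<integral>x. s ^ x \<partial>measure_pmf (?R v)) / _")
proof -
  note rc = root_component_simps[OF assms, of E]
  have "(\<integral>x. s ^ x \<partial>measure_pmf (remaining_cuts k V E r c)) =
    (\<Sum>v\<in>root_component V E r. pmf (pmf_of_set (root_component V E r)) v *\<^sub>R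
      (\<integral>x. s ^ x \<partial>measure_pmf (map_pmf Suc (?R v))))"
    using assms rc
    by (subst remaining_cuts.simps)
      (simp add: Let_def, subst pmf_expectation_bind[of "root_component V E r"],
        auto simp: finite_set_pmf_remaining_cuts)
  also have "\<dots> = (\<Sum>v\<in>root_component V E r. s / of_nat (card (root_component V E r)) *
      (\<integral>x. s ^ x \<partial>measure_pmf (?R v)))"
    using rc by (intro sum.cong) (simp_all add: pmf_of_set scaleR_conv_of_real indicator_def)
  finally show ?thesis by (simp add: sum_distrib_left sum_divide_distrib)
qed

definition path_edges :: "nat \<Rightarrow> nat set set" where
  "path_edges n = {{i, Suc i} | i. 1 \<le> i \<and> i < n}"

text \<open>\<open>remaining_cuts\<close> deletes only the vertex that was cut; vertices beyond it
  stay in \<open>V\<close> but are unreachable. The component is thus determined by the first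
  missing vertex \<open>Suc m\<close>, whatever \<open>V\<close> contains further on.\<close>

lemma root_component_path:
  assumes "{1..m} \<subseteq> V" "V \<subseteq> {1..n}" "Suc m \<notin> V" "m \<ge> 1"
  shows "root_component V {e \<in> path_edges n. e \<subseteq> V} 1 = {1..m}"
proof -
  define R where "R = {(u, w). {u, w} \<in> {e \<in> path_edges n. e \<subseteq> V}}"
  have "w \<in> {1..m}" if "(1, w) \<in> R\<^sup>*" for w
    using that
  proof (induction rule: rtrancl_induct)
    case base
    then show ?case using assms by simp
  next
    case (step u w)
    then obtain i where i: "{u, w} = {i, Suc i}" "1 \<le> i" and V: "u \<in> V" "w \<in> V"
      unfolding R_def path_edges_def by auto
    then have "w = Suc u \<or> u = Suc w" by (auto simp: doubleton_eq_iff)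
    then show ?case using step V i assms(2,3)
      by (metis One_nat_def Suc_le_eq atLeastAtMost_iff le_Suc_eq subset_iff Suc_leD le_antisym not_less_eq_eq)
  qed
  moreover have "(1, i) \<in> R\<^sup>*" if "i \<in> {1..m}" for i
    using that
  proof (induction i)
    case (Suc i)
    show ?case
    proof (cases "i = 0")
      case False
      then have "{i, Suc i} \<subseteq> V" using Suc.prems assms(1) by auto
      moreover from this have "Suc i \<le> n" using assms(2) by auto
      ultimately have "(i, Suc i) \<in> R" using False by (auto simp: R_def path_edges_def)
      then show ?thesis using Suc False by (auto intro: rtrancl_into_rtrancl)
    qed simp
  qed simp
  ultimately have "{v \<in> V. (1, v) \<in> R\<^sup>*} = {1..m}" using assms(1) by blast
  then show ?thesis unfolding root_component_def R_def .
qed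

text \<open>Once all successor states are known to converge, the linear equation has the limit
  \<open>s\<close> times their average, which is one step of the discrete process. The induction is
  on the cuts still available in the component of the root, since a cut lowers this number
  strictly.\<close>

lemma cut_gf_limit:
  assumes "1 \<le> k" "{1..m} \<subseteq> V" "V \<subseteq> {1..n}" "Suc m \<notin> V" "\<forall>v\<in>{1..m}. c v < k"
  shows "(cut_gf s (map (\<lambda>v. k - c v) [1..<Suc m]) \<longlongrightarrow>
    (\<integral>x. s ^ x \<partial>measure_pmf (remaining_cuts k V {e \<in> path_edges n. e \<subseteq> V} 1 c))) at_top"
  using assms
proof (induction "\<Sum>v\<in>{1..m}. k - c v" arbitrary: m V c rule: less_induct)
  case less
  show ?case
  proof (cases "m = 0")
    case True
    then have "1 \<notin> V" using less by auto
    then show ?thesis using True by (subst remaining_cuts.simps) simp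
  next
    case False
    then have m: "m \<ge> 1" by simp
    have V: "1 \<in> V" "finite V" using less m by (auto intro: finite_subset)
    define as where "as = map (\<lambda>v. k - c v) [1..<Suc m]"
    have len: "length as = m" by (simp add: as_def)
    have as_nth: "as ! i = k - c (Suc i)" if "i < m" for i
      using that by (simp add: as_def del: upt_Suc)
    have as_pos: "\<forall>a\<in>set as. a \<ge> 1" using less.prems(5) by (auto simp: as_def Suc_le_eq simp del: upt_Suc)
    define E where "E = {e \<in> path_edges n. e \<subseteq> V}"
    define H where "H v = (\<integral>x. s ^ x \<partial>measure_pmf
      (if k \<le> Suc (c v) then remaining_cuts k (V - {v}) {e \<in> E. v \<notin> e} 1 (c(v := Suc (c v)))
       else remaining_cuts k V E 1 (c(v := Suc (c v)))))" for v
    have rem: "(\<integral>x. s ^ x \<partial>measure_pmf (remaining_cuts k V E 1 c)) = s * (\<Sum>v\<in>{1..m}. H v) / of_nat m"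
      unfolding H_def using gf_remaining_cuts[OF V, where s = s and k = k and E = E and c = c]
        root_component_path[OF less.prems(2-4) m] by (simp add: E_def)
    have H: "(cut_gf s (cut_step i as) \<longlongrightarrow> H (Suc i)) at_top" if i: "i < m" for i
    proof (cases "k \<le> Suc (c (Suc i))")
      case True
      have "c (Suc i) < k" using less.prems(5) i by auto
      then have "as ! i = 1" using True as_nth[OF i] by simp
      \<comment> \<open>List positions start at 0 and vertices at 1. Dropping positions from
        \<open>i\<close> on matches the new first gap \<open>Suc i\<close>, although
        \<open>V\<close> loses a single vertex.\<close>
      then have step: "cut_step i as = map (\<lambda>v. k - (c(Suc i := Suc (c (Suc i)))) v) [1..<Suc i]"
        using i as_nth len by (auto simp: cut_step_def simp del: upt_Suc intro!: nth_equalityI)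
      have E: "{e \<in> E. Suc i \<notin> e} = {e \<in> path_edges n. e \<subseteq> V - {Suc i}}"
        by (auto simp: E_def)
      have "(\<Sum>v\<in>{1..i}. k - (c(Suc i := Suc (c (Suc i)))) v) = (\<Sum>v\<in>{1..i}. k - c v)"
        by (intro sum.cong) auto
      also have "\<dots> < (\<Sum>v\<in>{1..m}. k - c v)"
        using i less.prems(5) by (intro sum_strict_mono2[where b = "Suc i"]) auto
      finally show ?thesis
        unfolding step H_def E using True
        by (simp only: if_True, intro less.hyps) (use less.prems i in \<open>auto simp: subset_iff\<close>)
    next
      case False
      have "as ! i \<noteq> 1" using False as_nth[OF i] by auto
      then have step: "cut_step i as = map (\<lambda>v. k - (c(Suc i := Suc (c (Suc i)))) v) [1..<Suc m]"
        using i as_nth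
        by (auto simp: cut_step_def len nth_list_update simp del: upt_Suc intro!: nth_equalityI)
      have "(\<Sum>v\<in>{1..m}. k - (c(Suc i := Suc (c (Suc i)))) v) < (\<Sum>v\<in>{1..m}. k - c v)"
        using i less.prems(5) False
        by (intro sum_strict_mono_ex1) (auto intro!: bexI[of _ "Suc i"])
      then show ?thesis
        unfolding step H_def E_def using False
        by (simp only: if_False, intro less.hyps) (use less.prems i in auto)
    qed
    have "((\<lambda>x. s * (\<Sum>i<m. cut_gf s (cut_step i as) x)) \<longlongrightarrow> s * (\<Sum>i<m. H (Suc i))) at_top"
      by (intro tendsto_mult tendsto_sum tendsto_const H) simp
    moreover have "(cut_gf s as has_vector_derivative
        (- of_real (real m) * cut_gf s as x + s * (\<Sum>v<m. cut_gf s (cut_step v as) x))) (at x within {0..})"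
      if "x \<ge> 0" for x
      using cut_gf_deriv[OF as_pos that, of s] by (simp add: len)
    ultimately have "(cut_gf s as \<longlongrightarrow> s * (\<Sum>i<m. H (Suc i)) / of_real (real m)) at_top"
      using m by (intro linear_ode_limit) auto
    also have "(\<Sum>i<m. H (Suc i)) = (\<Sum>v\<in>{1..m}. H v)"
      by (rule sum.reindex_bij_witness[of _ "\<lambda>v. v - 1" Suc]) auto
    finally show ?thesis
      using rem by (simp add: as_def E_def del: upt_Suc)
  qed
qed

theorem cut_gf_path:
  assumes "k \<ge> 1"
  shows "(cut_gf s (replicate n k) \<longlongrightarrow> (\<integral>x. s ^ x \<partial>measure_pmf (path_kcut_number k n))) at_top"
proof -
  have "{e \<in> path_edges n. e \<subseteq> {1..n}} = path_edges n"
    by (auto simp: path_edges_def)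
  moreover have "{{i, Suc i} | i. 1 \<le> i \<and> i < n} = path_edges n"
    by (simp add: path_edges_def)
  moreover have "map (\<lambda>v. k - 0) [1..<Suc n] = replicate n k"
    by (simp add: map_replicate_const del: upt_Suc)
  ultimately show ?thesis
    using cut_gf_limit[of k n "{1..n}" n "\<lambda>_. 0" s] assms
    unfolding path_kcut_number_def kcut_number_def by (simp del: upt_Suc)
qed

section \<open>Comparison with a sum of running minima\<close>

primrec run_min :: "real \<Rightarrow> (nat \<Rightarrow> real) \<Rightarrow> nat \<Rightarrow> real" where
  "run_min x \<omega> 0 = x"
| "run_min x \<omega> (Suc v) = min (run_min x \<omega> v) (\<omega> v)"

lemma less_run_min_iff: "y < run_min x \<omega> v \<longleftrightarrow> y < x \<and> (\<forall>j<v. y < \<omega> j)"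
  by (induction v) (auto simp: less_Suc_eq)

text \<open>A new first ring time only lowers the starting value. This is the recursion that
  \<open>ring_op\<close> expresses by integration, with the first vertex treated outermost.\<close>

lemma run_min_case_nat: "run_min x (case_nat t \<omega>) (Suc v) = run_min (min x t) \<omega> v"
  by (induction v) auto

lemma run_min_le: "run_min x \<omega> v \<le> x"
  by (induction v) auto

lemma run_min_nonneg: "x \<ge> 0 \<Longrightarrow> (\<And>j. \<omega> j \<ge> 0) \<Longrightarrow> run_min x \<omega> v \<ge> 0"
  by (induction v) auto

lemma iexp_diff_bound: "cmod (iexp u - iexp v) \<le> \<bar>u - v\<bar>"
proof -
  have "iexp u - iexp v = iexp v * (iexp (u - v) - 1)"
    by (simp add: algebra_simps flip: exp_add)
  then have "cmod (iexp u - iexp v) = cmod (iexp (u - v) - 1)"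
    by (simp add: norm_mult)
  also have "\<dots> \<le> \<bar>u - v\<bar>" using iexp_approx1[of "u - v" 0] by simp
  finally show ?thesis .
qed

lemma iexp_power: "iexp \<theta> ^ r = iexp (real r * \<theta>)"
  by (metis exp_of_nat_mult mult.left_commute of_real_mult of_real_of_nat_eq)

text \<open>The first-order terms in \<open>\<theta>\<close> cancel up to \<open>\<theta> a\<^sup>2\<close>.\<close>

lemma iexp_two_terms_bound:
  fixes x \<theta> :: real
  defines "a \<equiv> min 1 x"
  assumes x: "x \<ge> 0"
  shows "cmod ((1 - iexp (a * \<theta>)) * pois 0 x + (iexp \<theta> - iexp (a * \<theta>)) * pois 1 x)
    \<le> \<bar>\<theta>\<bar> * a\<^sup>2 + 2 * \<theta>\<^sup>2 * a"
proof (cases "x \<ge> 1")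
  case True
  then have a: "a = 1" by (simp add: a_def)
  have "cmod ((1 - iexp \<theta>) * pois 0 x) = cmod (iexp \<theta> - 1) * exp (- x)"
    by (simp add: norm_mult pois_def norm_minus_commute)
  also have "\<dots> \<le> \<bar>\<theta>\<bar> * 1"
    using iexp_approx1[of \<theta> 0] x by (intro mult_mono) auto
  finally have "cmod ((1 - iexp \<theta>) * pois 0 x) \<le> \<bar>\<theta>\<bar>" by simp
  also have "\<bar>\<theta>\<bar> \<le> \<bar>\<theta>\<bar> * a\<^sup>2 + 2 * \<theta>\<^sup>2 * a" by (simp add: a)
  finally show ?thesis by (simp add: a)
next
  case False
  then have a: "a = x" by (simp add: a_def)
  define \<rho> where "\<rho> u = iexp u - 1 - \<i> * u" for u :: real
  let ?z = "- (\<i> * \<theta> * x\<^sup>2) - \<rho> (x * \<theta>) + (\<rho> \<theta> - \<rho> (x * \<theta>)) * x"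
  let ?b = "\<bar>\<theta>\<bar> * x\<^sup>2 + (x * \<theta>)\<^sup>2 / 2 + (\<theta>\<^sup>2 / 2 + (x * \<theta>)\<^sup>2 / 2) * x"
  have \<rho>: "cmod (\<rho> u) \<le> u\<^sup>2 / 2" for u
    using iexp_approx1[of u 1] by (simp add: \<rho>_def power2_eq_square algebra_simps)
  have iexp: "iexp u = 1 + \<i> * u + \<rho> u" for u by (simp add: \<rho>_def)
  have "(1 - iexp (a * \<theta>)) * pois 0 x + (iexp \<theta> - iexp (a * \<theta>)) * pois 1 x =
      exp (- x) * ?z"
    unfolding a iexp by (simp add: pois_def algebra_simps power2_eq_square)
  also have "cmod \<dots> \<le> 1 * ?b"
    unfolding norm_mult
  proof (intro mult_mono)
    have "cmod ?z
      \<le> cmod (\<i> * \<theta> * x\<^sup>2) + cmod (\<rho> (x * \<theta>)) + (cmod (\<rho> \<theta>) + cmod (\<rho> (x * \<theta>))) * x"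
    proof -
      have "cmod ((\<rho> \<theta> - \<rho> (x * \<theta>)) * x) \<le> (cmod (\<rho> \<theta>) + cmod (\<rho> (x * \<theta>))) * x"
        using x by (simp add: norm_mult mult_right_mono norm_triangle_ineq4)
      moreover have "cmod (- (\<i> * \<theta> * x\<^sup>2) - \<rho> (x * \<theta>)) \<le> cmod (\<i> * \<theta> * x\<^sup>2) + cmod (\<rho> (x * \<theta>))"
        by (rule order.trans[OF norm_triangle_ineq4]) simp
      ultimately show ?thesis by (smt (verit) norm_triangle_ineq)
    qed
    also have "\<dots> \<le> ?b"
      by (intro add_mono mult_right_mono \<rho> x) (simp add: norm_mult norm_power)
    finally show "cmod ?z
      \<le> ?b" .
  qed (use x in auto)
  also have "\<dots> \<le> \<bar>\<theta>\<bar> * x\<^sup>2 + 2 * \<theta>\<^sup>2 * x"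
  proof -
    have "x\<^sup>2 \<le> x" using x False by (simp add: power2_eq_square mult_left_le)
    from mult_left_mono[OF this, of "\<theta>\<^sup>2"] have 1: "(x * \<theta>)\<^sup>2 \<le> \<theta>\<^sup>2 * x"
      by (simp add: power_mult_distrib mult.commute)
    have "(x * \<theta>)\<^sup>2 * x \<le> (x * \<theta>)\<^sup>2" using x False by (simp add: mult_left_le)
    with 1 have "(x * \<theta>)\<^sup>2 / 2 + (\<theta>\<^sup>2 * x / 2 + (x * \<theta>)\<^sup>2 * x / 2) \<le> 2 * (\<theta>\<^sup>2 * x)"
      using mult_nonneg_nonneg[OF zero_le_power2[of \<theta>] x] by linarith
    then show ?thesis by (simp add: distrib_right mult.assoc)
  qed
  finally show ?thesis using a by simp
qed

section \<open>Erlang ring times\<close>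

definition ring_law :: "nat \<Rightarrow> real measure" where
  "ring_law k = density lborel (erlang_density (k - 1) 1)"

lemma sets_ring_law [measurable_cong, simp]: "sets (ring_law k) = sets borel"
  by (simp add: ring_law_def)

lemma space_ring_law [simp]: "space (ring_law k) = UNIV"
  by (simp add: ring_law_def)

lemma pois_nonneg: "x \<ge> 0 \<Longrightarrow> pois r x \<ge> 0"
  by (simp add: pois_def)

lemma erlang_density_eq_pois: "erlang_density j 1 x = indicator {0..} x * pois j x"
  by (simp add: erlang_density_def pois_def indicator_def)

lemma AE_ring_law_nonneg: "AE t in ring_law k. 0 \<le> t"
  unfolding ring_law_def by (subst AE_density) (auto simp: erlang_density_def)

locale path_cuts =
  fixes k :: nat
  assumes k_ge_2: "2 \<le> k"
begin

definition tail :: "real \<Rightarrow> real" where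
  "tail x = (\<Sum>r<k. pois r x)"

sublocale ring: prob_space "ring_law k"
  unfolding ring_law_def by (rule prob_space_erlang_density) simp

sublocale seq: sequence_space "ring_law k" ..

lemma measure_ring_law_gt:
  assumes "x \<ge> 0"
  shows "measure (ring_law k) {x<..} = tail x"
proof -
  have "measure (ring_law k) {..x} = erlang_CDF (k - 1) 1 x"
    using emeasure_erlang_density[of 1 "k - 1" x]
    by (simp add: measure_def ring_law_def)
  also have "\<dots> = 1 - tail x"
    using assms k_ge_2 lessThan_Suc_atMost[of "k - 1"]
    by (simp add: erlang_CDF_def tail_def pois_def mult.commute)
  finally have "measure (ring_law k) (UNIV - {..x}) = tail x"
    using ring.prob_compl[of "{..x}"] by simp
  moreover have "UNIV - {..x} = {x<..}" by auto
  ultimately show ?thesis by simp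
qed

lemma tail_le_1: "x \<ge> 0 \<Longrightarrow> tail x \<le> 1"
  using measure_ring_law_gt[of x] ring.prob_le_1[of "{x<..}"] by simp

lemma tail_nonneg: "x \<ge> 0 \<Longrightarrow> tail x \<ge> 0"
  by (auto simp: tail_def pois_def intro!: sum_nonneg)

text \<open>Splits according to whether the ring falls after \<open>x\<close> or before. It
  identifies \<open>ring_op 1 k g x\<close> with the expectation of \<open>g\<close> at the minimum
  of \<open>x\<close> and an Erlang time, the link between the operators and actual random
  variables.\<close>

lemma integral_min_ring_law:
  fixes g :: "real \<Rightarrow> 'b::euclidean_space"
  assumes g: "continuous_on {0..} g" and [measurable]: "g \<in> borel_measurable borel" and x: "x \<ge> 0"
  shows "(\<integral>t. g (min x t) \<partial>ring_law k) =
    tail x *\<^sub>R g x + integral {0..x} (\<lambda>y. pois (k - 1) y *\<^sub>R g y)"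
proof -
  define h where "h t = indicator {0..x} t *\<^sub>R g t" for t
  have gx: "continuous_on {0..x} g" using g by (rule continuous_on_subset) auto
  have h_meas [measurable]: "h \<in> borel_measurable borel"
    unfolding h_def[abs_def] using borel_measurable_continuous_on_indicator[OF _ gx] by simp
  have cont: "continuous_on {0..x} (\<lambda>y. pois (k - 1) y *\<^sub>R g y)"
    by (intro continuous_intros gx)
  have int: "set_integrable lborel {0..x} (\<lambda>y. pois (k - 1) y *\<^sub>R g y)"
    unfolding set_integrable_def by (rule borel_integrable_compact) (use cont in auto)
  have hint: "integrable (ring_law k) h"
    unfolding ring_law_def
  proof (subst integrable_density)
    have "(\<lambda>t. erlang_density (k - 1) 1 t *\<^sub>R h t) =
        (\<lambda>y. indicator {0..x} y *\<^sub>R (pois (k - 1) y *\<^sub>R g y))"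
      by (auto simp: fun_eq_iff h_def erlang_density_eq_pois indicator_def)
    then show "integrable lborel (\<lambda>t. erlang_density (k - 1) 1 t *\<^sub>R h t)"
      using int by (simp add: set_integrable_def)
  qed auto
  have "(\<integral>t. g (min x t) \<partial>ring_law k) = (\<integral>t. h t + indicator {x<..} t *\<^sub>R g x \<partial>ring_law k)"
  proof (rule integral_cong_AE)
    show "AE t in ring_law k. g (min x t) = h t + indicator {x<..} t *\<^sub>R g x"
      using AE_ring_law_nonneg by eventually_elim (auto simp: h_def indicator_def min_def)
  qed measurable
  also have "\<dots> = (\<integral>t. h t \<partial>ring_law k) + (\<integral>t. indicator {x<..} t *\<^sub>R g x \<partial>ring_law k)"
    by (intro Bochner_Integration.integral_add hint) (auto intro!: ring.integrable_const_bound[where B="norm (g x)"] simp: indicator_def)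
  also have "(\<integral>t. indicator {x<..} t *\<^sub>R g x \<partial>ring_law k) = tail x *\<^sub>R g x"
    unfolding measure_ring_law_gt[OF x, symmetric]
    by (rule has_bochner_integral_integral_eq[OF has_bochner_integral_indicator])
      (auto simp: ring.emeasure_eq_measure)
  also have "(\<integral>t. h t \<partial>ring_law k) = (LINT y:{0..x}|lborel. pois (k - 1) y *\<^sub>R g y)"
    unfolding ring_law_def set_lebesgue_integral_def
    by (subst integral_density)
      (auto simp: h_def erlang_density_eq_pois indicator_def pois_nonneg intro!: Bochner_Integration.integral_cong)
  also have "\<dots> = integral {0..x} (\<lambda>y. pois (k - 1) y *\<^sub>R g y)"
    by (rule set_borel_integral_eq_integral) (rule int)
  finally show ?thesis by (simp add: add.commute)
qed


abbreviation seqs :: "(nat \<Rightarrow> real) measure" where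
  "seqs \<equiv> \<Pi>\<^sub>M i\<in>UNIV. ring_law k"

lemma measurable_run_min [measurable]:
  assumes [measurable]: "f \<in> borel_measurable M" "h \<in> measurable M seqs"
  shows "(\<lambda>z. run_min (f z) (h z) v) \<in> borel_measurable M"
proof -
  have [measurable]: "(\<lambda>z. h z j) \<in> borel_measurable M" for j
    using measurable_compose[OF assms(2) measurable_component_singleton[of j UNIV]]
    by (simp cong: measurable_cong_sets)
  show ?thesis by (induction v) auto
qed

text \<open>The first ring time is independent of the later ones, and these again form a sequence
  with the same law.\<close>

lemma integral_seqs_split:
  fixes F :: "(nat \<Rightarrow> real) \<Rightarrow> 'b::{banach, second_countable_topology}"
  assumes [measurable]: "F \<in> borel_measurable seqs" and B: "\<And>\<omega>. norm (F \<omega>) \<le> B"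
  shows "(\<integral>\<omega>. F \<omega> \<partial>seqs) = (\<integral>t. (\<integral>\<omega>. F (case_nat t \<omega>) \<partial>seqs) \<partial>ring_law k)"
proof -
  interpret P: pair_prob_space "ring_law k" seqs ..
  have "(\<integral>\<omega>. F \<omega> \<partial>seqs) = (\<integral>\<omega>. F \<omega> \<partial>distr (ring_law k \<Otimes>\<^sub>M seqs) seqs (\<lambda>(t, \<omega>). case_nat t \<omega>))"
    by (simp only: seq.PiM_iter)
  also have "\<dots> = (\<integral>z. F (case_nat (fst z) (snd z)) \<partial>(ring_law k \<Otimes>\<^sub>M seqs))"
    by (subst integral_distr) (auto simp: case_prod_beta')
  also have "\<dots> = (\<integral>t. (\<integral>\<omega>. F (case_nat t \<omega>) \<partial>seqs) \<partial>ring_law k)"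
    using P.integral_fst'[of "\<lambda>z. F (case_nat (fst z) (snd z))"]
    by (simp add: P.integrable_const_bound[of _ B] B)
  finally show ?thesis .
qed

text \<open>The cap \<open>min 1 x\<close> makes the value constant for \<open>x \<ge> 1\<close>, so
  it can be compared with \<open>cut_gf\<close> while \<open>x\<close> tends to infinity
  there.\<close>

definition chain_cf :: "real \<Rightarrow> nat \<Rightarrow> real \<Rightarrow> complex" where
  "chain_cf \<theta> m x = (\<integral>\<omega>. iexp (\<theta> * (\<Sum>v<m. run_min (min 1 x) \<omega> v)) \<partial>seqs)"

lemma chain_cf_measurable [measurable]: "chain_cf \<theta> m \<in> borel_measurable borel"
  unfolding chain_cf_def[abs_def] by measurable

lemma chain_cf_le_1: "cmod (chain_cf \<theta> m x) \<le> 1"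
  unfolding chain_cf_def
  by (rule order.trans[OF integral_norm_bound]) (simp add: seq.P.prob_space)

lemma chain_cf_Suc_integral:
  "chain_cf \<theta> (Suc m) x = iexp (\<theta> * min 1 x) * (\<integral>t. chain_cf \<theta> m (min x t) \<partial>ring_law k)"
proof -
  let ?K = "\<lambda>t. \<integral>\<omega>. iexp (\<theta> * (\<Sum>v<Suc m. run_min (min 1 x) (case_nat t \<omega>) v)) \<partial>seqs"
  have "chain_cf \<theta> (Suc m) x = (\<integral>t. ?K t \<partial>ring_law k)"
    unfolding chain_cf_def by (rule integral_seqs_split[where B = 1]) auto
  also have "\<dots> = (\<integral>t. iexp (\<theta> * min 1 x) * chain_cf \<theta> m (min x t) \<partial>ring_law k)"
  proof (rule Bochner_Integration.integral_cong[OF refl])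
    fix t
    have "(\<Sum>v<Suc m. run_min (min 1 x) (case_nat t \<omega>) v) =
        min 1 x + (\<Sum>v<m. run_min (min 1 (min x t)) \<omega> v)" for \<omega>
      by (simp only: sum.lessThan_Suc_shift run_min_case_nat run_min.simps(1) min.assoc)
    then show "?K t =
        iexp (\<theta> * min 1 x) * chain_cf \<theta> m (min x t)"
      by (simp add: chain_cf_def distrib_left exp_add)
  qed
  finally show ?thesis by simp
qed

text \<open>The two facts are obtained together: the recursion requires continuity of the previous
  function, and continuity of the next one is read off from the recursion.\<close>

lemma chain_cf_continuous: "continuous_on {0..} (chain_cf \<theta> m)"
  and chain_cf_Suc: "x \<ge> 0 \<Longrightarrow> chain_cf \<theta> (Suc m) x = iexp (\<theta> * min 1 x) * ring_op 1 k (chain_cf \<theta> m) x"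
proof -
  have rec: "chain_cf \<theta> (Suc m) x = iexp (\<theta> * min 1 x) * ring_op 1 k (chain_cf \<theta> m) x"
    if "continuous_on {0..} (chain_cf \<theta> m)" "x \<ge> 0" for m x
    unfolding chain_cf_Suc_integral using integral_min_ring_law[OF that(1) _ that(2)]
    by (simp add: ring_op_def tail_def scaleR_conv_of_real)
  show cont: "continuous_on {0..} (chain_cf \<theta> m)" for m
  proof (induction m)
    case 0
    then show ?case by (simp add: chain_cf_def seq.P.prob_space)
  next
    case (Suc m)
    have "continuous_on {0..} (\<lambda>x. iexp (\<theta> * min 1 x) * ring_op 1 k (chain_cf \<theta> m) x)"
      by (intro continuous_intros continuous_on_ring_op Suc)
    then show ?case by (subst continuous_on_cong[OF refl rec[OF Suc]]) auto
  qed
  show "x \<ge> 0 \<Longrightarrow> chain_cf \<theta> (Suc m) x = iexp (\<theta> * min 1 x) * ring_op 1 k (chain_cf \<theta> m) x"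
    by (rule rec[OF cont])
qed

text \<open>Error of one vertex whose capped minimum is \<open>a\<close>. In \<open>k + 2\<close>,
  the part \<open>k + 1\<close> comes from two or more rings and 1 from the second-order term for
  zero or one ring.\<close>

definition step_err :: "real \<Rightarrow> real \<Rightarrow> real" where
  "step_err \<theta> a = (real k + 2) * \<bar>\<theta>\<bar> * a\<^sup>2 + 2 * \<theta>\<^sup>2 * a"


lemma step_err_mono: "0 \<le> a \<Longrightarrow> a \<le> b \<Longrightarrow> step_err \<theta> a \<le> step_err \<theta> b"
  unfolding step_err_def by (intro add_mono mult_left_mono power_mono) auto

lemma step_err_nonneg: "0 \<le> a \<Longrightarrow> 0 \<le> step_err \<theta> a"
  by (simp add: step_err_def)

lemma step_err_measurable [measurable]: "step_err \<theta> \<in> borel_measurable borel"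
  unfolding step_err_def[abs_def] by measurable

lemma tail_upper_integral:
  assumes "x \<ge> 0"
  shows "tail x + integral {0..x} (pois (k - 1)) = 1"
  using integral_min_ring_law[of "\<lambda>_. 1 :: real" x] assms ring.prob_space by simp

text \<open>On the unit circle the powers of \<open>s\<close> have modulus 1, so the operator is
  dominated by averaging against the law of the minimum of \<open>x\<close> and a ring time; earlier
  errors are propagated without amplification.\<close>

lemma norm_ring_op_le:
  fixes g :: "real \<Rightarrow> complex"
  assumes g: "continuous_on {0..} g" and e: "continuous_on {0..} e"
    and le: "\<And>y. y \<ge> 0 \<Longrightarrow> cmod (g y) \<le> e y" and s: "cmod s = 1" and x: "x \<ge> 0"
  shows "cmod (ring_op s k g x) \<le> tail x * e x + integral {0..x} (\<lambda>y. pois (k - 1) y * e y)"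
proof -
  let ?P = "integral {0..x} (\<lambda>y. pois (k - 1) y * e y)" and ?R = "integral {0..x} (\<lambda>y. complex_of_real (pois (k - 1) y) * g y)"
  have "cmod (\<Sum>r<k. s ^ r * complex_of_real (pois r x)) \<le> tail x"
    unfolding tail_def by (rule sum_norm_le) (use s x in \<open>auto simp: norm_mult norm_power pois_nonneg\<close>)
  then have "cmod ((\<Sum>r<k. s ^ r * complex_of_real (pois r x)) * g x) \<le> tail x * e x"
    unfolding norm_mult using le[OF x] by (intro mult_mono) (auto simp: tail_nonneg x)
  moreover have "cmod ?R \<le>
      ?P"
    by (intro integral_norm_bound_integral integrable_half_line continuous_intros g e)
      (use le in \<open>auto simp: norm_mult pois_nonneg intro!: mult_left_mono\<close>)
  then have "cmod (s ^ k * ?R) \<le>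
      ?P"
    using s by (simp add: norm_mult norm_power)
  ultimately show ?thesis
    unfolding ring_op_def using norm_triangle_mono by blast
qed

text \<open>Compares the random number of rings, at most \<open>k\<close>, with its deterministic
  substitute \<open>min 1 x\<close>. Zero or one ring cancel up to second order; for more rings the
  difference is crude, but the event itself has second-order probability.\<close>

lemma ring_op_step_err:
  fixes g :: "real \<Rightarrow> complex"
  assumes g: "continuous_on {0..} g" "\<And>y. cmod (g y) \<le> 1" and x: "x \<ge> 0"
  shows "cmod (ring_op (iexp \<theta>) k g x - iexp (\<theta> * min 1 x) * ring_op 1 k g x) \<le> step_err \<theta> (min 1 x)"
proof -
  define a where "a = min 1 x"
  have a: "0 \<le> a" "a \<le> 1" using x by (auto simp: a_def)
  define d where "d r = iexp \<theta> ^ r - iexp (a * \<theta>)" for r :: nat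
  define I where "I = integral {0..x} (\<lambda>y. complex_of_real (pois (k - 1) y) * g y)"
  have d_le: "cmod (d r) \<le> (real k + 1) * \<bar>\<theta>\<bar>" if "r \<le> k" for r
  proof -
    have "cmod (d r) \<le> \<bar>real r * \<theta> - a * \<theta>\<bar>"
      unfolding d_def iexp_power by (rule iexp_diff_bound)
    also have "\<dots> = \<bar>real r - a\<bar> * \<bar>\<theta>\<bar>" by (simp add: left_diff_distrib flip: abs_mult)
    also have "\<dots> \<le> (real k + 1) * \<bar>\<theta>\<bar>" using that a by (intro mult_right_mono) auto
    finally show ?thesis .
  qed
  have split: "{..<k} = {0, 1} \<union> {2..<k}" using k_ge_2 by auto
  have "ring_op (iexp \<theta>) k g x - iexp (\<theta> * min 1 x) * ring_op 1 k g x =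
      (\<Sum>r<k. d r * pois r x) * g x + d k * I"
    by (simp add: ring_op_def d_def I_def a_def[symmetric] mult.commute[of \<theta>]
        left_diff_distrib right_diff_distrib distrib_left sum_subtractf sum_distrib_left sum_distrib_right mult.assoc)
  also have "\<dots> = (d 0 * pois 0 x + d 1 * pois 1 x) * g x + ((\<Sum>r\<in>{2..<k}. d r * pois r x) * g x + d k * I)"
    unfolding split by (subst sum.union_disjoint) (auto simp: algebra_simps)
  also have "cmod \<dots> \<le> (\<bar>\<theta>\<bar> * a\<^sup>2 + 2 * \<theta>\<^sup>2 * a) + (real k + 1) * \<bar>\<theta>\<bar> * a\<^sup>2"
  proof (rule norm_triangle_mono)
    have "cmod (d 0 * pois 0 x + d 1 * pois 1 x) \<le> \<bar>\<theta>\<bar> * a\<^sup>2 + 2 * \<theta>\<^sup>2 * a"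
      using iexp_two_terms_bound[OF x, of \<theta>] by (simp add: d_def a_def)
    then have "cmod ((d 0 * pois 0 x + d 1 * pois 1 x) * g x) \<le> (\<bar>\<theta>\<bar> * a\<^sup>2 + 2 * \<theta>\<^sup>2 * a) * 1"
      unfolding norm_mult using g(2) a by (intro mult_mono) auto
    then show "cmod ((d 0 * pois 0 x + d 1 * pois 1 x) * g x) \<le> \<bar>\<theta>\<bar> * a\<^sup>2 + 2 * \<theta>\<^sup>2 * a" by simp
    have "cmod I \<le> integral {0..x} (pois (k - 1))"
      unfolding I_def
      by (intro integral_norm_bound_integral integrable_half_line continuous_intros g)
        (use g(2) in \<open>auto simp: norm_mult pois_nonneg intro!: mult_left_le\<close>)
    then have "cmod (d k * I) \<le> (real k + 1) * \<bar>\<theta>\<bar> * integral {0..x} (pois (k - 1))"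
      unfolding norm_mult by (intro mult_mono d_le) auto
    moreover have "cmod ((\<Sum>r\<in>{2..<k}. d r * pois r x) * g x) \<le> (real k + 1) * \<bar>\<theta>\<bar> * (\<Sum>r\<in>{2..<k}. pois r x) * 1"
      unfolding norm_mult
    proof (rule mult_mono[OF _ g(2)])
      have "cmod (\<Sum>r\<in>{2..<k}. d r * pois r x) \<le> (\<Sum>r\<in>{2..<k}. (real k + 1) * \<bar>\<theta>\<bar> * pois r x)"
        by (rule sum_norm_le) (use pois_nonneg[OF x] d_le in \<open>auto simp: norm_mult intro!: mult_right_mono\<close>)
      then show "cmod (\<Sum>r\<in>{2..<k}. d r * pois r x) \<le> (real k + 1) * \<bar>\<theta>\<bar> * (\<Sum>r\<in>{2..<k}. pois r x)"
        by (simp add: sum_distrib_left)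
    qed (use pois_nonneg[OF x] in \<open>auto intro!: mult_nonneg_nonneg sum_nonneg\<close>)
    ultimately have "cmod ((\<Sum>r\<in>{2..<k}. d r * pois r x) * g x + d k * I) \<le>
        (real k + 1) * \<bar>\<theta>\<bar> * ((\<Sum>r\<in>{2..<k}. pois r x) + integral {0..x} (pois (k - 1)))"
      unfolding distrib_left by (intro norm_triangle_mono) auto
    \<comment> \<open>The left side is the Poisson probability of at least two rings, the integral
      accounting for \<open>k\<close> or more. For \<open>x \<le> 1\<close> it is at most
      \<open>x^2\<close> because \<open>exp (- x) \<ge> 1 - x\<close>.\<close>
    also have "(\<Sum>r\<in>{2..<k}. pois r x) + integral {0..x} (pois (k - 1)) = 1 - pois 0 x - pois 1 x"
      using tail_upper_integral[OF x] unfolding tail_def split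
      by (subst (asm) sum.union_disjoint) auto
    also have "\<dots> \<le> a\<^sup>2"
    proof (cases "x \<le> 1")
      case True
      have "(1 - x) * (1 + x) \<le> exp (- x) * (1 + x)"
        using x exp_ge_add_one_self[of "- x"] by (intro mult_right_mono) auto
      then show ?thesis using True by (simp add: a_def pois_def power2_eq_square algebra_simps)
    next
      case False
      then show ?thesis using pois_nonneg[OF x, of 0] pois_nonneg[OF x, of 1] by (simp add: a_def)
    qed
    finally show "cmod ((\<Sum>r\<in>{2..<k}. d r * pois r x) * g x + d k * I) \<le> (real k + 1) * \<bar>\<theta>\<bar> * a\<^sup>2"
      by (simp add: mult_left_mono)
  qed
  finally show ?thesis by (simp add: step_err_def a_def algebra_simps)
qed

text \<open>The \<open>max 0\<close> makes the bounds valid for every sequence, also on the null set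
  where ring times are negative.\<close>

abbreviation err_sum :: "real \<Rightarrow> nat \<Rightarrow> real \<Rightarrow> (nat \<Rightarrow> real) \<Rightarrow> real" where
  "err_sum \<theta> m x \<omega> \<equiv> \<Sum>v<m. step_err \<theta> (max 0 (run_min (min 1 x) \<omega> v))"

definition chain_err :: "real \<Rightarrow> nat \<Rightarrow> real \<Rightarrow> real" where
  "chain_err \<theta> m x = (\<integral>\<omega>. (err_sum \<theta> m x \<omega>) \<partial>seqs)"

lemma step_err_run_min_bound:
  "norm (err_sum \<theta> m x \<omega>) \<le> real m * step_err \<theta> 1"
proof -
  have "run_min (min 1 x) \<omega> v \<le> 1" for v using run_min_le[of "min 1 x" \<omega> v] by simp
  then have "(err_sum \<theta> m x \<omega>) \<le> (\<Sum>v<m. step_err \<theta> 1)"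
    by (intro sum_mono step_err_mono) auto
  moreover have "0 \<le> (err_sum \<theta> m x \<omega>)"
    by (intro sum_nonneg step_err_nonneg) auto
  ultimately show ?thesis by simp
qed

lemma chain_err_measurable [measurable]: "chain_err \<theta> m \<in> borel_measurable borel"
  unfolding chain_err_def[abs_def] by measurable

lemma chain_err_Suc_integral:
  assumes "x \<ge> 0"
  shows "chain_err \<theta> (Suc m) x = step_err \<theta> (min 1 x) + (\<integral>t. chain_err \<theta> m (min x t) \<partial>ring_law k)"
proof -
  note int = seq.P.integrable_const_bound[OF always_eventually[OF allI[OF step_err_run_min_bound]]]
  have "chain_err \<theta> (Suc m) x = (\<integral>t. (\<integral>\<omega>. (err_sum \<theta> (Suc m) x (case_nat t \<omega>)) \<partial>seqs) \<partial>ring_law k)"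
    unfolding chain_err_def
    by (rule integral_seqs_split[OF _ step_err_run_min_bound]) measurable
  also have "\<dots> = (\<integral>t. step_err \<theta> (min 1 x) + chain_err \<theta> m (min x t) \<partial>ring_law k)"
  proof (rule Bochner_Integration.integral_cong[OF refl])
    fix t
    have "(err_sum \<theta> (Suc m) x (case_nat t \<omega>)) =
        step_err \<theta> (min 1 x) + (err_sum \<theta> m (min x t) \<omega>)" for \<omega>
      using assms by (simp only: sum.lessThan_Suc_shift run_min_case_nat run_min.simps(1) min.assoc)
    moreover have "integrable seqs (\<lambda>\<omega>. err_sum \<theta> m (min x t) \<omega>)"
      by (rule int) measurable
    ultimately show "(\<integral>\<omega>. (err_sum \<theta> (Suc m) x (case_nat t \<omega>)) \<partial>seqs) =
        step_err \<theta> (min 1 x) + chain_err \<theta> m (min x t)"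
      by (simp add: chain_err_def seq.P.prob_space)
  qed
  also have "\<dots> = step_err \<theta> (min 1 x) + (\<integral>t. chain_err \<theta> m (min x t) \<partial>ring_law k)"
  proof (subst Bochner_Integration.integral_add)
    have "norm (chain_err \<theta> m y) \<le> real m * step_err \<theta> 1" for y
      unfolding chain_err_def
      by (rule order.trans[OF integral_norm_bound])
        (rule seq.P.integral_le_const[OF integrable_norm[OF int]], measurable,
          auto intro: step_err_run_min_bound[unfolded real_norm_def])
    then show "integrable (ring_law k) (\<lambda>t. chain_err \<theta> m (min x t))"
      by (intro ring.integrable_const_bound[where B = "real m * step_err \<theta> 1"]) auto
  qed (simp_all add: ring.prob_space[simplified])
  finally show ?thesis .
qed

lemma chain_err_continuous: "continuous_on {0..} (chain_err \<theta> m)"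
  and chain_err_Suc: "x \<ge> 0 \<Longrightarrow> chain_err \<theta> (Suc m) x = step_err \<theta> (min 1 x) +
    (tail x * chain_err \<theta> m x + integral {0..x} (\<lambda>y. pois (k - 1) y * chain_err \<theta> m y))"
proof -
  let ?T = "\<lambda>m x. integral {0..x} (\<lambda>y. pois (k - 1) y * chain_err \<theta> m y)"
  have rec: "chain_err \<theta> (Suc m) x = step_err \<theta> (min 1 x) +
    (tail x * chain_err \<theta> m x + ?T m x)"
    if "continuous_on {0..} (chain_err \<theta> m)" "x \<ge> 0" for m x
    using chain_err_Suc_integral[OF that(2)] integral_min_ring_law[OF that(1) _ that(2)] by simp
  show cont: "continuous_on {0..} (chain_err \<theta> m)" for m
  proof (induction m)
    case 0
    then show ?case by (simp add: chain_err_def)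
  next
    case (Suc m)
    have "continuous_on {0..} (\<lambda>x. ?T m x)"
      by (rule continuous_on_half_line_deriv[OF integral_deriv_half_line])
        (auto intro!: continuous_intros Suc)
    then have "continuous_on {0..} (\<lambda>x. step_err \<theta> (min 1 x) +
        (tail x * chain_err \<theta> m x + ?T m x))"
      unfolding step_err_def tail_def by (intro continuous_intros Suc)
    then show ?case by (subst continuous_on_cong[OF refl rec[OF Suc]]) auto
  qed
  show "x \<ge> 0 \<Longrightarrow> chain_err \<theta> (Suc m) x = step_err \<theta> (min 1 x) +
    (tail x * chain_err \<theta> m x + ?T m x)"
    by (rule rec[OF cont])
qed

text \<open>The telescoping step: the operator applied to the old difference is controlled by
  domination, the change of operator by \<open>step_err\<close>. \<open>chain_err\<close> satisfies
  the resulting recursion with equality.\<close>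

lemma cut_gf_chain_cf:
  "x \<ge> 0 \<Longrightarrow> cmod (cut_gf (iexp \<theta>) (replicate m k) x - chain_cf \<theta> m x) \<le> chain_err \<theta> m x"
proof (induction m arbitrary: x)
  case 0
  then show ?case by (simp add: chain_cf_def chain_err_def seq.P.prob_space)
next
  case (Suc m)
  let ?s = "iexp \<theta>" and ?U = "cut_gf (iexp \<theta>) (replicate m k)"
  have "?U = (\<lambda>y. (?U y - chain_cf \<theta> m y) + chain_cf \<theta> m y)" by simp
  then have "ring_op ?s k ?U x = ring_op ?s k (\<lambda>y. (?U y - chain_cf \<theta> m y) + chain_cf \<theta> m y) x"
    by simp
  also have "\<dots> = ring_op ?s k (\<lambda>y. ?U y - chain_cf \<theta> m y) x + ring_op ?s k (chain_cf \<theta> m) x"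
    by (intro ring_op_add continuous_intros continuous_on_cut_gf chain_cf_continuous)
  finally have "cut_gf ?s (replicate (Suc m) k) x - chain_cf \<theta> (Suc m) x =
      ring_op ?s k (\<lambda>y. ?U y - chain_cf \<theta> m y) x +
      (ring_op ?s k (chain_cf \<theta> m) x - iexp (\<theta> * min 1 x) * ring_op 1 k (chain_cf \<theta> m) x)"
    using Suc.prems by (simp add: chain_cf_Suc)
  also have "cmod \<dots> \<le> (tail x * chain_err \<theta> m x + integral {0..x} (\<lambda>y. pois (k - 1) y * chain_err \<theta> m y))
      + step_err \<theta> (min 1 x)"
    by (intro norm_triangle_mono norm_ring_op_le ring_op_step_err continuous_intros continuous_on_cut_gf
        chain_cf_continuous chain_err_continuous Suc chain_cf_le_1) auto
  finally show ?case using Suc.prems by (simp add: chain_err_Suc add.commute)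
qed

theorem path_kcut_number_chain_cf:
  "cmod ((\<integral>x. iexp \<theta> ^ x \<partial>measure_pmf (path_kcut_number k n)) - chain_cf \<theta> n 1) \<le> chain_err \<theta> n 1"
proof -
  have "k \<ge> 1" using k_ge_2 by simp
  \<comment> \<open>Beyond 1 the bound no longer depends on \<open>x\<close>, so it survives the
    limit.\<close>
  have const: "chain_cf \<theta> n x = chain_cf \<theta> n 1" "chain_err \<theta> n x = chain_err \<theta> n 1" if "x \<ge> 1" for x
    using that by (simp_all add: chain_cf_def chain_err_def)
  have "((\<lambda>x. cmod (cut_gf (iexp \<theta>) (replicate n k) x - chain_cf \<theta> n 1)) \<longlongrightarrow>
      cmod ((\<integral>x. iexp \<theta> ^ x \<partial>measure_pmf (path_kcut_number k n)) - chain_cf \<theta> n 1)) at_top"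
    by (intro tendsto_intros cut_gf_path \<open>k \<ge> 1\<close>)
  then show ?thesis
  proof (rule tendsto_upperbound)
    show "\<forall>\<^sub>F x in at_top. cmod (cut_gf (iexp \<theta>) (replicate n k) x - chain_cf \<theta> n 1) \<le> chain_err \<theta> n 1"
      using eventually_ge_at_top[of 1]
    proof eventually_elim
      case (elim x)
      then show ?case using cut_gf_chain_cf[of x \<theta> n] const[of x] by simp
    qed
  qed simp
qed

end

section \<open>Cube and simplex integrals as product measures\<close>

definition unit_law :: "real measure" where
  "unit_law = density lborel (indicator {0..1})"

lemma sets_unit_law [measurable_cong, simp]: "sets unit_law = sets borel"
  by (simp add: unit_law_def)

lemma space_unit_law [simp]: "space unit_law = UNIV"
  by (simp add: unit_law_def)

lemma nn_integral_unit_law: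
  "f \<in> borel_measurable borel \<Longrightarrow> (\<integral>\<^sup>+t. f t \<partial>unit_law) = (\<integral>\<^sup>+t\<in>{0..1}. f t \<partial>lborel)"
  unfolding unit_law_def by (subst nn_integral_density) (auto simp: mult.commute)

interpretation unit_law: prob_space unit_law
  by (rule prob_spaceI) (simp add: unit_law_def emeasure_density)

interpretation unit_laws: product_prob_space "\<lambda>_::nat. unit_law" UNIV ..

interpretation lborels: product_sigma_finite "\<lambda>_::nat. lborel :: real measure" ..

abbreviation lborel_power :: "nat \<Rightarrow> (nat \<Rightarrow> real) measure" where
  "lborel_power q \<equiv> Pi\<^sub>M {..<q} (\<lambda>_. lborel)"

abbreviation unit_power :: "nat \<Rightarrow> (nat \<Rightarrow> real) measure" where
  "unit_power q \<equiv> Pi\<^sub>M {..<q} (\<lambda>_. unit_law)"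

abbreviation power_pair :: "nat \<Rightarrow> ((nat \<Rightarrow> real) \<times> (nat \<Rightarrow> real)) measure" where
  "power_pair q \<equiv> unit_power q \<Otimes>\<^sub>M lborel_power q"

interpretation unit_power: sigma_finite_measure "unit_power q" for q
  by (rule product_sigma_finite.sigma_finite[OF unit_laws.product_sigma_finite_axioms]) simp

interpretation lborel_power: sigma_finite_measure "lborel_power q" for q
  by (rule lborels.sigma_finite) simp

interpretation power_pair: pair_sigma_finite "unit_power q" "lborel_power q" for q ..

text \<open>
  The last coordinate comes first, since \<open>insert q {..<q}\<close> makes coordinate \<open>q\<close> the outermost one.
\<close>

definition rev_list :: "nat \<Rightarrow> (nat \<Rightarrow> real) \<Rightarrow> real list" where
  "rev_list q x = map x (rev [0..<q])"

lemma length_rev_list [simp]: "length (rev_list q x) = q"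
  by (simp add: rev_list_def)

lemma nth_rev_list: "i < q \<Longrightarrow> rev_list q x ! i = x (q - Suc i)"
  by (simp add: rev_list_def rev_nth)

lemma rev_list_0 [simp]: "rev_list 0 x = []"
  by (simp add: rev_list_def)

lemma rev_list_Suc_upd: "rev_list (Suc q) (x(q := y)) = y # rev_list q x"
  by (simp add: rev_list_def)

lemma (in product_sigma_finite) nn_integral_section_measurable:
  assumes "finite I" "i \<notin> I" and f: "f \<in> borel_measurable (Pi\<^sub>M (insert i I) M)"
  shows "(\<lambda>y. \<integral>\<^sup>+x. f (x(i := y)) \<partial>Pi\<^sub>M I M) \<in> borel_measurable (M i)"
proof -
  interpret I: finite_product_sigma_finite M I by standard fact
  have "(\<lambda>(y, x). x(i := y)) \<in> measurable (M i \<Otimes>\<^sub>M Pi\<^sub>M I M) (Pi\<^sub>M (insert i I) M)"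
    using measurable_compose[OF measurable_pair_swap' measurable_add_dim[of i I M]]
    by (simp add: case_prod_beta')
  from measurable_compose[OF this f]
  show ?thesis
    by (intro I.borel_measurable_nn_integral) (simp add: case_prod_beta')
qed

lemma measurable_section:
  assumes f: "f \<in> borel_measurable (Pi\<^sub>M (insert i I) M)" and y: "y \<in> space (M i)"
  shows "(\<lambda>x. f (x(i := y))) \<in> borel_measurable (Pi\<^sub>M I M)"
proof -
  have "(\<lambda>x. (x, y)) \<in> measurable (Pi\<^sub>M I M) (Pi\<^sub>M I M \<Otimes>\<^sub>M M i)" using y by measurable
  from measurable_compose[OF measurable_compose[OF this measurable_add_dim] f]
  show ?thesis by simp
qed

lemma cube_integral_cong:
  assumes "\<And>ts. length ts = q \<Longrightarrow> set ts \<subseteq> {0..1} \<Longrightarrow> g ts = h ts"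
  shows "cube_integral q g = cube_integral q h"
  using assms
proof (induction q arbitrary: g h)
  case (Suc q)
  show ?case
    unfolding cube_integral.simps
  proof (rule nn_integral_cong)
    fix t
    show "cube_integral q (\<lambda>ts. g (t # ts)) * indicator {0..1} t =
        cube_integral q (\<lambda>ts. h (t # ts)) * indicator {0..1} t"
      using Suc.IH[of "\<lambda>ts. g (t # ts)" "\<lambda>ts. h (t # ts)"] Suc.prems by (auto simp: indicator_def)
  qed
qed simp

lemma cube_integral_eq:
  assumes "(\<lambda>\<tau>. g (rev_list q \<tau>)) \<in> borel_measurable (unit_power q)"
  shows "cube_integral q g = (\<integral>\<^sup>+\<tau>. g (rev_list q \<tau>) \<partial>unit_power q)"
  using assms
proof (induction q arbitrary: g)
  case 0
  then show ?case using unit_laws.nn_integral_empty[of "\<lambda>\<tau>. g []"] by (simp add: lessThan_0)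
next
  case (Suc q)
  have ins: "{..<Suc q} = insert q {..<q}" by auto
  note meas = Suc.prems[unfolded ins]
  have sec: "(\<lambda>y. \<integral>\<^sup>+x. g (rev_list (Suc q) (x(q := y))) \<partial>unit_power q) \<in> borel_measurable unit_law"
    by (rule unit_laws.nn_integral_section_measurable[OF _ _ meas]) auto
  have "(\<integral>\<^sup>+\<tau>. g (rev_list (Suc q) \<tau>) \<partial>unit_power (Suc q)) =
      (\<integral>\<^sup>+y. (\<integral>\<^sup>+x. g (rev_list (Suc q) (x(q := y))) \<partial>unit_power q) \<partial>unit_law)"
    unfolding ins by (rule unit_laws.product_nn_integral_insert_rev[OF _ _ meas]) auto
  also have "\<dots> = (\<integral>\<^sup>+y\<in>{0..1}. (\<integral>\<^sup>+x. g (rev_list (Suc q) (x(q := y))) \<partial>unit_power q) \<partial>lborel)"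
    by (rule nn_integral_unit_law) (use sec in \<open>simp cong: measurable_cong_sets\<close>)
  also have "\<dots> = cube_integral (Suc q) g"
    unfolding cube_integral.simps
  proof (intro nn_integral_cong arg_cong2[where f = "(*)"] refl)
    fix y :: real
    show "(\<integral>\<^sup>+x. g (rev_list (Suc q) (x(q := y))) \<partial>unit_power q) = cube_integral q (\<lambda>ts. g (y # ts))"
      using measurable_section[OF meas, of y] unfolding rev_list_Suc_upd by (subst Suc.IH) simp_all
  qed
  finally show ?case by simp
qed

text \<open>Owing to the reversal in \<open>rev_list\<close>, a decreasing list has coordinates that
  increase with the index, and \<open>x (q - 1)\<close> is the outermost variable, the one confined
  to \<open>S\<close>.\<close>

definition decr_set :: "nat \<Rightarrow> real set \<Rightarrow> (nat \<Rightarrow> real) set" where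
  "decr_set q S = {x. (q > 0 \<longrightarrow> x (q - 1) \<in> S) \<and> (\<forall>i<q. 0 \<le> x i) \<and> (\<forall>i<q - 1. x i \<le> x (Suc i))}"

lemma decr_set_Suc_upd:
  assumes "S \<subseteq> {0..}"
  shows "x(q := y) \<in> decr_set (Suc q) S \<longleftrightarrow> y \<in> S \<and> x \<in> decr_set q {0..y}"
proof (cases q)
  case (Suc p)
  have "(\<forall>i<Suc p. (x(q := y)) i \<le> (x(q := y)) (Suc i)) \<longleftrightarrow> (\<forall>i<p. x i \<le> x (Suc i)) \<and> x p \<le> y"
    by (auto simp: Suc less_Suc_eq)
  then show ?thesis using assms by (auto simp: decr_set_def Suc less_Suc_eq)
qed (use assms in \<open>auto simp: decr_set_def\<close>)

lemma decr_set_measurable: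
  assumes [measurable]: "S \<in> sets borel"
  shows "(\<lambda>x. indicator (decr_set q S) x :: ennreal) \<in> borel_measurable (lborel_power q)"
proof -
  let ?M = "lborel_power q"
  have comp: "(\<lambda>x. x i) \<in> borel_measurable ?M" if "i < q" for i
    using measurable_component_singleton[of i "{..<q}" "\<lambda>_. lborel :: real measure"] that by simp
  have "Measurable.pred ?M (\<lambda>x. \<forall>i\<in>{..<q}. 0 \<le> x i)"
    by (intro pred_intros_finite) (auto intro!: borel_measurable_le comp)
  moreover have "Measurable.pred ?M (\<lambda>x. \<forall>i\<in>{..<q - 1}. x i \<le> x (Suc i))"
    by (intro pred_intros_finite) (auto simp: pred_def intro!: borel_measurable_le comp)
  moreover have "Measurable.pred ?M (\<lambda>x. q > 0 \<longrightarrow> x (q - 1) \<in> S)"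
    using measurable_sets[OF comp[of "q - 1"] assms] by (cases "q > 0") (simp_all add: pred_def vimage_def Int_def conj_commute)
  ultimately have "Measurable.pred ?M (\<lambda>x. (q > 0 \<longrightarrow> x (q - 1) \<in> S) \<and>
      (\<forall>i\<in>{..<q}. 0 \<le> x i) \<and> (\<forall>i\<in>{..<q - 1}. x i \<le> x (Suc i)))"
    unfolding pred_def by (intro sets.sets_Collect_conj)
  then have "Measurable.pred ?M (\<lambda>x. x \<in> decr_set q S)"
    by (simp only: decr_set_def mem_Collect_eq Ball_def lessThan_iff)
  then show ?thesis by (intro borel_measurable_indicator') (simp only: pred_def)
qed

lemma decreasing_integral_eq:
  assumes "(\<lambda>x. g (rev_list q x)) \<in> borel_measurable (lborel_power q)"
    and "S \<in> sets borel" "S \<subseteq> {0..}"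
  shows "decreasing_integral q S g =
    (\<integral>\<^sup>+x. g (rev_list q x) * indicator (decr_set q S) x \<partial>lborel_power q)"
  using assms
proof (induction q arbitrary: g S)
  case 0
  then show ?case using lborels.nn_integral_empty[of "\<lambda>x. g []"]
    by (simp add: decr_set_def)
next
  case (Suc q)
  have ins: "{..<Suc q} = insert q {..<q}" by auto
  note meas = Suc.prems(1)[unfolded ins]
  have meas': "(\<lambda>x. g (rev_list (Suc q) x) * indicator (decr_set (Suc q) S) x) \<in>
      borel_measurable (Pi\<^sub>M (insert q {..<q}) (\<lambda>_. lborel))"
    using meas decr_set_measurable[OF Suc.prems(2), of "Suc q", unfolded ins] by measurable
  have "(\<integral>\<^sup>+x. g (rev_list (Suc q) x) * indicator (decr_set (Suc q) S) x \<partial>lborel_power (Suc q)) =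
      (\<integral>\<^sup>+y. (\<integral>\<^sup>+x. g (rev_list (Suc q) (x(q := y))) * indicator (decr_set (Suc q) S) (x(q := y))
        \<partial>lborel_power q) \<partial>lborel)"
    unfolding ins by (rule lborels.product_nn_integral_insert_rev[OF _ _ meas']) auto
  also have "\<dots> = decreasing_integral (Suc q) S g"
    unfolding decreasing_integral.simps
  proof (rule nn_integral_cong)
    fix y :: real
    have "decreasing_integral q {0..y} (\<lambda>xs. g (y # xs)) = (\<integral>\<^sup>+x. g (rev_list (Suc q) (x(q := y))) *
        indicator (decr_set q {0..y}) x \<partial>lborel_power q)"
      using measurable_section[OF meas, of y] unfolding rev_list_Suc_upd by (subst Suc.IH) simp_all
    moreover have "indicator (decr_set (Suc q) S) (x(q := y)) =
        (indicator (decr_set q {0..y}) x * indicator S y :: ennreal)" for x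
      using decr_set_Suc_upd[OF Suc.prems(3), of x q y] by (auto simp: indicator_def)
    ultimately show "(\<integral>\<^sup>+x. g (rev_list (Suc q) (x(q := y))) * indicator (decr_set (Suc q) S) (x(q := y))
        \<partial>lborel_power q) = decreasing_integral q {0..y} (\<lambda>xs. g (y # xs)) * indicator S y"
      by (cases "y \<in> S") simp_all
  qed
  finally show ?case by simp
qed

section \<open>Powers of an integral as integrals over decreasing tuples\<close>

definition segment :: "real set \<Rightarrow> bool" where
  "segment S \<longleftrightarrow> S \<in> sets borel \<and> S \<subseteq> {0..} \<and> (\<forall>x\<in>S. {0..x} \<subseteq> S)"

lemma segment_simps [simp]: "segment {0..}" "segment {0..b}"
  by (auto simp: segment_def)

lemma segmentD: "segment S \<Longrightarrow> x \<in> S \<Longrightarrow> 0 \<le> y \<Longrightarrow> y \<le> x \<Longrightarrow> y \<in> S"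
  and segment_nonneg: "segment S \<Longrightarrow> x \<in> S \<Longrightarrow> 0 \<le> x"
  unfolding segment_def by (meson atLeastAtMost_iff subsetD, auto)

text \<open>Tonelli's theorem on the triangle below the diagonal. The diagonal is null, hence the
  half-open constraint on one side and the closed interval on the other.\<close>

lemma nn_integral_triangle_swap:
  fixes f g :: "real \<Rightarrow> ennreal"
  assumes [measurable]: "f \<in> borel_measurable borel" "g \<in> borel_measurable borel" and S: "segment S"
  shows "(\<integral>\<^sup>+y\<in>S. f y * (\<integral>\<^sup>+x\<in>S. g x * indicator {y<..} x \<partial>lborel) \<partial>lborel) =
    (\<integral>\<^sup>+x\<in>S. g x * (\<integral>\<^sup>+y\<in>{0..x}. f y \<partial>lborel) \<partial>lborel)"
proof -
  let ?h = "\<lambda>x y. (g x * indicator S x) * (f y * indicator S y) * (if y < x then 1 else 0)"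
  have [measurable]: "S \<in> sets borel" using S by (simp add: segment_def)
  have "(\<integral>\<^sup>+y\<in>S. f y * (\<integral>\<^sup>+x\<in>S. g x * indicator {y<..} x \<partial>lborel) \<partial>lborel) =
      (\<integral>\<^sup>+y. (\<integral>\<^sup>+x. ?h x y \<partial>lborel) \<partial>lborel)"
  proof (rule nn_integral_cong)
    fix y
    have "f y * (\<integral>\<^sup>+x\<in>S. g x * indicator {y<..} x \<partial>lborel) * indicator S y =
        (f y * indicator S y) * (\<integral>\<^sup>+x\<in>S. g x * indicator {y<..} x \<partial>lborel)"
      by (simp only: mult_ac)
    also have "\<dots> = (\<integral>\<^sup>+x. (f y * indicator S y) * (g x * indicator {y<..} x * indicator S x) \<partial>lborel)"
      by (rule nn_integral_cmult[symmetric]) measurable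
    also have "\<dots> = (\<integral>\<^sup>+x. ?h x y \<partial>lborel)"
      by (intro nn_integral_cong) (simp add: indicator_def mult_ac)
    finally show "f y * (\<integral>\<^sup>+x\<in>S. g x * indicator {y<..} x \<partial>lborel) * indicator S y =
        (\<integral>\<^sup>+x. ?h x y \<partial>lborel)" .
  qed
  also have "\<dots> = (\<integral>\<^sup>+x. (\<integral>\<^sup>+y. ?h x y \<partial>lborel) \<partial>lborel)"
    by (rule lborel_pair.Fubini') simp
  also have "\<dots> = (\<integral>\<^sup>+x\<in>S. g x * (\<integral>\<^sup>+y\<in>{0..x}. f y \<partial>lborel) \<partial>lborel)"
  proof (rule nn_integral_cong)
    fix x
    have "(\<integral>\<^sup>+y. ?h x y \<partial>lborel) =
        (\<integral>\<^sup>+y. (g x * indicator S x) * (f y * indicator {0..x} y) \<partial>lborel)"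
    proof (rule nn_integral_cong_AE)
      show "AE y in lborel. ?h x y =
          (g x * indicator S x) * (f y * indicator {0..x} y)"
        using AE_lborel_singleton[of x]
      proof eventually_elim
        case (elim y)
        have "indicator S y * (if y < x then 1 else 0) = (indicator {0..x} y :: ennreal)" if "x \<in> S"
          using segmentD[OF S that, of y] segment_nonneg[OF S, of y] elim by (auto simp: indicator_def)
        then show ?case by (cases "x \<in> S") (simp_all add: mult.assoc)
      qed
    qed
    also have "\<dots> = (g x * indicator S x) * (\<integral>\<^sup>+y\<in>{0..x}. f y \<partial>lborel)"
      by (rule nn_integral_cmult) measurable
    also have "\<dots> = g x * (\<integral>\<^sup>+y\<in>{0..x}. f y \<partial>lborel) * indicator S x"
      by (simp only: mult_ac)
    finally show "(\<integral>\<^sup>+y. ?h x y \<partial>lborel) =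
        g x * (\<integral>\<^sup>+y\<in>{0..x}. f y \<partial>lborel) * indicator S x" .
  qed
  finally show ?thesis .
qed

lemma primitive_measurable:
  fixes \<phi> :: "real \<Rightarrow> ennreal"
  assumes [measurable]: "\<phi> \<in> borel_measurable borel"
  shows "(\<lambda>x. \<integral>\<^sup>+y\<in>{0..x}. \<phi> y \<partial>lborel) \<in> borel_measurable borel"
proof -
  have "(\<lambda>x. \<integral>\<^sup>+y. \<phi> y * (if 0 \<le> y \<and> y \<le> x then 1 else 0) \<partial>lborel) \<in> borel_measurable borel"
    by measurable
  then show ?thesis by (simp add: indicator_def of_bool_def)
qed

text \<open>Integrated form of the chain rule for a power of the primitive, obtained without
  differentiation and with infinite values allowed. The total integral is split at \<open>y\<close>
  into the parts below and above; the part above is moved inside by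
  \<open>nn_integral_triangle_swap\<close>, where the induction hypothesis for \<open>{0..x}\<close>
  applies.\<close>

lemma nn_integral_primitive_power:
  fixes \<phi> :: "real \<Rightarrow> ennreal"
  assumes [measurable]: "\<phi> \<in> borel_measurable borel" and "segment S"
  shows "of_nat (Suc q) * (\<integral>\<^sup>+x\<in>S. \<phi> x * (\<integral>\<^sup>+y\<in>{0..x}. \<phi> y \<partial>lborel) ^ q \<partial>lborel) =
    (\<integral>\<^sup>+x\<in>S. \<phi> x \<partial>lborel) ^ Suc q"
  using assms(2)
proof (induction q arbitrary: S)
  case 0
  then show ?case by simp
next
  case (Suc q)
  define \<Phi> where "\<Phi> x = (\<integral>\<^sup>+y\<in>{0..x}. \<phi> y \<partial>lborel)" for x
  have [measurable]: "\<Phi> \<in> borel_measurable borel"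
    unfolding \<Phi>_def[abs_def] by (rule primitive_measurable) fact
  have [measurable]: "S \<in> sets borel" using Suc.prems by (simp add: segment_def)
  define G where "G = (\<integral>\<^sup>+x\<in>S. \<phi> x \<partial>lborel)"
  let ?J = "\<lambda>y. \<integral>\<^sup>+x\<in>S. \<phi> x * indicator {y<..} x \<partial>lborel"
  let ?Q = "\<integral>\<^sup>+y\<in>S. \<phi> y * \<Phi> y ^ Suc q \<partial>lborel"
  have G: "G = \<Phi> y + ?J y" if "y \<in> S" for y
    unfolding G_def \<Phi>_def
  proof -
    have "\<phi> x * indicator S x = \<phi> x * indicator {0..y} x + \<phi> x * indicator {y<..} x * indicator S x" for x
      using segmentD[OF Suc.prems that, of x] segment_nonneg[OF Suc.prems, of x] by (auto simp: indicator_def)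
    then show "(\<integral>\<^sup>+x\<in>S. \<phi> x \<partial>lborel) = (\<integral>\<^sup>+x\<in>{0..y}. \<phi> x \<partial>lborel) +
        ?J y"
      by (simp add: nn_integral_add)
  qed
  have IH: "of_nat (Suc q) * (\<integral>\<^sup>+y\<in>{0..x}. \<phi> y * \<Phi> y ^ q \<partial>lborel) = \<Phi> x ^ Suc q" for x
    using Suc.IH[of "{0..x}"] by (simp add: \<Phi>_def)
  have "G ^ Suc (Suc q) = G * (of_nat (Suc q) * (\<integral>\<^sup>+y\<in>S. \<phi> y * \<Phi> y ^ q \<partial>lborel))"
    using Suc.IH[OF Suc.prems] by (simp add: \<Phi>_def G_def)
  also have "\<dots> = of_nat (Suc q) * (\<integral>\<^sup>+y\<in>S. \<phi> y * \<Phi> y ^ q * G \<partial>lborel)"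
  proof -
    have "(\<integral>\<^sup>+y\<in>S. \<phi> y * \<Phi> y ^ q * G \<partial>lborel) = (\<integral>\<^sup>+y. G * (\<phi> y * \<Phi> y ^ q * indicator S y) \<partial>lborel)"
      by (simp only: mult_ac)
    also have "\<dots> = G * (\<integral>\<^sup>+y\<in>S. \<phi> y * \<Phi> y ^ q \<partial>lborel)"
      by (rule nn_integral_cmult) measurable
    finally show ?thesis by (simp only: mult.left_commute)
  qed
  also have "(\<integral>\<^sup>+y\<in>S. \<phi> y * \<Phi> y ^ q * G \<partial>lborel) =
      (\<integral>\<^sup>+y. \<phi> y * \<Phi> y ^ Suc q * indicator S y +
        (\<phi> y * \<Phi> y ^ q) * ?J y * indicator S y \<partial>lborel)"
  proof (rule nn_integral_cong)
    fix y
    show "\<phi> y * \<Phi> y ^ q * G * indicator S y = \<phi> y * \<Phi> y ^ Suc q * indicator S y +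
        (\<phi> y * \<Phi> y ^ q) * ?J y * indicator S y"
      by (cases "y \<in> S") (simp_all add: G[of y] distrib_left mult_ac)
  qed
  also have "\<dots> = ?Q +
      (\<integral>\<^sup>+y\<in>S. (\<phi> y * \<Phi> y ^ q) * ?J y \<partial>lborel)"
  proof (rule nn_integral_add)
    have "(\<lambda>y. \<integral>\<^sup>+x. \<phi> x * (if y < x then 1 else 0) * indicator S x \<partial>lborel) \<in> borel_measurable borel"
      by measurable
    then have [measurable]: "(\<lambda>y. \<integral>\<^sup>+x\<in>S. \<phi> x * indicator {y<..} x \<partial>lborel) \<in> borel_measurable borel"
      by (simp add: indicator_def[of "{_<..}"] of_bool_def)
    show "(\<lambda>y. (\<phi> y * \<Phi> y ^ q) * ?J y * indicator S y) \<in> borel_measurable lborel"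
      by measurable
  qed measurable
  also have "(\<integral>\<^sup>+y\<in>S. (\<phi> y * \<Phi> y ^ q) * ?J y \<partial>lborel) =
      (\<integral>\<^sup>+x\<in>S. \<phi> x * (\<integral>\<^sup>+y\<in>{0..x}. \<phi> y * \<Phi> y ^ q \<partial>lborel) \<partial>lborel)"
    by (rule nn_integral_triangle_swap) (use Suc.prems in measurable)
  also have "of_nat (Suc q) * (?Q +
      (\<integral>\<^sup>+x\<in>S. \<phi> x * (\<integral>\<^sup>+y\<in>{0..x}. \<phi> y * \<Phi> y ^ q \<partial>lborel) \<partial>lborel)) =
      of_nat (Suc q) * ?Q +
      (\<integral>\<^sup>+x\<in>S. \<phi> x * \<Phi> x ^ Suc q \<partial>lborel)"
  proof -
    define A where "A x = (\<integral>\<^sup>+y\<in>{0..x}. \<phi> y * \<Phi> y ^ q \<partial>lborel)" for x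
    have [measurable]: "A \<in> borel_measurable borel"
      unfolding A_def[abs_def] by (rule primitive_measurable) measurable
    have "(\<integral>\<^sup>+x\<in>S. \<phi> x * \<Phi> x ^ Suc q \<partial>lborel) =
        (\<integral>\<^sup>+x. of_nat (Suc q) * (\<phi> x * A x * indicator S x) \<partial>lborel)"
      unfolding IH[symmetric] A_def[symmetric] by (simp only: mult_ac)
    also have "\<dots> = of_nat (Suc q) * (\<integral>\<^sup>+x\<in>S. \<phi> x * A x \<partial>lborel)"
      by (rule nn_integral_cmult) measurable
    finally show ?thesis unfolding A_def by (simp only: distrib_left)
  qed
  also have "\<dots> = of_nat (Suc (Suc q)) * ?Q"
    by (simp add: distrib_right)
  finally show ?case by (simp add: G_def \<Phi>_def)
qed


lemma decreasing_integral_prod: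
  fixes \<phi> :: "real \<Rightarrow> ennreal"
  assumes [measurable]: "\<phi> \<in> borel_measurable borel" and "segment S"
  shows "fact q * decreasing_integral q S (\<lambda>xs. \<Prod>i<q. \<phi> (xs ! i)) = (\<integral>\<^sup>+x\<in>S. \<phi> x \<partial>lborel) ^ q"
proof -
  \<comment> \<open>The constant \<open>c\<close> collects the factors \<open>\<phi> x\<close> of
    the outer variables, which the inner integrals see as fixed.\<close>
  have "fact q * decreasing_integral q S (\<lambda>xs. c * (\<Prod>i<q. \<phi> (xs ! i))) = c * (\<integral>\<^sup>+x\<in>S. \<phi> x \<partial>lborel) ^ q" for c
    using assms(2)
  proof (induction q arbitrary: S c)
    case (Suc q)
    have [measurable]: "S \<in> sets borel" using Suc.prems by (simp add: segment_def)
    have fact_inverse: "inverse (fact q) * (fact q :: ennreal) = 1"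
    proof -
      have "(fact q :: ennreal) = ennreal (fact q)"
        by (metis ennreal_of_nat_eq_real_of_nat of_nat_fact)
      then show ?thesis by (simp add: inverse_ennreal ennreal_mult[symmetric] del: ennreal_of_nat_eq_real_of_nat)
    qed
    define \<Phi> where "\<Phi> x = (\<integral>\<^sup>+y\<in>{0..x}. \<phi> y \<partial>lborel)" for x
    have [measurable]: "\<Phi> \<in> borel_measurable borel"
      unfolding \<Phi>_def[abs_def] by (rule primitive_measurable) fact
    have IH: "fact q * decreasing_integral q {0..x} (\<lambda>xs. c * \<phi> x * (\<Prod>i<q. \<phi> (xs ! i))) = c * \<phi> x * \<Phi> x ^ q" for x
      unfolding \<Phi>_def by (rule Suc.IH) simp
    have eq: "decreasing_integral q {0..x} (\<lambda>xs. c * \<phi> x * (\<Prod>i<q. \<phi> (xs ! i))) =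
        inverse (fact q) * (c * \<phi> x * \<Phi> x ^ q)" for x
      unfolding IH[symmetric] mult.assoc[symmetric] fact_inverse by simp
    have "decreasing_integral (Suc q) S (\<lambda>xs. c * (\<Prod>i<Suc q. \<phi> (xs ! i))) =
        (\<integral>\<^sup>+x\<in>S. decreasing_integral q {0..x} (\<lambda>xs. c * \<phi> x * (\<Prod>i<q. \<phi> (xs ! i))) \<partial>lborel)"
      by (simp add: prod.lessThan_Suc_shift mult.assoc del: prod.lessThan_Suc)
    also have "\<dots> = (\<integral>\<^sup>+x. inverse (fact q) * c * (\<phi> x * \<Phi> x ^ q * indicator S x) \<partial>lborel)"
      unfolding eq by (simp only: mult_ac)
    also have "\<dots> = inverse (fact q) * c * (\<integral>\<^sup>+x\<in>S. \<phi> x * \<Phi> x ^ q \<partial>lborel)"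
      by (rule nn_integral_cmult) measurable
    finally have "fact (Suc q) * decreasing_integral (Suc q) S (\<lambda>xs. c * (\<Prod>i<Suc q. \<phi> (xs ! i))) =
        (fact q * inverse (fact q)) * (c * (of_nat (Suc q) * (\<integral>\<^sup>+x\<in>S. \<phi> x * \<Phi> x ^ q \<partial>lborel)))"
      by (simp add: mult_ac)
    also have "of_nat (Suc q) * (\<integral>\<^sup>+x\<in>S. \<phi> x * \<Phi> x ^ q \<partial>lborel) = (\<integral>\<^sup>+x\<in>S. \<phi> x \<partial>lborel) ^ Suc q"
      unfolding \<Phi>_def by (rule nn_integral_primitive_power) (use Suc.prems in auto)
    finally show ?case unfolding mult.commute[of "fact q" "inverse (fact q)"] fact_inverse by simp
  qed simp
  from this[of 1] show ?thesis by simp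
qed

section \<open>Moments of the scaled sum\<close>

lemma path_f_measurable [measurable]: "path_f \<in> borel_measurable borel"
  unfolding path_f_def[abs_def] by measurable

lemma path_f_range: "t \<in> {0..1} \<Longrightarrow> path_f t \<in> {0..1}"
  by (auto simp: path_f_def)

text \<open>The tent map preserves Lebesgue measure: each branch has slope 2 in absolute value and
  covers the unit interval, contributing one half.\<close>

lemma nn_integral_path_f:
  fixes g :: "real \<Rightarrow> ennreal"
  assumes [measurable]: "g \<in> borel_measurable borel"
  shows "(\<integral>\<^sup>+t\<in>{0..1}. g (path_f t) \<partial>lborel) = (\<integral>\<^sup>+u\<in>{0..1}. g u \<partial>lborel)"
proof -
  define R where "R = (\<integral>\<^sup>+u\<in>{0..1}. g u \<partial>lborel)"
  define A where "A = (\<integral>\<^sup>+t\<in>{0..1 / 2}. g (2 * t) \<partial>lborel)"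
  define B where "B = (\<integral>\<^sup>+t\<in>{1 / 2..1}. g (2 - 2 * t) \<partial>lborel)"
  have "R = 2 * (\<integral>\<^sup>+x. g (0 + 2 * x) * indicator {0..1} (0 + 2 * x) \<partial>lborel)"
    unfolding R_def by (subst nn_integral_real_affine[where c = 2 and t = 0]) simp_all
  also have "(\<integral>\<^sup>+x. g (0 + 2 * x) * indicator {0..1} (0 + 2 * x) \<partial>lborel) = A"
    unfolding A_def by (intro nn_integral_cong) (auto simp: indicator_def)
  finally have RA: "R = 2 * A" .
  have "R = 2 * (\<integral>\<^sup>+x. g (2 + (- 2) * x) * indicator {0..1} (2 + (- 2) * x) \<partial>lborel)"
    unfolding R_def by (subst nn_integral_real_affine[where c = "- 2" and t = 2]) simp_all
  also have "(\<integral>\<^sup>+x. g (2 + (- 2) * x) * indicator {0..1} (2 + (- 2) * x) \<partial>lborel) = B"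
    unfolding B_def by (intro nn_integral_cong) (auto simp: indicator_def)
  finally have RB: "R = 2 * B" .
  have AB: "A = B" using RA RB by (simp add: ennreal_mult_cancel_left)
  have "(\<integral>\<^sup>+t\<in>{0..1}. g (path_f t) \<partial>lborel) =
      (\<integral>\<^sup>+t. g (2 * t) * indicator {0..1 / 2} t + g (2 - 2 * t) * indicator {1 / 2..1} t \<partial>lborel)"
  proof (rule nn_integral_cong_AE)
    show "AE t in lborel. g (path_f t) * indicator {0..1} t =
        g (2 * t) * indicator {0..1 / 2} t + g (2 - 2 * t) * indicator {1 / 2..1} t"
      using AE_lborel_singleton[of "1 / 2"] by eventually_elim (auto simp: indicator_def path_f_def)
  qed
  also have "\<dots> = A + B" unfolding A_def B_def by (rule nn_integral_add) measurable
  also have "\<dots> = R" using RA AB by (simp add: mult_2)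
  finally show ?thesis by (simp add: R_def)
qed

lemma nn_integral_floor:
  fixes g :: "nat \<Rightarrow> ennreal"
  assumes n: "n > 0"
  shows "(\<integral>\<^sup>+u\<in>{0..1}. g (nat \<lfloor>real n * u\<rfloor>) \<partial>lborel) = ennreal (1 / real n) * (\<Sum>v<n. g v)"
proof -
  have "(\<integral>\<^sup>+u\<in>{0..1}. g (nat \<lfloor>real n * u\<rfloor>) \<partial>lborel) =
      ennreal (1 / real n) * (\<integral>\<^sup>+x. g (nat \<lfloor>real n * (0 + 1 / real n * x)\<rfloor>) * indicator {0..1} (0 + 1 / real n * x) \<partial>lborel)"
    using n by (subst nn_integral_real_affine[where c = "1 / real n" and t = 0]) simp_all
  also have "(\<integral>\<^sup>+x. g (nat \<lfloor>real n * (0 + 1 / real n * x)\<rfloor>) * indicator {0..1} (0 + 1 / real n * x) \<partial>lborel) =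
      (\<integral>\<^sup>+x. (\<Sum>v<n. g v * indicator {real v..<real v + 1} x) \<partial>lborel)"
  proof (rule nn_integral_cong_AE)
    show "AE x in lborel. g (nat \<lfloor>real n * (0 + 1 / real n * x)\<rfloor>) * indicator {0..1} (0 + 1 / real n * x) =
      (\<Sum>v<n. g v * indicator {real v..<real v + 1} x)"
      \<comment> \<open>At \<open>x = real n\<close> the floor would give the index
        \<open>n\<close>, which lies outside the sum.\<close>
      using AE_lborel_singleton[of "real n"]
    proof eventually_elim
      case (elim x)
      show ?case
      proof (cases "0 \<le> x \<and> x \<le> real n")
        case True
        define w where "w = nat \<lfloor>x\<rfloor>"
        have w: "real w \<le> x" "x < real w + 1" using True by (auto simp: w_def)
        have "w < n" using w elim True by simp
        have "(\<Sum>v<n. g v * indicator {real v..<real v + 1} x) = (\<Sum>v<n. if v = w then g w else 0)"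
        proof (rule sum.cong[OF refl])
          fix v
          have "x \<in> {real v..<real v + 1} \<longleftrightarrow> v = w" using w by auto
          then show "g v * indicator {real v..<real v + 1} x = (if v = w then g w else 0)"
            by (simp add: indicator_def)
        qed
        also have "\<dots> = g w" using \<open>w < n\<close> by simp
        finally show ?thesis using n True by (simp add: w_def)
      next
        case False
        have "x \<notin> {real v..<real v + 1}" if "v < n" for v using False that by auto
        then show ?thesis using n False by (auto simp: indicator_def divide_simps intro!: sum.neutral[symmetric])
      qed
    qed
  qed
  also have "\<dots> = (\<Sum>v<n. g v)"
    by (subst nn_integral_sum) (auto simp: nn_integral_cmult)
  finally show ?thesis .
qed

lemma measurable_lborel_power_component:
  assumes "f \<in> measurable M (lborel_power q)" "i < q"
  shows "(\<lambda>z. f z i) \<in> borel_measurable M"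
  using measurable_compose[OF assms(1) measurable_component_singleton[of i]] assms(2) by simp

lemma measurable_unit_power_component:
  assumes "f \<in> measurable M (unit_power q)" "i < q"
  shows "(\<lambda>z. f z i) \<in> borel_measurable M"
  using measurable_compose[OF assms(1) measurable_component_singleton[of i]] assms(2)
  by (simp cong: measurable_cong_sets)

text \<open>Expands a power of a double integral: the product over independent uniform coordinates
  supplies the inner integrals, the ordering of the \<open>x\<close> variables the factor
  \<open>fact q\<close>. It serves both for the exact moments and for the dominating
  function.\<close>

lemma kernel_power:
  fixes \<kappa> :: "real \<Rightarrow> real \<Rightarrow> ennreal"
  assumes \<kappa>: "(\<lambda>z. \<kappa> (fst z) (snd z)) \<in> borel_measurable (borel \<Otimes>\<^sub>M borel)"
  shows "fact q * (\<integral>\<^sup>+x. (\<integral>\<^sup>+\<tau>. (\<Prod>i<q. \<kappa> (\<tau> i) (x i)) \<partial>unit_power q) * indicator (decr_set q {0..}) x \<partial>lborel_power q) =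
    (\<integral>\<^sup>+x\<in>{0..}. (\<integral>\<^sup>+t. \<kappa> t x \<partial>unit_law) \<partial>lborel) ^ q"
proof -
  let ?K = "\<lambda>x. \<integral>\<^sup>+\<tau>. (\<Prod>i<q. \<kappa> (\<tau> i) (x i)) \<partial>unit_power q"
  have \<kappa>_comp: "(\<lambda>z. \<kappa> (f z) (g z)) \<in> borel_measurable M"
    if "f \<in> borel_measurable M" "g \<in> borel_measurable M" for f g M
    using measurable_compose[OF measurable_Pair[OF that] \<kappa>] by simp
  define \<phi> where "\<phi> x = (\<integral>\<^sup>+t. \<kappa> t x \<partial>unit_law)" for x
  have "(\<lambda>z. \<kappa> (snd z) (fst z)) \<in> borel_measurable (borel \<Otimes>\<^sub>M unit_law)"
    by (intro \<kappa>_comp) simp_all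
  then have [measurable]: "\<phi> \<in> borel_measurable borel" unfolding \<phi>_def[abs_def]
    by (intro unit_law.borel_measurable_nn_integral) (simp add: case_prod_beta')
  have prod: "(\<Prod>i<q. \<phi> (rev_list q x ! i)) = (?K x)" for x
  proof -
    have "(\<Prod>i<q. \<phi> (rev_list q x ! i)) = (\<Prod>i<q. \<phi> (x (q - Suc i)))"
      by (intro prod.cong) (auto simp: nth_rev_list)
    also have "\<dots> = (\<Prod>i<q. \<phi> (x i))"
      by (rule prod.nat_diff_reindex)
    also have "\<dots> = (?K x)"
      unfolding \<phi>_def by (rule unit_laws.product_nn_integral_prod[symmetric]) (simp_all add: \<kappa>_comp)
    finally show ?thesis .
  qed
  have "(\<lambda>z. \<Prod>i<q. \<kappa> (snd z i) (fst z i)) \<in> borel_measurable (lborel_power q \<Otimes>\<^sub>M unit_power q)"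
    by (intro borel_measurable_prod_ennreal \<kappa>_comp measurable_lborel_power_component[OF measurable_fst]
        measurable_unit_power_component[OF measurable_snd]) auto
  then have meas: "(\<lambda>x. ?K x) \<in> borel_measurable (lborel_power q)"
    by (intro unit_power.borel_measurable_nn_integral) (auto simp: case_prod_beta')
  have "(\<integral>\<^sup>+x\<in>{0..}. \<phi> x \<partial>lborel) ^ q = fact q * decreasing_integral q {0..} (\<lambda>xs. \<Prod>i<q. \<phi> (xs ! i))"
    by (rule decreasing_integral_prod[symmetric]) auto
  also have "decreasing_integral q {0..} (\<lambda>xs. \<Prod>i<q. \<phi> (xs ! i)) =
      (\<integral>\<^sup>+x. (?K x) * indicator (decr_set q {0..}) x \<partial>lborel_power q)"
    by (subst decreasing_integral_eq) (use meas in \<open>simp_all add: prod\<close>)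
  finally show ?thesis by (simp add: \<phi>_def)
qed

context path_cuts
begin

definition scaled_min :: "nat \<Rightarrow> real \<Rightarrow> (nat \<Rightarrow> real) \<Rightarrow> real" where
  "scaled_min n u \<omega> = real n powr (1 / k) * run_min 1 \<omega> (nat \<lfloor>real n * u\<rfloor>)"

definition scaled_sum :: "nat \<Rightarrow> (nat \<Rightarrow> real) \<Rightarrow> real" where
  "scaled_sum n \<omega> = real n powr (1 / k - 1) * (\<Sum>v<n. run_min 1 \<omega> v)"

lemma scaled_min_measurable [measurable]:
  assumes [measurable]: "f \<in> borel_measurable M" "h \<in> measurable M seqs"
  shows "(\<lambda>z. scaled_min n (f z) (h z)) \<in> borel_measurable M"
proof -
  have "(\<lambda>z. run_min 1 (h z) (nat \<lfloor>real n * f z\<rfloor>)) \<in> borel_measurable M"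
    by (rule measurable_compose_countable[where f = "\<lambda>v z. run_min 1 (h z) v"]) measurable
  then show ?thesis unfolding scaled_min_def by measurable
qed

lemma scaled_sum_measurable [measurable]: "scaled_sum n \<in> borel_measurable seqs"
  unfolding scaled_sum_def[abs_def] by measurable

lemma AE_seqs_nonneg: "AE \<omega> in seqs. \<forall>j. 0 \<le> \<omega> j"
proof (subst AE_all_countable, intro allI)
  fix j
  show "AE \<omega> in seqs. 0 \<le> \<omega> j"
    by (rule AE_PiM_component) (auto intro: ring.prob_space_axioms AE_ring_law_nonneg)
qed

definition level_measure :: "nat \<Rightarrow> (nat \<Rightarrow> real) \<Rightarrow> real \<Rightarrow> ennreal" where
  "level_measure n \<omega> x = (\<integral>\<^sup>+t. indicator {..<scaled_min n (path_f t) \<omega>} x \<partial>unit_law)"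

lemma level_indicator_measurable [measurable]:
  assumes [measurable]: "f \<in> borel_measurable M" "h \<in> measurable M seqs" "g \<in> borel_measurable M"
  shows "(\<lambda>z. indicator {..<scaled_min n (f z) (h z)} (g z) :: ennreal) \<in> borel_measurable M"
proof -
  have "(\<lambda>z. if g z < scaled_min n (f z) (h z) then 1 else 0 :: ennreal) \<in> borel_measurable M"
    by measurable
  then show ?thesis by (simp add: indicator_def of_bool_def)
qed

lemma seqs_space [simp]: "space seqs = UNIV"
  by (simp add: space_PiM)

text \<open>Layer-cake formula for the scaled minimum as a function of the position;
  \<open>path_f\<close> then disappears because it preserves the uniform law, and a step function
  remains to be integrated.\<close>

lemma nn_integral_level_measure:
  assumes n: "n > 0" and \<omega>: "\<forall>j. 0 \<le> \<omega> j"
  shows "(\<integral>\<^sup>+x\<in>{0..}. level_measure n \<omega> x \<partial>lborel) = ennreal (scaled_sum n \<omega>)"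
proof -
  interpret P: pair_sigma_finite lborel unit_law ..
  have mn: "run_min 1 \<omega> v \<ge> 0" for v using \<omega> by (intro run_min_nonneg) auto
  have "(\<integral>\<^sup>+x\<in>{0..}. level_measure n \<omega> x \<partial>lborel) =
      (\<integral>\<^sup>+x. (\<integral>\<^sup>+t. indicator {..<scaled_min n (path_f t) \<omega>} x * indicator {0..} x \<partial>unit_law) \<partial>lborel)"
    unfolding level_measure_def by (intro nn_integral_cong nn_integral_multc[symmetric]) measurable
  also have "\<dots> = (\<integral>\<^sup>+t. (\<integral>\<^sup>+x. indicator {..<scaled_min n (path_f t) \<omega>} x * indicator {0..} x \<partial>lborel) \<partial>unit_law)"
    by (rule P.Fubini'[symmetric]) measurable
  also have "\<dots> = (\<integral>\<^sup>+t. ennreal (scaled_min n (path_f t) \<omega>) \<partial>unit_law)"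
  proof (rule nn_integral_cong)
    fix t
    have "(\<integral>\<^sup>+x. indicator {..<scaled_min n (path_f t) \<omega>} x * indicator {0..} x \<partial>lborel) =
        (\<integral>\<^sup>+x. indicator {0..<scaled_min n (path_f t) \<omega>} x \<partial>lborel)"
      by (intro nn_integral_cong) (auto simp: indicator_def)
    also have "\<dots> = ennreal (scaled_min n (path_f t) \<omega>)"
      using mn by (simp add: scaled_min_def)
    finally show "(\<integral>\<^sup>+x. indicator {..<scaled_min n (path_f t) \<omega>} x * indicator {0..} x \<partial>lborel) =
        ennreal (scaled_min n (path_f t) \<omega>)" .
  qed
  also have "\<dots> = (\<integral>\<^sup>+t\<in>{0..1}. ennreal (scaled_min n (path_f t) \<omega>) \<partial>lborel)"
    by (rule nn_integral_unit_law) measurable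
  also have "\<dots> = (\<integral>\<^sup>+u\<in>{0..1}. ennreal (scaled_min n u \<omega>) \<partial>lborel)"
    by (rule nn_integral_path_f) measurable
  also have "\<dots> = ennreal (1 / real n) * (\<Sum>v<n. ennreal (real n powr (1 / k) * run_min 1 \<omega> v))"
    unfolding scaled_min_def by (rule nn_integral_floor[OF n])
  also have "\<dots> = ennreal (1 / real n * (\<Sum>v<n. real n powr (1 / k) * run_min 1 \<omega> v))"
    using mn by (subst sum_ennreal) (auto simp: ennreal_mult'[symmetric] sum_nonneg)
  also have "1 / real n * (\<Sum>v<n. real n powr (1 / k) * run_min 1 \<omega> v) = scaled_sum n \<omega>"
    using n by (simp add: scaled_sum_def sum_distrib_left[symmetric] powr_diff)
  finally show ?thesis .
qed

definition joint_level :: "nat \<Rightarrow> nat \<Rightarrow> (nat \<Rightarrow> real) \<Rightarrow> (nat \<Rightarrow> real) \<Rightarrow> (nat \<Rightarrow> real) \<Rightarrow> ennreal" where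
  "joint_level n q \<omega> x \<tau> = (\<Prod>i<q. indicator {..<scaled_min n (path_f (\<tau> i)) \<omega>} (x i))"

lemma joint_level_measurable:
  assumes [measurable]: "h \<in> measurable M seqs"
    and f: "f \<in> measurable M (lborel_power q)" and g: "g \<in> measurable M (unit_power q)"
  shows "(\<lambda>z. joint_level n q (h z) (f z) (g z)) \<in> borel_measurable M"
  unfolding joint_level_def
  by (intro borel_measurable_prod_ennreal level_indicator_measurable assms(1)
      measurable_compose[OF _ path_f_measurable] measurable_lborel_power_component[OF f] measurable_unit_power_component[OF g]) auto

lemma scaled_sum_power:
  assumes n: "n > 0" and \<omega>: "\<forall>j. 0 \<le> \<omega> j"
  shows "ennreal (scaled_sum n \<omega>) ^ q = fact q *
    (\<integral>\<^sup>+x. (\<integral>\<^sup>+\<tau>. joint_level n q \<omega> x \<tau> \<partial>unit_power q) * indicator (decr_set q {0..}) x \<partial>lborel_power q)"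
proof -
  have "(\<lambda>z. indicator {..<scaled_min n (path_f (fst z)) \<omega>} (snd z) :: ennreal) \<in> borel_measurable (borel \<Otimes>\<^sub>M borel)"
    by measurable
  from kernel_power[OF this, of q] show ?thesis
    using nn_integral_level_measure[OF assms] by (simp add: level_measure_def joint_level_def)
qed

definition level_prob :: "nat \<Rightarrow> nat \<Rightarrow> (nat \<Rightarrow> real) \<Rightarrow> (nat \<Rightarrow> real) \<Rightarrow> ennreal" where
  "level_prob n q x \<tau> = (\<integral>\<^sup>+\<omega>. joint_level n q \<omega> x \<tau> \<partial>seqs)"

text \<open>Tonelli's theorem moves the expectation inside, where it leaves joint probabilities that
  can be computed exactly.\<close>

lemma scaled_sum_moment:
  assumes n: "n > 0"
  shows "(\<integral>\<^sup>+\<omega>. ennreal (scaled_sum n \<omega>) ^ q \<partial>seqs) =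
    fact q * (\<integral>\<^sup>+z. level_prob n q (snd z) (fst z) * indicator (decr_set q {0..}) (snd z) \<partial>power_pair q)"
proof -
  interpret P: pair_sigma_finite seqs "power_pair q" ..
  let ?I = "\<lambda>x. indicator (decr_set q {0..}) x :: ennreal"
  let ?J = "\<lambda>\<omega>. \<integral>\<^sup>+z. joint_level n q \<omega> (snd z) (fst z) * ?I (snd z) \<partial>power_pair q"
  have I: "?I \<in> borel_measurable (lborel_power q)" by (rule decr_set_measurable) simp
  have J1: "(\<lambda>\<tau>. joint_level n q \<omega> x \<tau>) \<in> borel_measurable (unit_power q)" if "x \<in> space (lborel_power q)" for \<omega> x
    using that by (intro joint_level_measurable) simp_all
  have J2: "(\<lambda>z. joint_level n q \<omega> (snd z) (fst z) * ?I (snd z)) \<in> borel_measurable (power_pair q)" for \<omega>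
    by (intro borel_measurable_times_ennreal joint_level_measurable measurable_compose[OF _ I]) simp_all
  have J3: "(\<lambda>w. joint_level n q (fst w) (snd (snd w)) (fst (snd w)) * ?I (snd (snd w)))
      \<in> borel_measurable (seqs \<Otimes>\<^sub>M (power_pair q))"
    by (intro borel_measurable_times_ennreal joint_level_measurable measurable_compose[OF _ I]) simp_all
  have J4: "(\<lambda>\<omega>. joint_level n q \<omega> (snd z) (fst z)) \<in> borel_measurable seqs"
    if "z \<in> space (power_pair q)" for z
    using that by (intro joint_level_measurable) (auto simp: space_pair_measure)
  have "(\<integral>\<^sup>+\<omega>. ennreal (scaled_sum n \<omega>) ^ q \<partial>seqs) =
      (\<integral>\<^sup>+\<omega>. fact q * ?J \<omega> \<partial>seqs)"
  proof (rule nn_integral_cong_AE)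
    show "AE \<omega> in seqs. ennreal (scaled_sum n \<omega>) ^ q =
        fact q * ?J \<omega>"
      using AE_seqs_nonneg
    proof eventually_elim
      case (elim \<omega>)
      have "(\<integral>\<^sup>+x. (\<integral>\<^sup>+\<tau>. joint_level n q \<omega> x \<tau> \<partial>unit_power q) * ?I x \<partial>lborel_power q) =
          (\<integral>\<^sup>+x. (\<integral>\<^sup>+\<tau>. joint_level n q \<omega> x \<tau> * ?I x \<partial>unit_power q) \<partial>lborel_power q)"
        by (intro nn_integral_cong nn_integral_multc[symmetric] J1)
      also have "\<dots> = ?J \<omega>"
        using power_pair.nn_integral_snd[OF J2] by simp
      finally show ?case using scaled_sum_power[OF n elim] by simp
    qed
  qed
  also have "\<dots> = fact q * (\<integral>\<^sup>+\<omega>. ?J \<omega> \<partial>seqs)"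
    using power_pair.P.borel_measurable_nn_integral_fst[OF J3] by (intro nn_integral_cmult) simp
  also have "(\<integral>\<^sup>+\<omega>. ?J \<omega> \<partial>seqs) =
      (\<integral>\<^sup>+z. (\<integral>\<^sup>+\<omega>. joint_level n q \<omega> (snd z) (fst z) * ?I (snd z) \<partial>seqs) \<partial>power_pair q)"
    by (rule P.Fubini'[symmetric]) (use J3 in \<open>simp add: case_prod_beta'\<close>)
  also have "\<dots> = (\<integral>\<^sup>+z. level_prob n q (snd z) (fst z) * ?I (snd z) \<partial>power_pair q)"
    unfolding level_prob_def by (intro nn_integral_cong nn_integral_multc J4)
  finally show ?thesis .
qed

lemma level_prob_measurable:
  "(\<lambda>z. level_prob n q (snd z) (fst z)) \<in> borel_measurable (power_pair q)"
proof -
  have "(\<lambda>w. joint_level n q (snd w) (snd (fst w)) (fst (fst w)))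
      \<in> borel_measurable ((power_pair q) \<Otimes>\<^sub>M seqs)"
    by (intro joint_level_measurable) simp_all
  from seq.P.borel_measurable_nn_integral_fst[OF this] show ?thesis
    by (simp add: level_prob_def)
qed

end

section \<open>Asymptotics of the level probabilities\<close>

primrec wmax :: "(nat \<Rightarrow> 'a::linorder) \<Rightarrow> 'a \<Rightarrow> nat \<Rightarrow> 'a" where
  "wmax v a 0 = a"
| "wmax v a (Suc i) = max (wmax v a i) (v i)"

lemma wmax_mono: "i \<le> j \<Longrightarrow> wmax v a i \<le> wmax v a j"
  by (induction j) (auto simp: le_Suc_eq max.coboundedI1)

lemma wmax_ge: "i < j \<Longrightarrow> v i \<le> wmax v a j"
  by (induction j) (auto simp: less_Suc_eq max.coboundedI1)

lemma wmax_cong: "(\<And>j. j < i \<Longrightarrow> v j = v' j) \<Longrightarrow> wmax v a i = wmax v' a i"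
  by (induction i) auto

context path_cuts
begin

text \<open>\<open>1 - tail y\<close> is the integral of the Erlang density over
  \<open>{0..y}\<close>, in which the factor \<open>exp (- t)\<close> lies between
  \<open>exp (- y)\<close> and 1.\<close>

lemma tail_complement_bounds:
  assumes y: "y \<ge> 0"
  shows "exp (- y) * (y ^ k / fact k) \<le> 1 - tail y" "1 - tail y \<le> y ^ k / fact k"
proof -
  let ?p = "\<lambda>t::real. t ^ (k - 1) / fact (k - 1)"
  have eq: "1 - tail y = integral {0..y} (pois (k - 1))"
    using tail_upper_integral[OF y] by simp
  have pint: "pois (k - 1) integrable_on {0..y}"
    by (intro integrable_continuous_real continuous_intros)
  have "((\<lambda>t. ?p t) has_integral (y ^ k / fact k - 0 ^ k / fact k)) {0..y}"
  proof (rule fundamental_theorem_of_calculus[OF y])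
    fix x
    have "((\<lambda>t. t ^ k / fact k) has_real_derivative ?p x) (at x within {0..y})"
    proof -
      obtain j where j: "k = Suc j" using k_ge_2 by (cases k) auto
      show ?thesis unfolding j
        by (rule DERIV_cong[OF DERIV_cdivide[OF DERIV_power[OF DERIV_ident]]]) (simp add: divide_simps)
    qed
    then show "((\<lambda>t. t ^ k / fact k) has_vector_derivative ?p x) (at x within {0..y})"
      by (simp add: has_real_derivative_iff_has_vector_derivative)
  qed
  then have int: "((\<lambda>t. ?p t) has_integral (y ^ k / fact k)) {0..y}"
    using k_ge_2 by (simp add: power_0_left)
  have "integral {0..y} (pois (k - 1)) \<le> integral {0..y} (\<lambda>t. ?p t)"
  proof (rule integral_le[OF pint has_integral_integrable[OF int]])
    fix t assume t: "t \<in> {0..y}"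
    have "exp (- t) * t ^ (k - 1) \<le> 1 * t ^ (k - 1)" using t by (intro mult_right_mono) auto
    then show "pois (k - 1) t \<le> ?p t" by (simp add: pois_def divide_right_mono)
  qed
  then show "1 - tail y \<le> y ^ k / fact k" using eq integral_unique[OF int] by simp
  have int': "((\<lambda>t. exp (- y) * ?p t) has_integral exp (- y) * (y ^ k / fact k)) {0..y}"
    by (rule has_integral_mult_right[OF int])
  have "integral {0..y} (\<lambda>t. exp (- y) * ?p t) \<le> integral {0..y} (pois (k - 1))"
  proof (rule integral_le[OF has_integral_integrable[OF int'] pint])
    fix t assume t: "t \<in> {0..y}"
    have "exp (- y) * t ^ (k - 1) \<le> exp (- t) * t ^ (k - 1)" using t by (intro mult_right_mono) auto
    then show "exp (- y) * ?p t \<le> pois (k - 1) t" by (simp add: pois_def divide_right_mono)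
  qed
  then show "exp (- y) * (y ^ k / fact k) \<le> 1 - tail y" using eq integral_unique[OF int'] by simp
qed

text \<open>On the capped range \<open>y \<le> 1\<close> the factor \<open>exp (- y)\<close> is at
  least \<open>exp (- 1)\<close>; dividing by \<open>fact k\<close> gives the coefficient of
  \<open>y ^ k\<close> that remains.\<close>

definition tail_rate :: real where
  "tail_rate = exp (- 1) / fact k"

lemma tail_rate_pos: "tail_rate > 0" and tail_rate_le_1: "tail_rate \<le> 1"
proof -
  show "tail_rate > 0" by (simp add: tail_rate_def)
  have "exp (- 1) \<le> (1 :: real)" "(1 :: real) \<le> fact k" by simp_all
  then have "exp (- 1) \<le> (fact k :: real)" by (rule order.trans)
  then show "tail_rate \<le> 1" by (simp add: tail_rate_def)
qed

lemma tail_le_exp: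
  assumes "0 \<le> y" "y \<le> 1"
  shows "tail y \<le> exp (- tail_rate * y ^ k)"
proof -
  have "exp (- 1) * (y ^ k / fact k) \<le> exp (- y) * (y ^ k / fact k)"
    using assms by (intro mult_right_mono) auto
  then have "tail y \<le> 1 + (- tail_rate * y ^ k)"
    using tail_complement_bounds(1)[OF assms(1)] by (simp add: tail_rate_def)
  then show ?thesis using exp_ge_add_one_self[of "- tail_rate * y ^ k"] by linarith
qed

lemma scaled_power:
  assumes "n > 0"
  shows "(x * real n powr (- 1 / k)) ^ k = x ^ k / real n"
proof -
  have "(real n powr (- 1 / k)) ^ k = real n powr (real k * (- 1 / k))"
    using assms by (intro powr_power) simp
  also have "real k * (- 1 / k) = - 1" using k_ge_2 by simp
  finally show ?thesis using assms by (simp add: power_mult_distrib powr_minus divide_simps)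
qed

lemma scale_tendsto_0: "(\<lambda>n. x * real n powr (- 1 / k)) \<longlonglongrightarrow> 0"
proof -
  have "(\<lambda>n. real n powr (- 1 / k)) \<longlonglongrightarrow> 0"
    using k_ge_2 by (intro tendsto_neg_powr filterlim_real_sequentially) simp
  from tendsto_mult[OF tendsto_const[of x] this] show ?thesis by simp
qed

text \<open>With \<open>z n = 1 - tail (\<delta> n)\<close>, the product \<open>real n * z n\<close>
  tends to \<open>x ^ k / fact k\<close>. The logarithm of the power is squeezed between its linear
  term and that term corrected by \<open>2 * real (w n) * (z n)^2\<close>, which vanishes.\<close>

lemma tail_power_limit:
  assumes x: "x \<ge> 0" and w: "(\<lambda>n. real (w n) / real n) \<longlonglongrightarrow> D"
  shows "(\<lambda>n. tail (x * real n powr (- 1 / k)) ^ w n) \<longlonglongrightarrow> exp (- (1 / fact k) * (D * x ^ k))"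
proof -
  define \<delta> where "\<delta> n = x * real n powr (- 1 / k)" for n
  define z where "z n = 1 - tail (\<delta> n)" for n
  have \<delta>0: "\<delta> n \<ge> 0" for n using x by (simp add: \<delta>_def)
  have \<delta>_lim: "\<delta> \<longlonglongrightarrow> 0" unfolding \<delta>_def[abs_def] by (rule scale_tendsto_0)
  have z: "exp (- \<delta> n) * (\<delta> n ^ k / fact k) \<le> z n" "z n \<le> \<delta> n ^ k / fact k" for n
    using tail_complement_bounds[OF \<delta>0] by (auto simp: z_def)
  have z0: "0 \<le> z n" for n using tail_le_1[OF \<delta>0] by (simp add: z_def)
  have nz: "(\<lambda>n. real n * z n) \<longlonglongrightarrow> x ^ k / fact k"
  proof (rule tendsto_sandwich)
    have pw: "real n * (\<delta> n ^ k / fact k) = x ^ k / fact k" if "n > 0" for n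
      using scaled_power[OF that, of x] that by (simp add: \<delta>_def)
    show "\<forall>\<^sub>F n in sequentially. exp (- \<delta> n) * (x ^ k / fact k) \<le> real n * z n"
      using eventually_gt_at_top[of 0]
    proof eventually_elim
      case (elim n)
      have "real n * (exp (- \<delta> n) * (\<delta> n ^ k / fact k)) \<le> real n * z n"
        using z(1)[of n] by (intro mult_left_mono) auto
      then show ?case using pw[OF elim] by (metis mult.left_commute)
    qed
    show "\<forall>\<^sub>F n in sequentially. real n * z n \<le> x ^ k / fact k"
      using eventually_gt_at_top[of 0]
    proof eventually_elim
      case (elim n)
      show ?case using mult_left_mono[OF z(2)[of n], of "real n"] pw[OF elim] by simp
    qed
    have "(\<lambda>n. exp (- \<delta> n) * (x ^ k / fact k)) \<longlonglongrightarrow> exp (- 0) * (x ^ k / fact k)"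
      by (intro tendsto_intros \<delta>_lim)
    then show "(\<lambda>n. exp (- \<delta> n) * (x ^ k / fact k)) \<longlonglongrightarrow> x ^ k / fact k" by simp
  qed simp
  have z_lim: "z \<longlonglongrightarrow> 0"
  proof (rule tendsto_sandwich[of "\<lambda>_. 0" _ _ "\<lambda>n. \<delta> n ^ k / fact k"])
    have "(\<lambda>n. \<delta> n ^ k / fact k) \<longlonglongrightarrow> 0 ^ k / fact k" by (intro tendsto_intros \<delta>_lim) auto
    moreover have "0 ^ k / fact k = (0 :: real)" using k_ge_2 by (simp add: power_0_left)
    ultimately show "(\<lambda>n. \<delta> n ^ k / fact k) \<longlonglongrightarrow> 0" by metis
  qed (use z z0 in auto)
  have wz: "(\<lambda>n. real (w n) * z n) \<longlonglongrightarrow> D * (x ^ k / fact k)"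
  proof (rule Lim_transform_eventually[OF tendsto_mult[OF w nz]])
    show "\<forall>\<^sub>F n in sequentially. real (w n) / real n * (real n * z n) = real (w n) * z n"
      using eventually_gt_at_top[of 0] by eventually_elim simp
  qed
  have "(\<lambda>n. real (w n) * ln (1 - z n)) \<longlonglongrightarrow> - (D * (x ^ k / fact k))"
  proof (rule tendsto_sandwich)
    have small: "\<forall>\<^sub>F n in sequentially. z n < 1 / 2"
      using order_tendstoD(2)[OF z_lim, of "1 / 2"] by simp
    show "\<forall>\<^sub>F n in sequentially. - (real (w n) * z n) - 2 * (real (w n) * z n) * z n \<le> real (w n) * ln (1 - z n)"
      using small
    proof eventually_elim
      case (elim n)
      have "real (w n) * (- z n - 2 * (z n)\<^sup>2) \<le> real (w n) * ln (1 - z n)"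
        using elim z0 by (intro mult_left_mono ln_one_minus_pos_lower_bound) auto
      then show ?case by (simp add: algebra_simps power2_eq_square)
    qed
    show "\<forall>\<^sub>F n in sequentially. real (w n) * ln (1 - z n) \<le> - (real (w n) * z n)"
      using small
    proof eventually_elim
      case (elim n)
      have "ln (1 - z n) \<le> - z n" using ln_le_minus_one[of "1 - z n"] elim by simp
      from mult_left_mono[OF this, of "real (w n)"] show ?case by simp
    qed
    have "(\<lambda>n. - (real (w n) * z n) - 2 * (real (w n) * z n) * z n) \<longlonglongrightarrow>
        - (D * (x ^ k / fact k)) - 2 * (D * (x ^ k / fact k)) * 0"
      by (intro tendsto_intros wz z_lim)
    then show "(\<lambda>n. - (real (w n) * z n) - 2 * (real (w n) * z n) * z n) \<longlonglongrightarrow> - (D * (x ^ k / fact k))"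
      by simp
  qed (rule tendsto_minus[OF wz])
  then have "(\<lambda>n. exp (real (w n) * ln (1 - z n))) \<longlonglongrightarrow> exp (- (D * (x ^ k / fact k)))"
    by (rule tendsto_exp)
  moreover have "\<forall>\<^sub>F n in sequentially. exp (real (w n) * ln (1 - z n)) = tail (\<delta> n) ^ w n"
    using order_tendstoD(2)[OF z_lim, of 1, simplified]
  proof eventually_elim
    case (elim n)
    then show ?case by (simp add: exp_of_nat_mult z_def)
  qed
  ultimately have "(\<lambda>n. tail (\<delta> n) ^ w n) \<longlonglongrightarrow> exp (- (D * (x ^ k / fact k)))"
    by (rule Lim_transform_eventually)
  then show ?thesis by (simp add: \<delta>_def)
qed

section \<open>Joint law of the running minima\<close>

lemma prob_above:
  assumes "\<And>j. j < N \<Longrightarrow> z j \<ge> 0"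
  shows "measure seqs {\<omega>. \<forall>j<N. z j < \<omega> j} = (\<Prod>j<N. tail (z j))"
proof -
  have "prod_emb UNIV (\<lambda>_. ring_law k) {..<N} (Pi\<^sub>E {..<N} (\<lambda>j. {z j<..})) = {\<omega>. \<forall>j<N. z j < \<omega> j}"
    unfolding prod_emb_def by (auto simp: PiE_def extensional_def Pi_def restrict_def)
  moreover have "measure seqs (prod_emb UNIV (\<lambda>_. ring_law k) {..<N} (Pi\<^sub>E {..<N} (\<lambda>j. {z j<..}))) =
      (\<Prod>j<N. measure (ring_law k) {z j<..})"
    by (rule seq.measure_PiM_emb) simp_all
  ultimately have "measure seqs {\<omega>. \<forall>j<N. z j < \<omega> j} = (\<Prod>j<N. measure (ring_law k) {z j<..})"
    by (simp only:)
  also have "\<dots> = (\<Prod>j<N. tail (z j))"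
    using assms by (intro prod.cong measure_ring_law_gt) auto
  finally show ?thesis .
qed

text \<open>For decreasing levels \<open>y\<close>, the constraints \<open>j < v i \<longrightarrow> y i < \<omega> j\<close> with \<open>j\<close> below the running
  maximum of \<open>v\<close> are implied by earlier ones.\<close>

lemma prob_staircase:
  fixes v :: "nat \<Rightarrow> nat"
  assumes y: "\<And>i. i < q \<Longrightarrow> y i \<ge> 0" "\<And>i j. i \<le> j \<Longrightarrow> j < q \<Longrightarrow> y j \<le> y i"
  shows "measure seqs {\<omega>. \<forall>i<q. \<forall>j<v i. y i < \<omega> j} =
    (\<Prod>i<q. tail (y i) ^ (wmax v 0 (Suc i) - wmax v 0 i))"
proof -
  let ?E = "{\<omega>. \<forall>i<q. \<forall>j<v i. y i < \<omega> j}"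
  define W where "W = wmax v 0"
  have W0: "W 0 = 0" and WS: "W (Suc i) = max (W i) (v i)" for i by (simp_all add: W_def)
  have W_mono: "i \<le> j \<Longrightarrow> W i \<le> W j" for i j unfolding W_def by (rule wmax_mono)
  \<comment> \<open>Index of the first entry whose running maximum exceeds \<open>j\<close>. Levels
    decrease, so this entry imposes the strongest constraint on coordinate \<open>j\<close>.\<close>
  define ix where "ix j = (LEAST i. j < W (Suc i))" for j
  have ix: "j < W (Suc (ix j))" "W (ix j) \<le> j" "ix j < q" if j: "j < W q" for j
  proof -
    have "q \<noteq> 0" using j W0 by (metis not_less0)
    then have "j < W (Suc (q - 1))" using j by simp
    from LeastI[of "\<lambda>i. j < W (Suc i)", OF this] Least_le[of "\<lambda>i. j < W (Suc i)", OF this] \<open>q \<noteq> 0\<close>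
    show "j < W (Suc (ix j))" "ix j < q" by (simp_all add: ix_def)
    show "W (ix j) \<le> j"
    proof (cases "ix j")
      case (Suc i)
      then have "\<not> j < W (Suc i)" using not_less_Least[of i "\<lambda>i. j < W (Suc i)"] by (simp add: ix_def)
      then show ?thesis using Suc by simp
    qed (simp add: W0)
  qed
  have "?E = {\<omega>. \<forall>j<W q. y (ix j) < \<omega> j}"
  proof (intro equalityI subsetI CollectI allI impI)
    fix \<omega> j assume \<omega>: "\<omega> \<in> ?E" and j: "j < W q"
    have "j < v (ix j)" using ix(1,2)[OF j] WS[of "ix j"] by simp
    then show "y (ix j) < \<omega> j" using \<omega> ix(3)[OF j] by simp
  next
    fix \<omega> i j assume \<omega>: "\<omega> \<in> {\<omega>. \<forall>j<W q. y (ix j) < \<omega> j}" and i: "i < q" and j: "j < v i"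
    have ji: "j < W (Suc i)" using j WS[of i] by simp
    then have jq: "j < W q" using W_mono[of "Suc i" q] i by simp
    have "ix j \<le> i" unfolding ix_def using ji by (rule Least_le)
    then have "y i \<le> y (ix j)" using y(2) i by simp
    then show "y i < \<omega> j" using \<omega> jq by force
  qed
  then have "measure seqs ?E = (\<Prod>j<W q. tail (y (ix j)))"
    using prob_above[of "W q" "\<lambda>j. y (ix j)"] ix y(1) by simp
  also have "p \<le> q \<Longrightarrow> (\<Prod>j<W p. tail (y (ix j))) = (\<Prod>i<p. tail (y i) ^ (W (Suc i) - W i))" for p
  proof (induction p)
    case (Suc p)
    have eq: "ix j = p" if "j \<in> {W p..<W (Suc p)}" for j
      unfolding ix_def
    proof (rule Least_equality)
      fix i assume "j < W (Suc i)"
      then show "p \<le> i" using that W_mono[of "Suc i" p] by (cases "p \<le> i") auto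
    qed (use that in simp)
    have "{..<W (Suc p)} = {..<W p} \<union> {W p..<W (Suc p)}" using W_mono[of p "Suc p"] by auto
    then have "(\<Prod>j<W (Suc p). tail (y (ix j))) =
        (\<Prod>j<W p. tail (y (ix j))) * (\<Prod>j\<in>{W p..<W (Suc p)}. tail (y (ix j)))"
      by (simp add: prod.union_disjoint ivl_disj_int)
    also have "(\<Prod>j\<in>{W p..<W (Suc p)}. tail (y (ix j))) = tail (y p) ^ (W (Suc p) - W p)"
      using eq by simp
    finally show ?case using Suc by simp
  qed (simp add: W0)
  finally show ?thesis by (simp add: W_def)
qed

lemma less_scaled_min_iff:
  assumes "n > 0"
  shows "x < scaled_min n u \<omega> \<longleftrightarrow>
    x * real n powr (- 1 / k) < 1 \<and> (\<forall>j<nat \<lfloor>real n * u\<rfloor>. x * real n powr (- 1 / k) < \<omega> j)"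
proof -
  define A where "A = real n powr (1 / k)"
  have A: "A > 0" "real n powr (- 1 / k) = inverse A"
    using assms powr_minus[of "real n" "1 / k"] by (simp_all add: A_def)
  then have "x < scaled_min n u \<omega> \<longleftrightarrow> x * real n powr (- 1 / k) < run_min 1 \<omega> (nat \<lfloor>real n * u\<rfloor>)"
    unfolding scaled_min_def A_def[symmetric] by (simp add: divide_inverse[symmetric] pos_divide_less_eq mult.commute)
  then show ?thesis by (simp add: less_run_min_iff)
qed

lemma level_event_sets:
  fixes x u :: "nat \<Rightarrow> real"
  shows "{\<omega>. \<forall>i<q. x i < scaled_min n (u i) \<omega>} \<in> sets seqs"
proof -
  have "{\<omega> \<in> space seqs. \<forall>i\<in>{..<q}. x i < scaled_min n (u i) \<omega>} \<in> sets seqs"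
    by (intro sets.sets_Collect_finite_All borel_measurable_less scaled_min_measurable) auto
  then show ?thesis by (simp add: Ball_def)
qed

lemma level_prob_eq_measure:
  "level_prob n q x \<tau> = ennreal (measure seqs {\<omega>. \<forall>i<q. x i < scaled_min n (path_f (\<tau> i)) \<omega>})"
proof -
  have "joint_level n q \<omega> x \<tau> = indicator {\<omega>. \<forall>i<q. x i < scaled_min n (path_f (\<tau> i)) \<omega>} \<omega>" for \<omega>
    unfolding joint_level_def by (induction q) (auto simp: indicator_def less_Suc_eq)
  then show ?thesis
    unfolding level_prob_def
    by (simp add: level_event_sets seq.P.emeasure_eq_measure)
qed

text \<open>The index \<open>q - Suc i\<close> undoes the reversal of coordinates, pairing the first
  position with the largest level. The increments of the running maximum are the values of
  \<open>D_fun path_f\<close> on initial segments.\<close>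

definition limit_density :: "nat \<Rightarrow> (nat \<Rightarrow> real) \<Rightarrow> (nat \<Rightarrow> real) \<Rightarrow> real" where
  "limit_density q x \<tau> = exp (- (1 / fact k) * (\<Sum>i<q. (wmax (\<lambda>i. path_f (\<tau> (q - Suc i))) 0 (Suc i)
     - wmax (\<lambda>i. path_f (\<tau> (q - Suc i))) 0 i) * x (q - Suc i) ^ k))"

lemma decr_set_antimono:
  assumes "x \<in> decr_set q S" "i \<le> j" "j < q"
  shows "x i \<le> x j"
  using assms(2,3)
proof (induction rule: dec_induct)
  case (step j)
  then have "x j \<le> x (Suc j)" using assms(1) by (simp add: decr_set_def)
  with step show ?case by simp
qed simp

lemma nat_floor_tendsto:
  assumes "u \<ge> 0"
  shows "(\<lambda>n. real (nat \<lfloor>real n * u\<rfloor>) / real n) \<longlonglongrightarrow> u"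
proof (rule tendsto_sandwich[of "\<lambda>n. u - 1 / real n" _ _ "\<lambda>_. u"])
  have *: "real n * u - 1 \<le> real (nat \<lfloor>real n * u\<rfloor>)" "real (nat \<lfloor>real n * u\<rfloor>) \<le> real n * u" for n
    using assms by (auto simp: of_nat_nat)
  show "\<forall>\<^sub>F n in sequentially. u - 1 / real n \<le> real (nat \<lfloor>real n * u\<rfloor>) / real n"
    using eventually_gt_at_top[of 0]
  proof eventually_elim
    case (elim n)
    then show ?case using divide_right_mono[OF *(1)[of n], of "real n"] by (simp add: diff_divide_distrib)
  qed
  show "\<forall>\<^sub>F n in sequentially. real (nat \<lfloor>real n * u\<rfloor>) / real n \<le> u"
    using eventually_gt_at_top[of 0]
  proof eventually_elim
    case (elim n)
    then show ?case using divide_right_mono[OF *(2)[of n], of "real n"] by simp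
  qed
  show "(\<lambda>n. u - 1 / real n) \<longlonglongrightarrow> u"
    using tendsto_diff[OF tendsto_const[of u] lim_1_over_n] by simp
qed simp

text \<open>The staircase formula is a finite product of powers of \<open>tail\<close>, and its
  exponents divided by \<open>n\<close> converge to increments of the running maximum of the tent
  values.\<close>

lemma level_prob_limit:
  assumes x: "x \<in> decr_set q {0..}" and \<tau>: "\<And>i. i < q \<Longrightarrow> \<tau> i \<in> {0..1}"
  shows "(\<lambda>n. level_prob n q x \<tau>) \<longlonglongrightarrow> ennreal (limit_density q x \<tau>)"
proof -
  define xs where "xs i = x (q - Suc i)" for i
  define f where "f i = path_f (\<tau> (q - Suc i))" for i
  have f0: "f i \<ge> 0" if "i < q" for i
    using path_f_range[OF \<tau>, of "q - Suc i"] that by (simp add: f_def)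
  have xs0: "xs i \<ge> 0" if "i < q" for i using x that by (simp add: xs_def decr_set_def)
  have xs_decr: "xs j \<le> xs i" if "i \<le> j" "j < q" for i j
    unfolding xs_def using decr_set_antimono[OF x] that by simp
  define v where "v n i = nat \<lfloor>real n * f i\<rfloor>" for n i
  let ?P = "\<lambda>n i. tail (xs i * real n powr (- 1 / k)) ^ (wmax (v n) 0 (Suc i) - wmax (v n) 0 i)"
  have W_lim: "i \<le> q \<Longrightarrow> (\<lambda>n. real (wmax (v n) 0 i) / real n) \<longlonglongrightarrow> wmax f 0 i" for i
  proof (induction i)
    case (Suc i)
    have "(\<lambda>n. max (real (wmax (v n) 0 i) / real n) (real (v n i) / real n)) \<longlonglongrightarrow> max (wmax f 0 i) (f i)"
      unfolding v_def by (intro tendsto_max nat_floor_tendsto f0 Suc[unfolded v_def]) (use Suc in auto)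
    moreover have "real (wmax (v n) 0 (Suc i)) / real n = max (real (wmax (v n) 0 i) / real n) (real (v n i) / real n)" for n
      by (auto simp: max_def divide_right_mono divide_le_cancel)
    ultimately show ?case by (simp only: wmax.simps(2))
  qed simp
  have D_lim: "(\<lambda>n. real (wmax (v n) 0 (Suc i) - wmax (v n) 0 i) / real n) \<longlonglongrightarrow> wmax f 0 (Suc i) - wmax f 0 i"
    if "i < q" for i
    using tendsto_diff[OF W_lim[of "Suc i"] W_lim[of i]] that
    by (simp add: of_nat_diff diff_divide_distrib del: of_nat_max)
  have "(\<lambda>n. \<Prod>i<q. ?P n i) \<longlonglongrightarrow>
      (\<Prod>i<q. exp (- (1 / fact k) * ((wmax f 0 (Suc i) - wmax f 0 i) * xs i ^ k)))"
    by (intro tendsto_prod tail_power_limit xs0 D_lim) auto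
  also have "(\<Prod>i<q. exp (- (1 / fact k) * ((wmax f 0 (Suc i) - wmax f 0 i) * xs i ^ k))) = limit_density q x \<tau>"
    unfolding limit_density_def f_def[symmetric] xs_def[symmetric] sum_distrib_left
    by (rule exp_sum[symmetric]) simp
  finally have lim: "(\<lambda>n. \<Prod>i<q. ?P n i)
      \<longlonglongrightarrow> limit_density q x \<tau>" .
  \<comment> \<open>Eventually all scaled levels lie below the cap 1, so only the constraints on the
    ring times remain.\<close>
  have "\<forall>\<^sub>F n in sequentially. \<forall>i\<in>{..<q}. xs i * real n powr (- 1 / k) < 1"
    by (intro eventually_ball_finite ballI order_tendstoD(2)[OF scale_tendsto_0]) auto
  then have "\<forall>\<^sub>F n in sequentially. ennreal (\<Prod>i<q. tail (xs i * real n powr (- 1 / k)) ^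
      (wmax (v n) 0 (Suc i) - wmax (v n) 0 i)) = level_prob n q x \<tau>"
    using eventually_gt_at_top[of 0]
  proof eventually_elim
    case (elim n)
    have "{\<omega>. \<forall>i<q. x i < scaled_min n (path_f (\<tau> i)) \<omega>} =
        {\<omega>. \<forall>i<q. x (q - Suc i) < scaled_min n (path_f (\<tau> (q - Suc i))) \<omega>}"
    proof (intro Collect_cong iffI allI impI)
      fix \<omega> i assume "\<forall>i<q. x (q - Suc i) < scaled_min n (path_f (\<tau> (q - Suc i))) \<omega>" "i < q"
      from this(1)[rule_format, of "q - Suc i"] this(2)
      show "x i < scaled_min n (path_f (\<tau> i)) \<omega>" by simp
    qed auto
    also have "\<dots> = {\<omega>. \<forall>i<q. \<forall>j<v n i. xs i * real n powr (- 1 / k) < \<omega> j}"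
      using elim less_scaled_min_iff[OF elim(2)] by (auto simp: xs_def v_def f_def)
    finally show ?case
      unfolding level_prob_eq_measure
      by (subst prob_staircase[symmetric]) (auto simp: xs0 xs_decr mult_right_mono)
  qed
  with tendsto_ennrealI[OF lim] show ?thesis by (rule Lim_transform_eventually)
qed

text \<open>The factor \<open>exp tail_rate\<close> pays for the floor: it costs at most one ring
  time, and \<open>\<delta> ^ k \<le> 1\<close>. A level at or above the cap has probability
  zero.\<close>

lemma level_prob_single:
  assumes n: "n > 0" and x: "x \<ge> 0" and u: "u \<ge> 0"
  shows "measure seqs {\<omega>. x < scaled_min n u \<omega>} \<le> exp tail_rate * exp (- tail_rate * u * x ^ k)"
proof (cases "x * real n powr (- 1 / k) < 1")
  case True
  define \<delta> where "\<delta> = x * real n powr (- 1 / k)"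
  define N where "N = nat \<lfloor>real n * u\<rfloor>"
  have \<delta>: "0 \<le> \<delta>" "\<delta> \<le> 1" using True x by (auto simp: \<delta>_def)
  have "measure seqs {\<omega>. x < scaled_min n u \<omega>} = tail \<delta> ^ N"
    using less_scaled_min_iff[OF n] True prob_above[of N "\<lambda>_. \<delta>"] \<delta> by (simp add: \<delta>_def N_def)
  also have "\<dots> \<le> exp (- tail_rate * \<delta> ^ k) ^ N"
    using \<delta> by (intro power_mono tail_le_exp tail_nonneg)
  also have "\<dots> = exp (- (tail_rate * (real N * \<delta> ^ k)))"
    by (simp add: exp_of_nat_mult[symmetric])
  also have "\<dots> \<le> exp (tail_rate - tail_rate * u * x ^ k)"
  proof -
    have "real n * u - 1 \<le> real N" unfolding N_def by linarith
    then have "(real n * u - 1) * \<delta> ^ k \<le> real N * \<delta> ^ k" using \<delta> by (intro mult_right_mono) auto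
    moreover have "real n * u * \<delta> ^ k = u * x ^ k"
      using scaled_power[OF n, of x] n by (simp add: \<delta>_def)
    moreover have "\<delta> ^ k \<le> 1" using \<delta> by (simp add: power_le_one)
    ultimately have "u * x ^ k - 1 \<le> real N * \<delta> ^ k" by (simp add: left_diff_distrib)
    from mult_left_mono[OF this, of tail_rate] tail_rate_pos show ?thesis by (simp add: algebra_simps)
  qed
  also have "\<dots> = exp tail_rate * exp (- tail_rate * u * x ^ k)" by (simp flip: exp_add)
  finally show ?thesis .
next
  case False
  then have "{\<omega>. x < scaled_min n u \<omega>} = {}" using less_scaled_min_iff[OF n] by auto
  then show ?thesis by simp
qed

text \<open>The probability of an intersection of \<open>q\<close> events is at most the geometric mean of theirs.\<close>

lemma level_prob_le:
  assumes n: "n > 0" and q: "q > 0" and x: "\<And>i. i < q \<Longrightarrow> x i \<ge> 0" and \<tau>: "\<And>i. i < q \<Longrightarrow> \<tau> i \<in> {0..1}"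
  shows "level_prob n q x \<tau> \<le> (\<Prod>i<q. ennreal (exp tail_rate * exp (- (tail_rate / q) * path_f (\<tau> i) * x i ^ k)))"
proof -
  define p where "p = measure seqs {\<omega>. \<forall>i<q. x i < scaled_min n (path_f (\<tau> i)) \<omega>}"
  define r where "r i = exp tail_rate * exp (- (tail_rate / q) * path_f (\<tau> i) * x i ^ k)" for i
  have "p \<le> r i ^ q" if i: "i < q" for i
  proof -
    have "p \<le> measure seqs {\<omega>. x i < scaled_min n (path_f (\<tau> i)) \<omega>}"
      unfolding p_def
    proof (rule seq.P.finite_measure_mono)
      have "{\<omega> \<in> space seqs. x i < scaled_min n (path_f (\<tau> i)) \<omega>} \<in> sets seqs"
        by (intro borel_measurable_less scaled_min_measurable) auto
      then show "{\<omega>. x i < scaled_min n (path_f (\<tau> i)) \<omega>} \<in> sets seqs" by simp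
    qed (use i in auto)
    also have "\<dots> \<le> exp tail_rate * exp (- tail_rate * path_f (\<tau> i) * x i ^ k)"
      using path_f_range[OF \<tau>[OF i]] by (intro level_prob_single n x i) auto
    \<comment> \<open>The constant is enlarged so that the bound becomes the exact power
      \<open>r i ^ q\<close>.\<close>
    also have "\<dots> \<le> exp (real q * tail_rate) * exp (- tail_rate * path_f (\<tau> i) * x i ^ k)"
      using q tail_rate_pos by (intro mult_right_mono) auto
    also have "\<dots> = r i ^ q"
      using q by (simp add: r_def power_mult_distrib exp_of_nat_mult[symmetric])
    finally show ?thesis .
  qed
  then have "(\<Prod>i<q. p) \<le> (\<Prod>i<q. r i ^ q)"
    by (intro prod_mono) (auto simp: p_def)
  then have "p ^ q \<le> (\<Prod>i<q. r i) ^ q" by (simp add: prod_power_distrib)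
  moreover have "0 \<le> (\<Prod>i<q. r i)" by (intro prod_nonneg) (simp add: r_def)
  ultimately have "p \<le> (\<Prod>i<q. r i)"
    using power_mono_iff[of p "\<Prod>i<q. r i" q] q by (simp add: p_def)
  then have "ennreal p \<le> ennreal (\<Prod>i<q. r i)" by (rule ennreal_leI)
  also have "\<dots> = (\<Prod>i<q. ennreal (r i))" by (rule prod_ennreal[symmetric]) (simp add: r_def)
  finally show ?thesis by (simp add: level_prob_eq_measure p_def r_def)
qed

end

section \<open>Convergence of the moments\<close>

lemma wmax_le: "a \<le> c \<Longrightarrow> (\<And>i. i < j \<Longrightarrow> v i \<le> c) \<Longrightarrow> wmax v a j \<le> c"
  by (induction j) auto

lemma wmax_eq_Max: "wmax v a j = Max (insert a (v ` {..<j}))"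
proof (induction j)
  case (Suc j)
  have "insert a (v ` {..<Suc j}) = insert (v j) (insert a (v ` {..<j}))" by (auto simp: lessThan_Suc)
  then show ?case using Suc by (simp add: max.commute)
qed simp

lemma INF_path_f:
  assumes "0 \<le> a" "a \<le> b" "b \<le> 1"
  shows "(INF t\<in>{a..b}. path_f t) = min (path_f a) (path_f b)"
proof (rule cInf_eq_minimum)
  show "min (path_f a) (path_f b) \<in> path_f ` {a..b}" using assms by (simp add: min_def)
  show "min (path_f a) (path_f b) \<le> x" if "x \<in> path_f ` {a..b}" for x
    using that assms by (auto simp: path_f_def)
qed

text \<open>Appending a point on the right adds the increase of the tent value, if there is one. An
  increase is possible only if the previous point lies on the rising branch, and then its value was
  the maximum so far.\<close>

lemma sum_path_f_sorted:
  fixes s :: "nat \<Rightarrow> real"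
  assumes "\<And>i. i \<le> m \<Longrightarrow> s i \<in> {0..1}" "\<And>i j. i \<le> j \<Longrightarrow> j \<le> m \<Longrightarrow> s i \<le> s j"
  shows "(\<Sum>i<Suc m. path_f (s i)) - (\<Sum>i<m. min (path_f (s i)) (path_f (s (Suc i)))) =
    wmax (\<lambda>i. path_f (s i)) 0 (Suc m)"
  using assms
proof (induction m)
  case 0
  then show ?case using path_f_range[of "s 0"] by simp
next
  case (Suc m)
  let ?f = "\<lambda>i. path_f (s i)"
  have IH: "(\<Sum>i<Suc m. ?f i) - (\<Sum>i<m. min (?f i) (?f (Suc i))) = wmax ?f 0 (Suc m)"
    using Suc by simp
  have sm: "s m \<le> s (Suc m)" "s (Suc m) \<le> 1" using Suc.prems by auto
  have "wmax ?f 0 (Suc m) + ?f (Suc m) - min (?f m) (?f (Suc m)) = max (wmax ?f 0 (Suc m)) (?f (Suc m))"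
  proof (cases "?f (Suc m) \<le> ?f m")
    case True
    have "?f m \<le> wmax ?f 0 (Suc m)" by (rule wmax_ge) simp
    with True show ?thesis by simp
  next
    case False
    then have half: "s m \<le> 1 / 2" using sm by (auto simp: path_f_def split: if_splits)
    have "?f i \<le> ?f m" if "i < Suc m" for i
      using Suc.prems(2)[of i m] that half by (simp add: path_f_def)
    moreover have "0 \<le> ?f m" using path_f_range[of "s m"] Suc.prems(1)[of m] by simp
    ultimately have "wmax ?f 0 (Suc m) = ?f m"
      by (intro antisym wmax_le wmax_ge) auto
    with False show ?thesis by simp
  qed
  with IH show ?case by (simp only: sum.lessThan_Suc wmax.simps(2))
qed

lemma L_fun_path_f:
  assumes ts: "ts \<noteq> []" "set ts \<subseteq> {0..1}"
  shows "L_fun path_f ts = wmax (\<lambda>i. path_f (ts ! i)) 0 (length ts)"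
proof -
  define s where "s = sort ts"
  obtain m where m: "length ts = Suc m" using ts by (cases ts) auto
  have len: "length s = Suc m" by (simp add: s_def m)
  have s01: "s ! i \<in> {0..1}" if "i \<le> m" for i
  proof -
    have "s ! i \<in> set s" using that len by (intro nth_mem) simp
    then show ?thesis using ts(2) by (auto simp: s_def)
  qed
  have smono: "s ! i \<le> s ! j" if "i \<le> j" "j \<le> m" for i j
    using that len by (intro sorted_nth_mono) (auto simp: s_def)
  have "(\<Sum>i<m. INF t\<in>{s ! i..s ! Suc i}. path_f t) = (\<Sum>i<m. min (path_f (s ! i)) (path_f (s ! Suc i)))"
  proof (rule sum.cong[OF refl])
    fix i assume "i \<in> {..<m}"
    then show "(INF t\<in>{s ! i..s ! Suc i}. path_f t) = min (path_f (s ! i)) (path_f (s ! Suc i))"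
      using s01[of i] s01[of "Suc i"] smono[of i "Suc i"] by (intro INF_path_f) auto
  qed
  then have "L_fun path_f ts = wmax (\<lambda>i. path_f (s ! i)) 0 (Suc m)"
    using sum_path_f_sorted[of m "\<lambda>i. s ! i"] s01 smono
    by (simp add: L_fun_def Let_def m s_def[symmetric] del: sum.lessThan_Suc)
  \<comment> \<open>A maximum depends only on the set of values, so sorting can be undone.\<close>
  also have "\<dots> = wmax (\<lambda>i. path_f (ts ! i)) 0 (Suc m)"
  proof -
    have "(\<lambda>i. path_f (s ! i)) ` {..<Suc m} = path_f ` set s"
      unfolding set_conv_nth len by auto
    moreover have "(\<lambda>i. path_f (ts ! i)) ` {..<Suc m} = path_f ` set ts"
      unfolding set_conv_nth m by auto
    ultimately show ?thesis by (simp only: wmax_eq_Max) (simp add: s_def)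
  qed
  finally show ?thesis by (simp only: m)
qed

lemma D_fun_path_f:
  assumes i: "i < length ts" and ts: "set ts \<subseteq> {0..1}"
  shows "D_fun path_f (take (Suc i) ts) =
    wmax (\<lambda>i. path_f (ts ! i)) 0 (Suc i) - wmax (\<lambda>i. path_f (ts ! i)) 0 i"
proof -
  have L: "L_fun path_f (take j ts) = wmax (\<lambda>i. path_f (ts ! i)) 0 j" if "0 < j" "j \<le> length ts" for j
  proof -
    have "take j ts \<noteq> []" "set (take j ts) \<subseteq> {0..1}" "length (take j ts) = j"
      using that ts set_take_subset[of j ts] by auto
    then have "L_fun path_f (take j ts) = wmax (\<lambda>i. path_f (take j ts ! i)) 0 j"
      using L_fun_path_f[of "take j ts"] by simp
    also have "\<dots> = wmax (\<lambda>i. path_f (ts ! i)) 0 j" by (rule wmax_cong) simp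
    finally show ?thesis .
  qed
  show ?thesis
  proof (cases "i = 0")
    case True
    then have "length (take (Suc i) ts) = 1" using i by (cases ts) auto
    then show ?thesis using L[of 1] i True by (simp add: D_fun_def Suc_le_eq)
  next
    case False
    then show ?thesis using L[of "Suc i"] L[of i] i by (simp add: D_fun_def min_def butlast_take)
  qed
qed

context path_cuts
begin

lemma limit_density_measurable:
  "(\<lambda>z. ennreal (limit_density q (snd z) (fst z))) \<in> borel_measurable (power_pair q)"
proof -
  have \<tau>: "(\<lambda>z. path_f (fst z (q - Suc i))) \<in> borel_measurable (power_pair q)" if "i < q" for i
    using that by (intro measurable_compose[OF _ path_f_measurable] measurable_unit_power_component[OF measurable_fst]) auto
  have W: "i \<le> q \<Longrightarrow> (\<lambda>z. wmax (\<lambda>i. path_f (fst z (q - Suc i))) 0 i) \<in> borel_measurable (power_pair q)" for i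
    by (induction i) (auto intro!: borel_measurable_max \<tau>)
  have x: "(\<lambda>z. snd z (q - Suc i)) \<in> borel_measurable (power_pair q)" if "i < q" for i
    using that by (intro measurable_lborel_power_component[OF measurable_snd]) auto
  show ?thesis
    unfolding limit_density_def
    by (intro measurable_compose[OF _ measurable_ennreal] measurable_compose[OF _ borel_measurable_exp] borel_measurable_times
        borel_measurable_const borel_measurable_sum borel_measurable_diff borel_measurable_power W x) auto
qed

text \<open>Rewrites the nested integrals as one integral over a product measure, the form required
  for dominated convergence. \<open>cube_integral\<close> evaluates its integrand only on lists in
  the unit interval, where the formula for \<open>D_fun path_f\<close> holds.\<close>

lemma moment_fun_eq:
  assumes q: "q > 0"
  shows "moment_fun k path_f q = fact q *
    (\<integral>\<^sup>+z. ennreal (limit_density q (snd z) (fst z)) * indicator (decr_set q {0..}) (snd z) \<partial>power_pair q)"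
proof -
  let ?G = "\<lambda>z. ennreal (limit_density q (snd z) (fst z)) * indicator (decr_set q {0..}) (snd z)"
  define h where "h ts xs = ennreal (exp (- (1 / fact k) * (\<Sum>i<q. (wmax (\<lambda>i. path_f (ts ! i)) 0 (Suc i) -
      wmax (\<lambda>i. path_f (ts ! i)) 0 i) * (xs ! i) ^ k)))" for ts xs :: "real list"
  have h_rev: "h (rev_list q \<tau>) (rev_list q x) = ennreal (limit_density q x \<tau>)" for \<tau> x
  proof -
    have "wmax (\<lambda>i. path_f (rev_list q \<tau> ! i)) 0 i = wmax (\<lambda>i. path_f (\<tau> (q - Suc i))) 0 i" if "i \<le> q" for i
      using that by (intro wmax_cong) (simp add: nth_rev_list)
    then show ?thesis
      unfolding h_def limit_density_def
      by (intro arg_cong[where f = "\<lambda>s. ennreal (exp (- (1 / fact k) * s))"] sum.cong) (simp_all add: nth_rev_list del: wmax.simps)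
  qed
  have meas: "(\<lambda>z. ?G z)
      \<in> borel_measurable (power_pair q)"
    by (intro borel_measurable_times_ennreal limit_density_measurable
        measurable_compose[OF measurable_snd decr_set_measurable]) simp
  have dec: "decreasing_integral q {0..} (h (rev_list q \<tau>)) =
      (\<integral>\<^sup>+x. ennreal (limit_density q x \<tau>) * indicator (decr_set q {0..}) x \<partial>lborel_power q)" for \<tau>
  proof (subst decreasing_integral_eq)
    show "(\<lambda>x. h (rev_list q \<tau>) (rev_list q x)) \<in> borel_measurable (lborel_power q)"
      unfolding h_rev limit_density_def
      by (intro measurable_compose[OF _ measurable_ennreal] measurable_compose[OF _ borel_measurable_exp] borel_measurable_times
          borel_measurable_const borel_measurable_sum borel_measurable_power
          measurable_lborel_power_component[OF measurable_ident_sets[OF refl], unfolded id_apply]) auto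
  qed (simp_all add: h_rev)
  have "moment_fun k path_f q = fact q * cube_integral q (\<lambda>ts. decreasing_integral q {0..} (h ts))"
    using q unfolding moment_fun_def
    by (simp only: if_False neq0_conv[symmetric])
      (intro arg_cong[where f = "(*) (fact q)"] cube_integral_cong
        arg_cong[where f = "decreasing_integral q {0..}"] ext, simp add: h_def D_fun_path_f del: wmax.simps)
  also have "cube_integral q (\<lambda>ts. decreasing_integral q {0..} (h ts)) =
      (\<integral>\<^sup>+\<tau>. (\<integral>\<^sup>+x. ennreal (limit_density q x \<tau>) * indicator (decr_set q {0..}) x \<partial>lborel_power q) \<partial>unit_power q)"
    unfolding dec[symmetric]
    by (rule cube_integral_eq) (use lborel_power.borel_measurable_nn_integral_fst[OF meas] in \<open>simp add: dec\<close>)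
  also have "\<dots> = (\<integral>\<^sup>+z. ?G z \<partial>power_pair q)"
    using lborel_power.nn_integral_fst[OF meas] by simp
  finally show ?thesis .
qed

section \<open>A dominating kernel and moment bounds\<close>

definition dom_kernel :: "nat \<Rightarrow> real \<Rightarrow> real \<Rightarrow> ennreal" where
  "dom_kernel q t x = ennreal (exp tail_rate * exp (- (tail_rate / q) * path_f t * x ^ k))"

text \<open>The domain is split at \<open>sqrt (q / tail_rate)\<close>, where the two parts have
  equal bounds, hence the factor 2. The rate divided by \<open>q\<close> in
  \<open>dom_kernel\<close> is what produces the growth like \<open>sqrt q\<close>.\<close>

definition moment_base :: "nat \<Rightarrow> real" where
  "moment_base q = 2 * exp tail_rate * sqrt (q / tail_rate)"

lemma nn_integral_inverse_square:
  assumes r: "(r :: real) > 0"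
  shows "(\<integral>\<^sup>+x\<in>{r..}. ennreal (1 / x\<^sup>2) \<partial>lborel) = ennreal (1 / r)"
proof -
  have "(\<integral>\<^sup>+x\<in>{r..}. ennreal (1 / x\<^sup>2) \<partial>lborel) = ennreal (0 - (- (1 / r)))"
  proof (rule nn_integral_FTC_atLeast)
    fix x assume "r \<le> x"
    then show "((\<lambda>x. - (1 / x)) has_real_derivative 1 / x\<^sup>2) (at x)"
      using r by (auto intro!: derivative_eq_intros simp: power2_eq_square)
    show "0 \<le> 1 / x\<^sup>2" by simp
  next
    have "((\<lambda>x::real. - (inverse x)) \<longlongrightarrow> - 0) at_top"
      by (intro tendsto_minus tendsto_inverse_0_at_top filterlim_ident)
    then show "((\<lambda>x::real. - (1 / x)) \<longlongrightarrow> 0) at_top" by (simp add: inverse_eq_divide)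
  qed auto
  then show ?thesis by simp
qed

text \<open>Under the tent map the position becomes a uniform \<open>u\<close>, and integrating the
  exponential over \<open>u\<close> gives, up to the constant, at most 1 and at most
  \<open>d / x ^ k\<close>. For \<open>x \<ge> 1\<close> and \<open>k \<ge> 2\<close> the latter is
  below \<open>d / x^2\<close>, which is integrable at infinity.\<close>

lemma dom_kernel_integral_le:
  assumes q: "q > 0"
  shows "(\<integral>\<^sup>+x\<in>{0..}. (\<integral>\<^sup>+t. dom_kernel q t x \<partial>unit_law) \<partial>lborel) \<le> ennreal (moment_base q)"
proof -
  let ?D = "\<lambda>x. \<integral>\<^sup>+t. dom_kernel q t x \<partial>unit_law"
  define d where "d = real q / tail_rate"
  define r where "r = sqrt d"
  have d: "d \<ge> 1" using q tail_rate_pos tail_rate_le_1 by (simp add: d_def)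
  have r: "r \<ge> 1" "r * r = d" using d by (simp_all add: r_def)
  have inner: "?D x = (\<integral>\<^sup>+u\<in>{0..1}. ennreal (exp tail_rate * exp (- (x ^ k / d) * u)) \<partial>lborel)" for x
  proof -
    have "?D x = (\<integral>\<^sup>+t\<in>{0..1}. ennreal (exp tail_rate * exp (- (x ^ k / d) * path_f t)) \<partial>lborel)"
      unfolding dom_kernel_def by (subst nn_integral_unit_law) (auto simp: d_def mult_ac)
    also have "\<dots> = (\<integral>\<^sup>+u\<in>{0..1}. ennreal (exp tail_rate * exp (- (x ^ k / d) * u)) \<partial>lborel)"
      by (rule nn_integral_path_f) measurable
    finally show ?thesis .
  qed
  have le1: "?D x \<le> ennreal (exp tail_rate)" if x: "x \<ge> 0" for x
  proof -
    have "(\<integral>\<^sup>+u\<in>{0..1}. ennreal (exp tail_rate * exp (- (x ^ k / d) * u)) \<partial>lborel) \<le>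
        (\<integral>\<^sup>+u\<in>{0..1::real}. ennreal (exp tail_rate) \<partial>lborel)"
    proof (rule nn_integral_mono)
      fix u
      have "exp (- (x ^ k / d) * u) \<le> 1" if "u \<in> {0..1}" using that x d by simp
      then show "ennreal (exp tail_rate * exp (- (x ^ k / d) * u)) * indicator {0..1} u \<le>
          ennreal (exp tail_rate) * indicator {0..1} u"
        by (auto simp: indicator_def mult_left_le intro!: ennreal_leI)
    qed
    then show ?thesis unfolding inner by (simp add: nn_integral_cmult)
  qed
  have le2: "?D x \<le> ennreal (exp tail_rate * d) * ennreal (1 / x\<^sup>2)" if x: "x \<ge> r" for x
  proof -
    define a where "a = x ^ k / d"
    have x1: "x \<ge> 1" using x r by simp
    have a: "a > 0" "1 / a \<le> d / x\<^sup>2"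
    proof -
      have "x\<^sup>2 \<le> x ^ k" using x1 k_ge_2 by (rule power_increasing[rotated])
      then show "a > 0" "1 / a \<le> d / x\<^sup>2" using x1 d by (auto simp: a_def intro!: divide_left_mono)
    qed
    have "(\<integral>\<^sup>+u\<in>{0..1}. ennreal (exp tail_rate * exp (- a * u)) \<partial>lborel) =
        ennreal (- (exp tail_rate * exp (- a * 1) / a) - - (exp tail_rate * exp (- a * 0) / a))"
      by (rule nn_integral_FTC_Icc) (use a in \<open>auto intro!: derivative_eq_intros\<close>)
    also have "\<dots> \<le> ennreal (exp tail_rate * (1 / a))"
      using a by (intro ennreal_leI) simp
    also have "\<dots> \<le> ennreal (exp tail_rate * (d / x\<^sup>2))"
      using a by (intro ennreal_leI mult_left_mono) auto
    also have "\<dots> = ennreal (exp tail_rate * d) * ennreal (1 / x\<^sup>2)"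
      using d by (simp add: ennreal_mult[symmetric])
    finally show ?thesis unfolding inner a_def .
  qed
  have "(\<integral>\<^sup>+x\<in>{0..}. ?D x \<partial>lborel) \<le>
      (\<integral>\<^sup>+x. ennreal (exp tail_rate) * indicator {0..r} x +
        ennreal (exp tail_rate * d) * (ennreal (1 / x\<^sup>2) * indicator {r..} x) \<partial>lborel)"
  proof (rule nn_integral_mono)
    fix x
    show "?D x * indicator {0..} x \<le> ennreal (exp tail_rate) * indicator {0..r} x +
        ennreal (exp tail_rate * d) * (ennreal (1 / x\<^sup>2) * indicator {r..} x)"
    proof (cases "x \<ge> r")
      case True
      then show ?thesis using le2[OF True] r by (auto simp: indicator_def mult.assoc intro: order.trans add_increasing)
    next
      case False
      then show ?thesis using le1[of x] by (auto simp: indicator_def)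
    qed
  qed
  also have "\<dots> = ennreal (exp tail_rate) * ennreal r + ennreal (exp tail_rate * d) * ennreal (1 / r)"
    using r by (simp add: nn_integral_add nn_integral_cmult nn_integral_inverse_square)
  also have "\<dots> = ennreal (exp tail_rate * r + exp tail_rate * d * (1 / r))"
    using r d by (simp add: ennreal_mult[symmetric] ennreal_plus[symmetric] del: ennreal_plus)
  also have "exp tail_rate * r + exp tail_rate * d * (1 / r) = moment_base q"
    using r by (simp add: moment_base_def r_def[symmetric, unfolded d_def] r(2)[symmetric])
  finally show ?thesis .
qed

definition dominating :: "nat \<Rightarrow> (nat \<Rightarrow> real) \<times> (nat \<Rightarrow> real) \<Rightarrow> ennreal" where
  "dominating q z = (\<Prod>i<q. dom_kernel q (fst z i) (snd z i)) * indicator (decr_set q {0..}) (snd z)"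

lemma dominating_measurable: "dominating q \<in> borel_measurable (power_pair q)"
proof -
  have "(\<lambda>z. dom_kernel q (fst z i) (snd z i)) \<in> borel_measurable (power_pair q)" if "i < q" for i
    unfolding dom_kernel_def using that
    by (intro measurable_compose[OF _ measurable_ennreal] measurable_compose[OF _ borel_measurable_exp] borel_measurable_times
        borel_measurable_const borel_measurable_power measurable_compose[OF _ path_f_measurable]
        measurable_lborel_power_component[OF measurable_snd] measurable_unit_power_component[OF measurable_fst])
  then show ?thesis
    unfolding dominating_def[abs_def]
    by (intro borel_measurable_times_ennreal borel_measurable_prod_ennreal
        measurable_compose[OF measurable_snd decr_set_measurable]) auto
qed

lemma dominating_integral:
  assumes q: "q > 0"
  shows "fact q * (\<integral>\<^sup>+z. dominating q z \<partial>power_pair q) \<le> ennreal (moment_base q) ^ q"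
proof -
  have \<kappa>: "(\<lambda>z. dom_kernel q (fst z) (snd z)) \<in> borel_measurable (borel \<Otimes>\<^sub>M borel)"
    unfolding dom_kernel_def by measurable
  have meas: "(\<lambda>\<tau>. \<Prod>i<q. dom_kernel q (\<tau> i) (x i)) \<in> borel_measurable (unit_power q)" for x
    unfolding dom_kernel_def
    by (intro borel_measurable_prod_ennreal measurable_compose[OF _ measurable_ennreal] measurable_compose[OF _ borel_measurable_exp]
        borel_measurable_times borel_measurable_const measurable_compose[OF _ path_f_measurable]
        measurable_unit_power_component[OF measurable_ident_sets[OF refl], unfolded id_apply]) auto
  have "(\<integral>\<^sup>+z. dominating q z \<partial>power_pair q) = (\<integral>\<^sup>+x. (\<integral>\<^sup>+\<tau>. dominating q (\<tau>, x) \<partial>unit_power q) \<partial>lborel_power q)"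
    by (rule power_pair.nn_integral_snd[OF dominating_measurable, symmetric])
  also have "\<dots> = (\<integral>\<^sup>+x. (\<integral>\<^sup>+\<tau>. (\<Prod>i<q. dom_kernel q (\<tau> i) (x i)) \<partial>unit_power q) * indicator (decr_set q {0..}) x \<partial>lborel_power q)"
    unfolding dominating_def by (intro nn_integral_cong) (simp add: nn_integral_multc meas)
  finally have "fact q * (\<integral>\<^sup>+z. dominating q z \<partial>power_pair q) =
      (\<integral>\<^sup>+x\<in>{0..}. (\<integral>\<^sup>+t. dom_kernel q t x \<partial>unit_law) \<partial>lborel) ^ q"
    using kernel_power[OF \<kappa>, of q] by simp
  also have "\<dots> \<le> ennreal (moment_base q) ^ q"
    by (rule power_mono[OF dom_kernel_integral_le[OF q]]) simp
  finally show ?thesis .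
qed

lemma AE_unit_cube: "AE z in power_pair q. \<forall>i<q. fst z i \<in> {0..1}"
proof -
  have one: "AE t in unit_law. t \<in> {0..1}"
    unfolding unit_law_def by (subst AE_density) (auto simp: indicator_def)
  have "AE \<tau> in unit_power q. \<forall>i\<in>{..<q}. \<tau> i \<in> {0..1}"
    by (intro eventually_ball_finite ballI AE_PiM_component one) (auto intro: unit_law.prob_space_axioms)
  then have "AE \<tau> in unit_power q. AE x in lborel_power q. \<forall>i\<in>{..<q}. fst (\<tau>, x) i \<in> {0..1}"
    by eventually_elim (auto intro: AE_I2)
  then have "AE z in power_pair q. \<forall>i\<in>{..<q}. fst z i \<in> {0..1}"
  proof (rule power_pair.AE_pair_measure[rotated])
    have "{z \<in> space (power_pair q). fst z i \<in> {0..1}} \<in> sets (power_pair q)" if "i < q" for i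
      using measurable_sets[OF measurable_unit_power_component[OF measurable_fst that, of "lborel_power q"], of "{0..1}"]
      by (simp add: vimage_def Int_def conj_commute)
    then show "{z \<in> space (power_pair q). \<forall>i\<in>{..<q}. fst z i \<in> {0..1}} \<in> sets (power_pair q)"
      by (intro sets.sets_Collect_finite_All) auto
  qed
  then show ?thesis by eventually_elim auto
qed

lemma AE_level_prob_le:
  assumes "n > 0" "q > 0"
  shows "AE z in power_pair q.
    level_prob n q (snd z) (fst z) * indicator (decr_set q {0..}) (snd z) \<le> dominating q z"
  using AE_unit_cube
proof eventually_elim
  case (elim z)
  show ?case
  proof (cases "snd z \<in> decr_set q {0..}")
    case True
    then show ?thesis using level_prob_le[OF assms, of "snd z" "fst z"] elim
      by (simp add: dominating_def dom_kernel_def decr_set_def)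
  qed simp
qed

lemma scaled_sum_moment_le:
  assumes "n > 0" "q > 0"
  shows "(\<integral>\<^sup>+\<omega>. ennreal (scaled_sum n \<omega>) ^ q \<partial>seqs) \<le> ennreal (moment_base q) ^ q"
proof -
  have "(\<integral>\<^sup>+\<omega>. ennreal (scaled_sum n \<omega>) ^ q \<partial>seqs) \<le> fact q * (\<integral>\<^sup>+z. dominating q z \<partial>power_pair q)"
    unfolding scaled_sum_moment[OF assms(1)]
    by (intro mult_left_mono nn_integral_mono_AE AE_level_prob_le assms) simp
  also note dominating_integral[OF assms(2)]
  finally show ?thesis .
qed

text \<open>Dominated convergence for the joint probabilities. The dominating function is the
  product kernel on decreasing tuples, whose integral is finite by the bound on the moments.\<close>

lemma scaled_sum_moment_limit:
  assumes q: "q > 0"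
  shows "(\<lambda>n. \<integral>\<^sup>+\<omega>. ennreal (scaled_sum (Suc n) \<omega>) ^ q \<partial>seqs) \<longlonglongrightarrow> moment_fun k path_f q"
proof -
  let ?I = "\<lambda>z. indicator (decr_set q {0..}) (snd z) :: ennreal"
  let ?M = "power_pair q"
  have I: "?I \<in> borel_measurable ?M"
    by (intro measurable_compose[OF measurable_snd decr_set_measurable]) simp
  have fin: "fact q * (\<integral>\<^sup>+z. dominating q z \<partial>?M) < \<infinity>"
    using dominating_integral[OF q] by (rule le_less_trans) (simp add: power_less_top_ennreal)
  have "(\<integral>\<^sup>+z. dominating q z \<partial>?M) \<le> fact q * (\<integral>\<^sup>+z. dominating q z \<partial>?M)"
  proof -
    have "(1 :: ennreal) \<le> fact q"
      by (metis ennreal_1 ennreal_leI fact_ge_1 ennreal_of_nat_eq_real_of_nat of_nat_fact)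
    from mult_right_mono[OF this, of "\<integral>\<^sup>+z. dominating q z \<partial>?M"] show ?thesis by simp
  qed
  then have fin': "(\<integral>\<^sup>+z. dominating q z \<partial>?M) < \<infinity>" using fin by (rule le_less_trans)
  have "(\<lambda>n. \<integral>\<^sup>+z. level_prob (Suc n) q (snd z) (fst z) * ?I z \<partial>?M) \<longlonglongrightarrow>
      (\<integral>\<^sup>+z. ennreal (limit_density q (snd z) (fst z)) * ?I z \<partial>?M)"
  proof (rule nn_integral_dominated_convergence[where w = "dominating q"])
    show "AE z in ?M. (\<lambda>n. level_prob (Suc n) q (snd z) (fst z) * ?I z) \<longlonglongrightarrow>
        ennreal (limit_density q (snd z) (fst z)) * ?I z"
      using AE_unit_cube
    proof eventually_elim
      case (elim z)
      show ?case
      proof (cases "snd z \<in> decr_set q {0..}")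
        case True
        from LIMSEQ_Suc[OF level_prob_limit[OF True, of "fst z"]] elim True show ?thesis by simp
      qed simp
    qed
  qed (use AE_level_prob_le[OF _ q] fin' in \<open>auto intro!: borel_measurable_times_ennreal level_prob_measurable I
      limit_density_measurable dominating_measurable\<close>)
  moreover have "(fact q :: ennreal) < top"
    by (metis of_nat_fact of_nat_less_top)
  ultimately have "(\<lambda>n. fact q * (\<integral>\<^sup>+z. level_prob (Suc n) q (snd z) (fst z) * ?I z \<partial>?M)) \<longlonglongrightarrow>
      fact q * (\<integral>\<^sup>+z. ennreal (limit_density q (snd z) (fst z)) * ?I z \<partial>?M)"
    by (intro ennreal_tendsto_cmult)
  then show ?thesis unfolding moment_fun_eq[OF q] by (simp add: scaled_sum_moment)
qed

lemma moment_fun_le: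
  assumes q: "q > 0"
  shows "moment_fun k path_f q \<le> ennreal (moment_base q) ^ q"
  by (rule LIMSEQ_le_const2[OF scaled_sum_moment_limit[OF q]])
    (use scaled_sum_moment_le[OF _ q] in auto)

end

section \<open>Convergence in distribution\<close>

lemma power_over_fact_le_exp:
  fixes x :: real
  assumes "x \<ge> 0"
  shows "x ^ n / fact n \<le> exp x"
proof -
  have s: "(\<lambda>n. x ^ n /\<^sub>R fact n) sums exp x" by (rule exp_converges)
  have "(\<Sum>i\<in>{n}. x ^ i /\<^sub>R fact i) \<le> (\<Sum>i. x ^ i /\<^sub>R fact i)"
    using assms by (intro sum_le_suminf sums_summable[OF s]) auto
  then show ?thesis using sums_unique[OF s] by (simp add: divide_inverse mult.commute)
qed

text \<open>Since \<open>q ^ q / fact q\<close> is at most \<open>exp q\<close>, the term is at most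
  the power \<open>q\<close> of \<open>A / sqrt q\<close>. The threshold \<open>4 * A^2\<close>
  makes this base at most one half.\<close>

lemma moment_growth_tendsto_0:
  fixes T :: real
  assumes T: "T \<ge> 0"
  shows "(\<lambda>q. (T * sqrt (real q)) ^ q / fact q) \<longlonglongrightarrow> 0"
proof (rule Lim_null_comparison)
  define A where "A = T * exp 1"
  have A: "A \<ge> 0" using T by (simp add: A_def)
  show "\<forall>\<^sub>F q in sequentially. norm ((T * sqrt (real q)) ^ q / fact q) \<le> (1 / 2) ^ q"
    using eventually_ge_at_top[of "nat \<lceil>4 * A\<^sup>2\<rceil>"] eventually_gt_at_top[of 0]
  proof eventually_elim
    case (elim q)
    define r where "r = sqrt (real q)"
    have r: "r > 0" "r * r = real q" using elim by (simp_all add: r_def)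
    have "4 * A\<^sup>2 \<le> real q" using elim(1) by linarith
    then have "(2 * A)\<^sup>2 \<le> real q" by (simp add: power_mult_distrib)
    then have "2 * A \<le> r" unfolding r_def by (rule real_le_rsqrt)
    then have Ar: "A / r \<le> 1 / 2" using r by (simp add: field_simps)
    have "(T * r) ^ q / fact q = (T / r) ^ q * (real q ^ q / fact q)"
    proof -
      have "T * r = T / r * real q" using r by (simp add: field_simps)
      then show ?thesis by (simp only: power_mult_distrib times_divide_eq_right)
    qed
    also have "\<dots> \<le> (T / r) ^ q * exp (real q)"
      using T r by (intro mult_left_mono power_over_fact_le_exp) auto
    also have "\<dots> = (A / r) ^ q"
      using exp_of_nat_mult[of q "1 :: real"] by (simp add: A_def power_mult_distrib power_divide)
    also have "\<dots> \<le> (1 / 2) ^ q" using A r Ar by (intro power_mono) auto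
    finally show ?case using T by (simp add: r_def)
  qed
  show "(\<lambda>q. (1 / 2 :: real) ^ q) \<longlonglongrightarrow> 0" by (rule LIMSEQ_realpow_zero) auto
qed

context path_cuts
begin

lemma AE_scaled_sum_nonneg: "AE \<omega> in seqs. 0 \<le> scaled_sum n \<omega>"
  using AE_seqs_nonneg
  by eventually_elim (auto simp: scaled_sum_def intro!: mult_nonneg_nonneg sum_nonneg run_min_nonneg)

lemma moment_base_nonneg: "moment_base q \<ge> 0"
  using tail_rate_pos by (simp add: moment_base_def)

lemma moment_fun_finite: "moment_fun k path_f q < \<infinity>"
proof (cases "q = 0")
  case False
  then have "moment_fun k path_f q \<le> ennreal (moment_base q) ^ q" by (intro moment_fun_le) simp
  also have "\<dots> < \<infinity>" by (simp add: power_less_top_ennreal)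
  finally show ?thesis .
qed (simp add: moment_fun_def)

lemma
  shows integrable_scaled_sum_power: "integrable seqs (\<lambda>\<omega>. scaled_sum (Suc n) \<omega> ^ q)"
    and integral_scaled_sum_power: "(\<integral>\<omega>. scaled_sum (Suc n) \<omega> ^ q \<partial>seqs) =
      enn2real (\<integral>\<^sup>+\<omega>. ennreal (scaled_sum (Suc n) \<omega>) ^ q \<partial>seqs)"
proof -
  let ?N = "\<integral>\<^sup>+\<omega>. ennreal (scaled_sum (Suc n) \<omega>) ^ q \<partial>seqs"
  have nonneg: "AE \<omega> in seqs. 0 \<le> scaled_sum (Suc n) \<omega> ^ q"
    using AE_scaled_sum_nonneg[of "Suc n"] by eventually_elim simp
  have eq: "(\<integral>\<^sup>+\<omega>. ennreal (scaled_sum (Suc n) \<omega> ^ q) \<partial>seqs) = ?N"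
    by (rule nn_integral_cong_AE)
      (use AE_scaled_sum_nonneg[of "Suc n"] in \<open>eventually_elim, simp add: ennreal_power\<close>)
  have meas: "(\<lambda>\<omega>. scaled_sum (Suc n) \<omega> ^ q) \<in> borel_measurable seqs"
    by (intro borel_measurable_power scaled_sum_measurable)
  have fin: "?N < \<infinity>"
  proof (cases "q = 0")
    case True
    then show ?thesis by (simp add: seq.P.emeasure_space_1 del: seqs_space)
  next
    case False
    then have "?N \<le> ennreal (moment_base q) ^ q"
      by (intro scaled_sum_moment_le) auto
    also have "\<dots> < \<infinity>" by (simp add: power_less_top_ennreal)
    finally show ?thesis .
  qed
  show "integrable seqs (\<lambda>\<omega>. scaled_sum (Suc n) \<omega> ^ q)"
    by (rule integrableI_nonneg[OF meas nonneg]) (use fin eq in simp)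
  show "(\<integral>\<omega>. scaled_sum (Suc n) \<omega> ^ q \<partial>seqs) =
      enn2real ?N"
    unfolding eq[symmetric] by (rule integral_eq_nn_integral[OF meas nonneg])
qed

definition sum_law :: "nat \<Rightarrow> real measure" where
  "sum_law n = distr seqs borel (scaled_sum n)"

lemma real_distribution_sum_law: "real_distribution (sum_law n)"
  unfolding sum_law_def by (rule seq.P.real_distribution_distr) (rule scaled_sum_measurable)

lemma sum_law_moments:
  shows "integrable (sum_law (Suc n)) (\<lambda>x. x ^ q)"
    and "(\<integral>x. x ^ q \<partial>sum_law (Suc n)) = enn2real (\<integral>\<^sup>+\<omega>. ennreal (scaled_sum (Suc n) \<omega>) ^ q \<partial>seqs)"
  unfolding sum_law_def
  by (simp_all add: integrable_distr_eq integral_distr scaled_sum_measurable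
      integrable_scaled_sum_power integral_scaled_sum_power)

lemma sum_law_moments_limit:
  "(\<lambda>n. \<integral>x. x ^ q \<partial>sum_law (Suc n)) \<longlonglongrightarrow> enn2real (moment_fun k path_f q)"
proof (cases "q = 0")
  case True
  then show ?thesis unfolding sum_law_moments
    by (simp add: moment_fun_def seq.P.emeasure_space_1 del: seqs_space)
next
  case False
  then have "(\<lambda>n. \<integral>\<^sup>+\<omega>. ennreal (scaled_sum (Suc n) \<omega>) ^ q \<partial>seqs) \<longlonglongrightarrow> ennreal (enn2real (moment_fun k path_f q))"
    using scaled_sum_moment_limit[of q] moment_fun_finite[of q] by simp
  then show ?thesis unfolding sum_law_moments by (rule tendsto_enn2real) simp
qed

lemma moment_fun_growth:
  "(\<lambda>p. t ^ (2 * p) * enn2real (moment_fun k path_f (2 * p)) / fact (2 * p)) \<longlonglongrightarrow> 0"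
proof (rule Lim_null_comparison)
  define T where "T = \<bar>t\<bar> * (2 * exp tail_rate / sqrt tail_rate)"
  have T: "T \<ge> 0" using tail_rate_pos by (simp add: T_def)
  show "\<forall>\<^sub>F p in sequentially. norm (t ^ (2 * p) * enn2real (moment_fun k path_f (2 * p)) / fact (2 * p)) \<le>
      (T * sqrt (real (2 * p))) ^ (2 * p) / fact (2 * p)"
    using eventually_gt_at_top[of 0]
  proof eventually_elim
    case (elim p)
    have "enn2real (moment_fun k path_f (2 * p)) \<le> enn2real (ennreal (moment_base (2 * p)) ^ (2 * p))"
      using elim by (intro enn2real_mono moment_fun_le) (auto simp: power_less_top_ennreal)
    also have "\<dots> = moment_base (2 * p) ^ (2 * p)"
      using moment_base_nonneg by (simp add: ennreal_power)
    finally have "t ^ (2 * p) * enn2real (moment_fun k path_f (2 * p)) \<le> t ^ (2 * p) * moment_base (2 * p) ^ (2 * p)"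
      by (rule mult_left_mono) simp
    also have "\<dots> = (\<bar>t\<bar> * moment_base (2 * p)) ^ (2 * p)"
      by (simp add: power_mult_distrib power_even_abs)
    also have "\<bar>t\<bar> * moment_base (2 * p) = T * sqrt (real (2 * p))"
      by (simp add: moment_base_def T_def real_sqrt_divide)
    finally show ?case by (simp add: divide_right_mono)
  qed
  have "strict_mono (\<lambda>p::nat. 2 * p)" by (simp add: strict_mono_def)
  from LIMSEQ_subseq_LIMSEQ[OF moment_growth_tendsto_0[OF T] this]
  show "(\<lambda>p. (T * sqrt (real (2 * p))) ^ (2 * p) / fact (2 * p)) \<longlonglongrightarrow> 0" by (simp only: o_def)
qed

section \<open>Vanishing of the comparison error\<close>

lemma scale_factor_tendsto_0: "(\<lambda>n. real n powr (1 / k - 1)) \<longlonglongrightarrow> 0"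
  using k_ge_2 by (intro tendsto_neg_powr filterlim_real_sequentially) (simp add: divide_simps)

lemma tail_less_1:
  assumes "y > 0"
  shows "tail y < 1"
proof -
  have "0 < exp (- y) * (y ^ k / fact k)" using assms by simp
  then show ?thesis using tail_complement_bounds(1)[of y] assms by linarith
qed

lemma run_min_gt_prob:
  assumes "0 \<le> \<epsilon>" "\<epsilon> < 1"
  shows "measure seqs {\<omega>. \<epsilon> < run_min 1 \<omega> v} = tail \<epsilon> ^ v"
  using assms prob_above[of v "\<lambda>_. \<epsilon>"] by (simp add: less_run_min_iff)

lemma run_min_gt_sets: "{\<omega>. \<epsilon> < run_min 1 \<omega> v} \<in> sets seqs"
proof -
  have "{\<omega> \<in> space seqs. \<epsilon> < run_min 1 \<omega> v} \<in> sets seqs"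
    by (intro borel_measurable_less measurable_run_min) auto
  then show ?thesis by simp
qed

text \<open>The square of a minimum \<open>M\<close> in the unit interval is at most
  \<open>\<epsilon> * M\<close> plus the indicator of \<open>\<epsilon> < M\<close>. The linear part
  is a multiple of \<open>scaled_sum\<close>, with bounded mean; the indicators have total mean at
  most a geometric series independent of \<open>n\<close>, and the factor \<open>s\<close> makes
  them negligible.\<close>

lemma chain_err_le:
  fixes \<theta> \<epsilon> :: real and n :: nat
  defines "s \<equiv> real (Suc n) powr (1 / k - 1)"
  assumes \<epsilon>: "0 < \<epsilon>" "\<epsilon> < 1"
  shows "chain_err (\<theta> * s) (Suc n) 1 \<le>
    (real k + 2) * \<bar>\<theta>\<bar> * (\<epsilon> * moment_base 1 + s / (1 - tail \<epsilon>)) + 2 * \<theta>\<^sup>2 * s * moment_base 1"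
proof -
  have s: "s \<ge> 0" by (simp add: s_def)
  let ?A = "\<lambda>\<omega> v. run_min 1 \<omega> v"
  let ?I = "\<lambda>\<omega> v. indicat_real {\<omega>. \<epsilon> < run_min 1 \<omega> v} \<omega>"
  define C where "C = (real k + 2) * \<bar>\<theta>\<bar>"
  let ?F = "\<lambda>\<omega>. C * (\<epsilon> * scaled_sum (Suc n) \<omega> + s * (\<Sum>v<Suc n. ?I \<omega> v)) + 2 * \<theta>\<^sup>2 * s * scaled_sum (Suc n) \<omega>"
  have C: "C \<ge> 0" by (simp add: C_def)
  have intI: "integrable seqs (\<lambda>\<omega>. \<Sum>v<Suc n. ?I \<omega> v)"
    by (intro Bochner_Integration.integrable_sum) (simp add: run_min_gt_sets seq.P.emeasure_eq_measure del: run_min.simps)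
  have intX: "integrable seqs (scaled_sum (Suc n))" using integrable_scaled_sum_power[of n 1] by simp
  have EX: "(\<integral>\<omega>. scaled_sum (Suc n) \<omega> \<partial>seqs) \<le> moment_base 1"
  proof -
    have "(\<integral>\<omega>. scaled_sum (Suc n) \<omega> \<partial>seqs) = enn2real (\<integral>\<^sup>+\<omega>. ennreal (scaled_sum (Suc n) \<omega>) ^ 1 \<partial>seqs)"
      using integral_scaled_sum_power[of n 1] by simp
    also have "\<dots> \<le> enn2real (ennreal (moment_base 1) ^ 1)"
      by (intro enn2real_mono scaled_sum_moment_le) (auto simp: power_less_top_ennreal)
    also have "\<dots> = moment_base 1" using moment_base_nonneg by simp
    finally show ?thesis .
  qed
  have EI: "(\<integral>\<omega>. (\<Sum>v<Suc n. ?I \<omega> v) \<partial>seqs) \<le> 1 / (1 - tail \<epsilon>)"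
  proof -
    have t: "0 \<le> tail \<epsilon>" "tail \<epsilon> < 1" using \<epsilon> tail_nonneg tail_less_1 by auto
    have "(\<integral>\<omega>. (\<Sum>v<Suc n. ?I \<omega> v) \<partial>seqs) = (\<Sum>v<Suc n. tail \<epsilon> ^ v)"
      by (subst Bochner_Integration.integral_sum)
        (use \<epsilon> in \<open>simp_all add: run_min_gt_sets seq.P.emeasure_eq_measure run_min_gt_prob del: sum.lessThan_Suc run_min.simps\<close>)
    also have "\<dots> \<le> (\<Sum>v. tail \<epsilon> ^ v)"
      using t by (intro sum_le_suminf summable_geometric) auto
    also have "\<dots> = 1 / (1 - tail \<epsilon>)" using t by (intro suminf_geometric) simp
    finally show ?thesis .
  qed
  have "chain_err (\<theta> * s) (Suc n) 1 \<le>
      (\<integral>\<omega>. ?F \<omega> \<partial>seqs)"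
    unfolding chain_err_def
  proof (rule integral_mono_AE)
    show "integrable seqs (\<lambda>\<omega>. err_sum (\<theta> * s) (Suc n) 1 \<omega>)"
      by (rule seq.P.integrable_const_bound[OF always_eventually[OF allI[OF step_err_run_min_bound]]]) measurable
    show "integrable seqs (\<lambda>\<omega>. ?F \<omega>)"
      by (intro Bochner_Integration.integrable_add integrable_mult_right intI intX)
    show "AE \<omega> in seqs. (err_sum (\<theta> * s) (Suc n) 1 \<omega>) \<le>
        ?F \<omega>"
      using AE_seqs_nonneg
    proof eventually_elim
      case (elim \<omega>)
      have X: "scaled_sum (Suc n) \<omega> = s * (\<Sum>v<Suc n. ?A \<omega> v)" by (simp add: scaled_sum_def s_def)
      have "step_err (\<theta> * s) (max 0 (?A \<omega> v)) \<le> C * (\<epsilon> * (s * ?A \<omega> v) + s * ?I \<omega> v) + 2 * \<theta>\<^sup>2 * s * (s * ?A \<omega> v)" for v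
      proof -
        have A: "0 \<le> ?A \<omega> v" "?A \<omega> v \<le> 1" using elim run_min_nonneg[of 1 \<omega> v] run_min_le[of 1 \<omega> v] by auto
        have "(?A \<omega> v)\<^sup>2 \<le> \<epsilon> * ?A \<omega> v + ?I \<omega> v"
        proof (cases "\<epsilon> < ?A \<omega> v")
          case True
          have "(?A \<omega> v)\<^sup>2 \<le> 1" using A by (simp add: power_le_one)
          moreover have "0 \<le> \<epsilon> * ?A \<omega> v" using A \<epsilon> by simp
          ultimately show ?thesis using True by simp
        next
          case False
          then show ?thesis using A by (simp add: power2_eq_square mult_right_mono)
        qed
        from mult_left_mono[OF this, of "C * s"] C s
        have "C * s * (?A \<omega> v)\<^sup>2 \<le> C * s * (\<epsilon> * ?A \<omega> v + ?I \<omega> v)" by simp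
        moreover have "step_err (\<theta> * s) (max 0 (?A \<omega> v)) = C * s * (?A \<omega> v)\<^sup>2 + 2 * \<theta>\<^sup>2 * s * (s * ?A \<omega> v)"
          using A s by (simp add: step_err_def C_def abs_mult power_mult_distrib power2_eq_square[of s])
        ultimately show ?thesis by (simp add: algebra_simps)
      qed
      then have "(\<Sum>v<Suc n. step_err (\<theta> * s) (max 0 (?A \<omega> v))) \<le>
          (\<Sum>v<Suc n. C * (\<epsilon> * (s * ?A \<omega> v) + s * ?I \<omega> v) + 2 * \<theta>\<^sup>2 * s * (s * ?A \<omega> v))"
        by (rule sum_mono)
      also have "\<dots> = ?F \<omega>"
        unfolding X by (simp only: sum.distrib sum_distrib_left distrib_left)
      finally show ?case by simp
    qed
  qed
  also have "\<dots> = C * (\<epsilon> * (\<integral>\<omega>. scaled_sum (Suc n) \<omega> \<partial>seqs) + s * (\<integral>\<omega>. (\<Sum>v<Suc n. ?I \<omega> v) \<partial>seqs)) +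
      2 * \<theta>\<^sup>2 * s * (\<integral>\<omega>. scaled_sum (Suc n) \<omega> \<partial>seqs)"
    using intX intI by (simp del: sum.lessThan_Suc)
  also have "\<dots> \<le> C * (\<epsilon> * moment_base 1 + s * (1 / (1 - tail \<epsilon>))) + 2 * \<theta>\<^sup>2 * s * moment_base 1"
    using C s \<epsilon> EX EI by (intro add_mono mult_left_mono) auto
  finally show ?thesis by (simp add: C_def)
qed

lemma chain_err_nonneg: "chain_err \<theta> m x \<ge> 0"
  unfolding chain_err_def by (intro integral_nonneg_AE AE_I2 sum_nonneg step_err_nonneg) simp

lemma chain_err_tendsto_0:
  "(\<lambda>n. chain_err (\<theta> * real (Suc n) powr (1 / k - 1)) (Suc n) 1) \<longlonglongrightarrow> 0"
proof (rule tendstoI)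
  fix e :: real assume e: "e > 0"
  define D where "D = (real k + 2) * \<bar>\<theta>\<bar> * moment_base 1"
  have D: "D \<ge> 0" using moment_base_nonneg by (simp add: D_def)
  \<comment> \<open>First \<open>n\<close> tends to infinity, leaving \<open>D * \<epsilon>\<close>;
    this is below \<open>e\<close>, and \<open>D + 1\<close> avoids division by zero if
    \<open>D = 0\<close>.\<close>
  define \<epsilon> where "\<epsilon> = min (1 / 2) (e / (2 * (D + 1)))"
  have \<epsilon>: "0 < \<epsilon>" "\<epsilon> < 1" using e D by (auto simp: \<epsilon>_def min_less_iff_disj)
  have "D * \<epsilon> \<le> D * (e / (2 * (D + 1)))" using D by (intro mult_left_mono) (auto simp: \<epsilon>_def)
  also have "\<dots> < e" using D e by (simp add: field_simps add_strict_increasing2)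
  finally have De: "D * \<epsilon> < e" .
  define s where "s n = real (Suc n) powr (1 / k - 1)" for n
  have s: "s \<longlonglongrightarrow> 0" unfolding s_def by (rule LIMSEQ_Suc[OF scale_factor_tendsto_0])
  have "(\<lambda>n. (real k + 2) * \<bar>\<theta>\<bar> * (\<epsilon> * moment_base 1 + s n / (1 - tail \<epsilon>)) + 2 * \<theta>\<^sup>2 * s n * moment_base 1)
      \<longlonglongrightarrow> (real k + 2) * \<bar>\<theta>\<bar> * (\<epsilon> * moment_base 1 + 0 / (1 - tail \<epsilon>)) + 2 * \<theta>\<^sup>2 * 0 * moment_base 1"
    using tail_less_1[OF \<epsilon>(1)] by (intro tendsto_intros s) simp
  then have "\<forall>\<^sub>F n in sequentially.
      (real k + 2) * \<bar>\<theta>\<bar> * (\<epsilon> * moment_base 1 + s n / (1 - tail \<epsilon>)) + 2 * \<theta>\<^sup>2 * s n * moment_base 1 < e"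
    using De by (intro order_tendstoD(2)) (auto simp: D_def mult_ac)
  then show "\<forall>\<^sub>F n in sequentially. dist (chain_err (\<theta> * real (Suc n) powr (1 / k - 1)) (Suc n) 1) 0 < e"
  proof eventually_elim
    case (elim n)
    then show ?case using chain_err_le[OF \<epsilon>, of \<theta> n] chain_err_nonneg by (simp add: s_def)
  qed
qed

lemma char_sum_law: "char (sum_law n) \<theta> = chain_cf (\<theta> * real n powr (1 / k - 1)) n 1"
  unfolding char_def sum_law_def chain_cf_def
  by (subst integral_distr) (auto simp: scaled_sum_measurable scaled_sum_def mult.assoc)

section \<open>From the capped sum to the number of cuts\<close>

definition cut_law :: "nat \<Rightarrow> real measure" where
  "cut_law n = distr (measure_pmf (path_kcut_number k n)) borel (\<lambda>x. real n powr (- 1 + 1 / real k) * real x)"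

lemma real_distribution_cut_law: "real_distribution (cut_law n)"
  unfolding cut_law_def by (rule prob_space.real_distribution_distr[OF measure_pmf.prob_space_axioms]) simp

lemma char_cut_law:
  "char (cut_law n) \<theta> = (\<integral>x. iexp (\<theta> * real n powr (1 / k - 1)) ^ x \<partial>measure_pmf (path_kcut_number k n))"
  unfolding char_def cut_law_def iexp_power
  by (subst integral_distr) (auto simp: mult_ac add.commute)

lemma char_cut_law_limit:
  assumes "(\<lambda>n. char (sum_law (Suc n)) \<theta>) \<longlonglongrightarrow> L"
  shows "(\<lambda>n. char (cut_law n) \<theta>) \<longlonglongrightarrow> L"
proof -
  have "(\<lambda>n. char (cut_law (Suc n)) \<theta> - char (sum_law (Suc n)) \<theta>) \<longlonglongrightarrow> 0"
    by (rule Lim_null_comparison[OF always_eventually chain_err_tendsto_0])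
      (unfold char_cut_law char_sum_law, rule allI, rule path_kcut_number_chain_cf)
  from tendsto_add[OF this assms] have "(\<lambda>n. char (cut_law (Suc n)) \<theta>) \<longlonglongrightarrow> L" by simp
  then show ?thesis by (rule LIMSEQ_imp_Suc)
qed

text \<open>A lower bound growing faster than any \<open>c ^ q\<close>: the limit law has unbounded support.\<close>

lemma moment_fun_ge:
  assumes R: "R \<ge> 0" and q: "q > 0"
  shows "R ^ q * exp (- (1 / fact k) * R ^ k) \<le> enn2real (moment_fun k path_f q)"
proof (rule LIMSEQ_le)
  let ?d = "\<lambda>n. R * real (Suc n) powr (- 1 / k)"
  show "(\<lambda>n. R ^ q * tail (?d n) ^ Suc n) \<longlonglongrightarrow> R ^ q * exp (- (1 / fact k) * R ^ k)"
  proof (intro tendsto_mult tendsto_const)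
    have "(\<lambda>n. real n / real n) \<longlonglongrightarrow> 1"
      by (rule tendsto_eventually) (use eventually_gt_at_top[of 0] in \<open>eventually_elim, simp\<close>)
    from LIMSEQ_Suc[OF tail_power_limit[OF R this]]
    show "(\<lambda>n. tail (?d n) ^ Suc n) \<longlonglongrightarrow> exp (- (1 / fact k) * R ^ k)" by simp
  qed
  show "(\<lambda>n. \<integral>\<omega>. scaled_sum (Suc n) \<omega> ^ q \<partial>seqs) \<longlonglongrightarrow> enn2real (moment_fun k path_f q)"
    using sum_law_moments_limit[of q] unfolding sum_law_moments integral_scaled_sum_power .
  have "\<forall>\<^sub>F n in sequentially. ?d n < 1"
    by (rule order_tendstoD(2)[OF LIMSEQ_Suc[OF scale_tendsto_0]]) simp
  then have "\<forall>\<^sub>F n in sequentially. R ^ q * tail (?d n) ^ Suc n \<le>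
      (\<integral>\<omega>. scaled_sum (Suc n) \<omega> ^ q \<partial>seqs)"
  proof eventually_elim
    case (elim n)
    let ?E = "{\<omega>. ?d n < run_min 1 \<omega> (Suc n)}"
    have "R ^ q * tail (?d n) ^ Suc n = (\<integral>\<omega>. R ^ q * indicator ?E \<omega> \<partial>seqs)"
      using R elim run_min_gt_sets by (simp add: run_min_gt_prob del: run_min.simps)
    also have "\<dots> \<le> (\<integral>\<omega>. scaled_sum (Suc n) \<omega> ^ q \<partial>seqs)"
    proof (rule integral_mono_AE)
      show "integrable seqs (\<lambda>\<omega>. R ^ q * indicator ?E \<omega>)"
        by (intro integrable_mult_right) (simp add: run_min_gt_sets seq.P.emeasure_eq_measure del: run_min.simps)
      show "AE \<omega> in seqs. R ^ q * indicator ?E \<omega> \<le> scaled_sum (Suc n) \<omega> ^ q"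
        using AE_scaled_sum_nonneg[of "Suc n"]
      proof eventually_elim
        case (elim \<omega>)
        have "R \<le> scaled_sum (Suc n) \<omega>" if "\<omega> \<in> ?E"
        proof -
          have "nat \<lfloor>real (Suc n) * 1\<rfloor> = Suc n" by (simp only: mult_1_right floor_of_nat nat_int)
          with that have "R < scaled_min (Suc n) 1 \<omega>"
            using less_scaled_min_iff[of "Suc n" R 1 \<omega>] by (simp add: less_run_min_iff del: run_min.simps)
          \<comment> \<open>The last minimum is written as an average of \<open>Suc n\<close>
            copies; it is the smallest of the running minima, so the copies are bounded by the
            actual summands.\<close>
          also have "\<dots> = real (Suc n) powr (1 / k - 1) * (\<Sum>v<Suc n. run_min 1 \<omega> (Suc n))"
            using \<open>nat \<lfloor>real (Suc n) * 1\<rfloor> = Suc n\<close>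
            by (simp add: scaled_min_def powr_diff del: run_min.simps)
          also have "\<dots> \<le> scaled_sum (Suc n) \<omega>"
          proof -
            have "run_min 1 \<omega> (Suc n) \<le> run_min 1 \<omega> v" if "v \<le> Suc n" for v
              using that by (induction rule: inc_induct) auto
            then show ?thesis unfolding scaled_sum_def
              by (intro mult_left_mono sum_mono) auto
          qed
          finally show ?thesis by simp
        qed
        then show ?case using elim R by (auto simp: indicator_def intro!: power_mono)
      qed
    qed (rule integrable_scaled_sum_power)
    finally show ?case .
  qed
  then show "\<exists>N. \<forall>n\<ge>N. R ^ q * tail (?d n) ^ Suc n \<le>
      (\<integral>\<omega>. scaled_sum (Suc n) \<omega> ^ q \<partial>seqs)"
    unfolding eventually_sequentially .
qed

text \<open>A law concentrated at \<open>c\<close> has moments \<open>c ^ q\<close>, whereas with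
  \<open>R = \<bar>c\<bar> + 1\<close> the lower bound grows like a positive multiple of
  \<open>R ^ q\<close>.\<close>

lemma nondegenerate_of_moments:
  assumes "real_distribution M" and moments: "\<And>q. (\<integral>x. x ^ q \<partial>M) = enn2real (moment_fun k path_f q)"
  shows "nondegenerate M"
  unfolding nondegenerate_def
proof
  interpret M: real_distribution M by fact
  assume "\<exists>c. AE x in M. x = c"
  then obtain c where c: "AE x in M. x = c" by blast
  define R where "R = \<bar>c\<bar> + 1"
  define d where "d = exp (- (1 / fact k) * R ^ k)"
  have R: "R > 0" by (simp add: R_def)
  have "d \<le> (\<bar>c\<bar> / R) ^ q" if q: "q > 0" for q
  proof -
    have "(\<integral>x. x ^ q \<partial>M) = (\<integral>x. c ^ q \<partial>M)"
      by (rule integral_cong_AE) (use c in auto)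
    also have "\<dots> = c ^ q" using M.prob_space by simp
    finally have "R ^ q * d \<le> c ^ q"
      using moment_fun_ge[of R q] R q moments[of q] by (simp add: d_def)
    also have "\<dots> \<le> \<bar>c\<bar> ^ q" by (metis abs_ge_self power_abs)
    finally show ?thesis using R by (simp add: power_divide field_simps)
  qed
  moreover have "(\<lambda>q. (\<bar>c\<bar> / R) ^ q) \<longlonglongrightarrow> 0"
    by (rule LIMSEQ_realpow_zero) (auto simp: R_def)
  ultimately have "d \<le> 0"
    by (intro LIMSEQ_le_const) (auto intro: exI[of _ 1])
  then show False by (simp add: d_def)
qed

end

theorem lemma10:
  fixes k :: nat
  assumes "k \<ge> 2"
  shows "\<exists>Z_law :: real measure.
    real_distribution Z_law \<and>
    nondegenerate Z_law \<and>
    has_moments Z_law (moment_fun k path_f) \<and>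
    (\<forall>\<nu>. real_distribution \<nu> \<and> has_moments \<nu> (moment_fun k path_f) \<longrightarrow> \<nu> = Z_law) \<and>
    weak_conv_m
      (\<lambda>n. distr (measure_pmf (path_kcut_number k n)) borel
             (\<lambda>x. real n powr (- 1 + 1 / real k) * real x))
      Z_law"
proof -
  interpret path_cuts k by standard fact
  obtain Z where Z: "real_distribution Z" "\<And>q. integrable Z (\<lambda>x. x ^ q)"
    "\<And>q. (\<integral>x. x ^ q \<partial>Z) = enn2real (moment_fun k path_f q)" "weak_conv_m (\<lambda>n. sum_law (Suc n)) Z"
    using method_of_moments[of "\<lambda>n. sum_law (Suc n)" "\<lambda>q. enn2real (moment_fun k path_f q)",
        OF real_distribution_sum_law sum_law_moments(1) sum_law_moments_limit moment_fun_growth] by blast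
  \<comment> \<open>The comparison with \<open>sum_law\<close> concerns characteristic functions, so
    Levy's continuity theorem is used in both directions.\<close>
  have "weak_conv_m cut_law Z"
    by (rule levy_continuity[OF real_distribution_cut_law Z(1)])
      (rule char_cut_law_limit[OF levy_continuity1[OF real_distribution_sum_law Z(1) Z(4)]])
  moreover have "\<nu> = Z" if "real_distribution \<nu>" "has_moments \<nu> (moment_fun k path_f)" for \<nu>
    by (rule moments_determine_distribution[OF that(1) Z(1) _ Z(2) _ Z(3) moment_fun_growth])
      (use that(2) in \<open>auto simp: has_moments_def\<close>)
  moreover have "has_moments Z (moment_fun k path_f)"
    using Z(2,3) moment_fun_finite by (simp add: has_moments_def)
  ultimately show ?thesis
    using Z(1) nondegenerate_of_moments[OF Z(1,3)] unfolding cut_law_def[abs_def] by blast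
qed

end
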